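(* Let $\lambda$ be a partition of a positive integer $m$. (1) There exists a polynomial $T_\lambda\in\mathbb{Q}(x)[t_1,\dots,t_m]$ over the rational function field $\mathbb{Q}(x)$ such that for every $n\ge m$, every complex irreducible character $\chi$ of the symmetric group $S_n$ and every $g\in S_n$ of cycle type $\lambda$, the value $\chi(g)/\chi(1)$ is obtained from $T_\lambda$ by plugging in $x=n$ (the coefficients of $T_\lambda$ being defined at $x=n$) and $t_k=\chi(c_k)/\chi(1)$ for $1\le k\le m$, where $c_k\in S_n$ is a cycle of length $k$. (2) The same remains true if the cycles are replaced by other classes as follows. For each $1\le k\le m$ let $D_k$ be any cycle type whose elements can be written as a composition of $k-1$ transpositions but not of any smaller number of transpositions. Then there exists a polynomial $\tilde T_\lambda\in\mathbb{Q}(x)[t_1,\dots,t_m]$ such that for every $n\ge m$ for which all of $D_1,\dots,D_m$ occur as cycle types in $S_n$, every complex irreducible character $\chi$ of $S_n$ and every $g\in S_n$ of cycle type $\lambda$, the value $\chi(g)/\chi(1)$ is obtained from $\tilde T_\lambda$ by plugging in $x=n$ and $t_k=\chi(d_k)/\chi(1)$ for $1\le k\le m$, where $d_k\in S_n$ has cycle type $D_k$.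
   Context: For a partition $\lambda$ of $m$ and $n\geq m$, a permutation in $S_n$ is said to have cycle type $\lambda$ if its cycle type is the partition of $n$ obtained from $\lambda$ by adding $n-m$ parts equal to $1$. In the same way parts of size $1$ are disregarded when speaking of a cycle type $D_k$ independently of $n$; $D_k$ occurs in $S_n$ if and only if the sum of its parts of size at least $2$ is at most $n$. A cycle of length $1$ is the identity. *)

theory Defs
  imports
    "HOL-Algebra.Sym_Groups"
    "HOL-Combinatorics.Orbits"
    "HOL-Computational_Algebra.Computational_Algebra"
    "HOL-Library.Poly_Mapping"
    "Jordan_Normal_Form.VS_Connect"
begin

definition partition_of :: "nat multiset \<Rightarrow> nat \<Rightarrow> bool" where
  "partition_of \<mu> m \<longleftrightarrow> 0 \<notin># \<mu> \<and> sum_mset \<mu> = m"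

text \<open>The multiset is indexed by the set of orbits of \<open>g\<close> on \<open>{1..n}\<close>, so each orbit
  contributes its size exactly once; fixed points contribute parts equal to 1.\<close>

definition cycle_type :: "nat \<Rightarrow> (nat \<Rightarrow> nat) \<Rightarrow> nat multiset" where
  "cycle_type n g = image_mset card (mset_set (Orbits.orbit g ` {1..n}))"

definition has_cycle_type :: "nat \<Rightarrow> nat multiset \<Rightarrow> (nat \<Rightarrow> nat) \<Rightarrow> bool" where
  "has_cycle_type n \<mu> g \<longleftrightarrow> sum_mset \<mu> \<le> n
     \<and> cycle_type n g = \<mu> + replicate_mset (n - sum_mset \<mu>) 1"

text \<open>Here the parts equal to 1 of \<open>\<mu>\<close> are irrelevant, so that \<open>n\<close> may be smaller than the
  sum of all parts of \<open>\<mu>\<close>.\<close>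

definition has_reduced_cycle_type :: "nat \<Rightarrow> nat multiset \<Rightarrow> (nat \<Rightarrow> nat) \<Rightarrow> bool" where
  "has_reduced_cycle_type n \<mu> g \<longleftrightarrow>
     filter_mset (\<lambda>i. i \<ge> 2) (cycle_type n g) = filter_mset (\<lambda>i. i \<ge> 2) \<mu>"

definition occurs_in_sym :: "nat \<Rightarrow> nat multiset \<Rightarrow> bool" where
  "occurs_in_sym n \<mu> \<longleftrightarrow> (\<exists>g\<in>carrier (sym_group n). has_reduced_cycle_type n \<mu> g)"

text \<open>For \<open>k = 1\<close> the function \<^const>\<open>cycle_of_list\<close> yields the identity.\<close>

definition is_cycle_of_length :: "nat \<Rightarrow> nat \<Rightarrow> (nat \<Rightarrow> nat) \<Rightarrow> bool" where
  "is_cycle_of_length n k c \<longleftrightarrow>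
     (\<exists>cs. cycle cs \<and> length cs = k \<and> set cs \<subseteq> {1..n} \<and> c = cycle_of_list cs)"

text \<open>\<^prop>\<open>swapidseq j g\<close> says that \<open>g\<close> is a composition of exactly \<open>j\<close> transpositions.\<close>

definition min_transpositions :: "nat \<Rightarrow> (nat \<Rightarrow> nat) \<Rightarrow> bool" where
  "min_transpositions j g \<longleftrightarrow> swapidseq j g \<and> (\<forall>i<j. \<not> swapidseq i g)"

text \<open>The elements of a cycle type form conjugacy classes in symmetric groups of all sufficiently
  large degrees; the condition is imposed on all of them. Since parts are positive, there
  is always at least one such element.\<close>

definition type_of_length :: "nat \<Rightarrow> nat multiset \<Rightarrow> bool" where
  "type_of_length j \<mu> \<longleftrightarrow> 0 \<notin># \<mu> \<and>
     (\<forall>n. \<forall>g\<in>carrier (sym_group n). has_reduced_cycle_type n \<mu> g \<longrightarrow> min_transpositions j g)"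

definition mat_trace :: "complex mat \<Rightarrow> complex" where
  "mat_trace A = (\<Sum>i<dim_row A. A $$ (i, i))"

definition matrix_representation ::
  "('g, 'b) monoid_scheme \<Rightarrow> nat \<Rightarrow> ('g \<Rightarrow> complex mat) \<Rightarrow> bool" where
  "matrix_representation G d \<rho> \<longleftrightarrow> \<rho> \<in> hom G (units_of (ring_mat TYPE(complex) d ()))"

definition irreducible_representation ::
  "('g, 'b) monoid_scheme \<Rightarrow> nat \<Rightarrow> ('g \<Rightarrow> complex mat) \<Rightarrow> bool" where
  "irreducible_representation G d \<rho> \<longleftrightarrow> matrix_representation G d \<rho> \<and> d > 0 \<and>
     (\<forall>W. VectorSpace.subspace class_ring W (module_vec TYPE(complex) d) \<longrightarrow>
          (\<forall>g\<in>carrier G. \<forall>w\<in>W. \<rho> g *\<^sub>v w \<in> W) \<longrightarrow>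
          W = {0\<^sub>v d} \<or> W = carrier_vec d)"

definition irreducible_character :: "('g, 'b) monoid_scheme \<Rightarrow> ('g \<Rightarrow> complex) \<Rightarrow> bool" where
  "irreducible_character G \<chi> \<longleftrightarrow>
     (\<exists>d \<rho>. irreducible_representation G d \<rho> \<and> (\<forall>g\<in>carrier G. \<chi> g = mat_trace (\<rho> g)))"

definition normalized_character :: "nat \<Rightarrow> ((nat \<Rightarrow> nat) \<Rightarrow> complex) \<Rightarrow> (nat \<Rightarrow> nat) \<Rightarrow> complex" where
  "normalized_character n \<chi> g = \<chi> g / \<chi> \<one>\<^bsub>sym_group n\<^esub>"

text \<open>A polynomial in variables indexed by natural numbers is a finitely supported map from
  exponent vectors to coefficients; \<^typ>\<open>rat poly fract\<close> is the field of rational functions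
  in one variable over the rationals.\<close>

type_synonym ratfun_mpoly = "(nat \<Rightarrow>\<^sub>0 nat) \<Rightarrow>\<^sub>0 rat poly fract"

definition in_variables :: "ratfun_mpoly \<Rightarrow> nat set \<Rightarrow> bool" where
  "in_variables T V \<longleftrightarrow> (\<forall>e\<in>Poly_Mapping.keys T. Poly_Mapping.keys e \<subseteq> V)"

definition ratfun_defined_at :: "rat poly fract \<Rightarrow> rat \<Rightarrow> bool" where
  "ratfun_defined_at r a \<longleftrightarrow> (\<exists>p q. r = Fract p q \<and> poly q a \<noteq> 0)"

definition ratfun_eval :: "rat poly fract \<Rightarrow> rat \<Rightarrow> rat" where
  "ratfun_eval r a = (THE v. \<exists>p q. r = Fract p q \<and> poly q a \<noteq> 0 \<and> v = poly p a / poly q a)"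

lemma ratfun_eval_Fract:
  assumes "poly q a \<noteq> 0"
  shows "ratfun_eval (Fract p q) a = poly p a / poly q a"
  unfolding ratfun_eval_def
proof (rule the_equality)
  show "\<exists>p' q'. Fract p q = Fract p' q' \<and> poly q' a \<noteq> 0 \<and> poly p a / poly q a = poly p' a / poly q' a"
    using assms by blast
next
  fix v
  assume "\<exists>p' q'. Fract p q = Fract p' q' \<and> poly q' a \<noteq> 0 \<and> v = poly p' a / poly q' a"
  then obtain p' q' where eq: "Fract p q = Fract p' q'" and q': "poly q' a \<noteq> 0"
    and v: "v = poly p' a / poly q' a"
    by blast
  have "q \<noteq> 0" "q' \<noteq> 0"
    using assms q' by auto
  then have "p * q' = p' * q"
    using eq by (simp add: eq_fract)
  then have "poly p a * poly q' a = poly p' a * poly q a"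
    by (metis poly_mult)
  then show "v = poly p a / poly q a"
    using assms q' v by (simp add: frac_eq_eq)
qed

definition coeffs_defined_at :: "ratfun_mpoly \<Rightarrow> rat \<Rightarrow> bool" where
  "coeffs_defined_at T a \<longleftrightarrow>
     (\<forall>e\<in>Poly_Mapping.keys T. ratfun_defined_at (Poly_Mapping.lookup T e) a)"

definition plug_in :: "ratfun_mpoly \<Rightarrow> rat \<Rightarrow> (nat \<Rightarrow> complex) \<Rightarrow> complex" where
  "plug_in T a t =
     (\<Sum>e\<in>Poly_Mapping.keys T. of_rat (ratfun_eval (Poly_Mapping.lookup T e) a) *
        (\<Prod>k\<in>Poly_Mapping.keys e. t k ^ Poly_Mapping.lookup e k))"

end

theory Submission
  imports Defs "Jordan_Normal_Form.Char_Poly"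
begin

text \<open>
  Write \<open>F(g) = \<chi>(g)/\<chi>(1)\<close>. By Schur's lemma a class sum acts on an irreducible representation as
  a scalar, so \<open>F(g) F(h)\<close> is the mean of \<open>F(g s h s\<inverse>)\<close> over all \<open>s\<close> in the symmetric group
  (\<open>irreducible_character_is_central\<close>). The rest of the proof works with class functions that satisfy
  this equation and \<open>F(1) = 1\<close>.

  For a list \<open>L\<close> of cycle lengths with sum \<open>r\<close> let \<open>S(L)\<close> be \<open>n (n-1) \<dots> (n-r+1) F(g)\<close> for \<open>g\<close> of type \<open>L\<close>
  (\<open>scaled_value\<close>). To multiply \<open>S([a])\<close> by \<open>S(M)\<close>, fix an \<open>a\<close>-cycle and let a product of type \<open>M\<close> run
  over all its placements in \<open>{1..n}\<close>. How a placement meets the fixed cycle is recorded by an overlap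
  pattern; there are finitely many patterns, independently of \<open>n\<close>, and a placement with a given pattern
  is determined up to conjugacy. The number of placements with a given pattern is a falling factorial;
  together with the factor \<open>n (n-1) \<dots> (n-a+1)\<close> of the fixed cycle it turns the value of \<open>F\<close> on the product
  into a scaled value again.
  So \<open>S([a]) S(M)\<close> is a sum of scaled values, with the same terms for all \<open>n\<close> (\<open>scaled_value_mult\<close>).

  The least number of transpositions needed for a permutation of type \<open>L\<close> is the sum of all \<open>l - 1\<close>
  (\<open>excess\<close>). It is subadditive, and strictly so in the product above as soon as one cycle of \<open>M\<close>
  meets the fixed cycle in two points. If all of them meet it in at most one point, the cycles that are
  touched merge with the fixed one into a single longer cycle and the others stay as they are. Up to
  terms of smaller length, multiplication therefore only merges cycles, and \<open>S(a # M)\<close>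
  itself is the term without contact. By induction on the length \<open>d\<close> and on the number of cycles,
  for \<open>L\<close> without parts 1 the value \<open>S(L)\<close> equals \<open>\<alpha>(L) S([d+1])\<close> plus a polynomial in \<open>n, S([2]), \<dots>, S([d])\<close>
  (\<open>placements_modulo_shorter\<close>, \<open>defect_in_cycle_polys\<close>), where
  \<open>\<alpha>(L)\<close> is a closed nonzero constant (\<open>cycle_coeff\<close>), not merely a nonzero function of \<open>n\<close>.

  Since \<open>\<alpha>(L)\<close> never vanishes, the passage from the cycles to any other choice of one type for
  each length is triangular and invertible without denominators (\<open>cycle_polys_change_generators\<close>). The only
  division is the final one by \<open>n (n-1) \<dots> (n-r+1)\<close> with \<open>r \<le> m\<close>, which has no zero at \<open>n \<ge> m\<close>. The statement
  about cycles is the case in which the chosen types are single cycles.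
\<close>

section \<open>Cycle systems and their length\<close>

fun product_of_cycles :: "'a list list \<Rightarrow> 'a \<Rightarrow> 'a" where
  "product_of_cycles [] = id"
| "product_of_cycles (cs # css) = cycle_of_list cs \<circ> product_of_cycles css"

lemma distinct_in_concat:
  "distinct (concat css) \<Longrightarrow> cs \<in> set css \<Longrightarrow> distinct cs"
  by (induction css) auto

lemma product_of_cycles_append:
  "product_of_cycles (css @ dss) = product_of_cycles css \<circ> product_of_cycles dss"
  by (induction css) (auto simp: comp_assoc)

lemma product_of_cycles_permutes: "product_of_cycles css permutes (set (concat css))"
proof (induction css)
  case (Cons cs css)
  have "cycle_of_list cs permutes (set (concat (cs # css)))"
    by (rule permutes_subset[OF cycle_permutes]) auto
  moreover have "product_of_cycles css permutes (set (concat (cs # css)))"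
    by (rule permutes_subset[OF Cons]) auto
  ultimately show ?case unfolding product_of_cycles.simps by (rule permutes_compose[rotated])
qed (simp only: product_of_cycles.simps permutes_id)

lemma product_of_cycles_permutes':
  "set (concat css) \<subseteq> S \<Longrightarrow> product_of_cycles css permutes S"
  using permutes_subset[OF product_of_cycles_permutes] .

lemma cycle_of_list_in: "x \<in> set cs \<Longrightarrow> cycle_of_list cs x \<in> set cs"
  using permutes_in_image[OF cycle_permutes] by metis

lemma product_of_cycles_apply:
  assumes "distinct (concat css)" "cs \<in> set css" "x \<in> set cs"
  shows "product_of_cycles css x = cycle_of_list cs x"
  using assms
proof (induction css)
  case (Cons ds css)
  have disj: "set ds \<inter> set (concat css) = {}" using Cons.prems(1) by auto
  show ?case
  proof (cases "cs \<in> set css")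
    case True
    then have "product_of_cycles css x = cycle_of_list cs x" using Cons by simp
    moreover have "cycle_of_list cs x \<notin> set ds"
      using cycle_of_list_in[OF Cons.prems(3)] True disj by auto
    ultimately show ?thesis by (simp add: id_outside_supp)
  next
    case False
    then have "cs = ds" using Cons.prems by simp
    then have "x \<notin> set (concat css)" using disj Cons.prems(3) by auto
    then have "product_of_cycles css x = x"
      using product_of_cycles_permutes by (metis permutes_not_in)
    then show ?thesis using \<open>cs = ds\<close> by simp
  qed
qed simp

lemma mset_concat_cong:
  assumes "mset css = mset dss"
  shows "mset (concat css) = mset (concat dss)"
  using assms by (simp add: mset_concat flip: sum_mset_sum_list)

lemma product_of_cycles_cong_mset:
  assumes "mset css = mset dss" "distinct (concat css)"
  shows "product_of_cycles css = product_of_cycles dss"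
proof
  fix x
  have "mset (concat css) = mset (concat dss)" by (rule mset_concat_cong[OF assms(1)])
  then have d: "distinct (concat dss)" using assms(2) mset_eq_imp_distinct_iff[of "concat css" "concat dss"] by simp
  have s: "set css = set dss" using assms(1) by (rule mset_eq_setD)
  show "product_of_cycles css x = product_of_cycles dss x"
  proof (cases "x \<in> set (concat css)")
    case True
    then obtain cs where cs: "cs \<in> set css" "x \<in> set cs" by auto
    then show ?thesis
      using product_of_cycles_apply[OF assms(2) cs] product_of_cycles_apply[OF d _ cs(2)] s by simp
  next
    case False
    moreover from False have "x \<notin> set (concat dss)" using s by simp
    ultimately show ?thesis
      using product_of_cycles_permutes by (metis permutes_not_in)
  qed
qed

text \<open>
  Relabelling the points is conjugation; this is what makes a class function depend on the cycle
  lengths only.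
\<close>

lemma product_of_cycles_conj:
  assumes "bij s" "\<And>cs. cs \<in> set css \<Longrightarrow> distinct cs"
  shows "product_of_cycles (map (map s) css) = s \<circ> product_of_cycles css \<circ> inv_into UNIV s"
  using assms(2)
proof (induction css)
  case Nil
  then show ?case using assms(1) by (simp add: fun_eq_iff bij_is_surj surj_f_inv_f)
next
  case (Cons cs css)
  have "inv_into UNIV s \<circ> s = id" using assms(1) by (simp add: bij_is_inj)
  then have "s \<circ> (cycle_of_list cs \<circ> product_of_cycles css) \<circ> inv_into UNIV s
     = (s \<circ> cycle_of_list cs \<circ> inv_into UNIV s) \<circ> (s \<circ> product_of_cycles css \<circ> inv_into UNIV s)"
    by (simp add: fun_eq_iff)
  moreover have "s \<circ> cycle_of_list cs \<circ> inv_into UNIV s = cycle_of_list (map s cs)"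
    using conjugation_of_cycle[OF _ assms(1), of cs] Cons.prems by simp
  moreover have "product_of_cycles (map (map s) css) = s \<circ> product_of_cycles css \<circ> inv_into UNIV s"
    by (rule Cons.IH) (simp add: Cons.prems)
  ultimately show ?case unfolding product_of_cycles.simps list.map by (simp only:)
qed

text \<open>
  For the list of all cycle lengths of a permutation this is its distance from the identity in the
  Cayley graph generated by the transpositions; parts equal to 1 do not contribute.
\<close>

definition excess :: "nat list \<Rightarrow> nat" where
  "excess L = (\<Sum>l\<leftarrow>L. l - 1)"

lemma excess_simps [simp]:
  "excess [] = 0" "excess (l # L) = l - 1 + excess L" "excess (L @ M) = excess L + excess M"
  by (simp_all add: excess_def)

lemma excess_add_length:
  assumes "0 \<notin> set L" shows "excess L + length L = sum_list L"
  using assms by (induction L) auto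

lemma swapidseq_cycle_of_list:
  "distinct cs \<Longrightarrow> swapidseq (length cs - 1) (cycle_of_list cs)"
proof (induction cs rule: cycle_of_list.induct)
  case (1 i j cs)
  then have "swapidseq (length cs) (cycle_of_list (j # cs))" "i \<noteq> j" by auto
  moreover have "length (i # j # cs) - 1 = Suc (length cs)" by simp
  ultimately show ?case unfolding cycle_of_list.simps by (metis swapidseq.comp_Suc)
qed auto

lemma swapidseq_product_of_cycles:
  assumes "\<And>cs. cs \<in> set css \<Longrightarrow> distinct cs"
  shows "swapidseq (excess (map length css)) (product_of_cycles css)"
  using assms
proof (induction css)
  case (Cons cs css)
  have "swapidseq (length cs - 1) (cycle_of_list cs)"
    by (rule swapidseq_cycle_of_list) (simp add: Cons.prems)
  moreover have "swapidseq (excess (map length css)) (product_of_cycles css)"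
    by (rule Cons.IH) (simp add: Cons.prems)
  ultimately have *: "swapidseq (length cs - 1) (cycle_of_list cs)"
    "swapidseq (excess (map length css)) (product_of_cycles css)" .
  from swapidseq_comp_add[OF *] show ?case
    unfolding product_of_cycles.simps excess_simps list.map .
qed simp

text \<open>
  Regard the \<open>j\<close> transpositions as edges of a graph. The graph has at least \<open>card S - j\<close> components
  in \<open>S\<close>, and the permutation maps every component to itself; \<open>f\<close> names the components. Each
  further edge merges at most two of them.
\<close>

lemma swapidseq_invariant_map:
  assumes "swapidseq j p" "finite S"
  shows "\<exists>f :: 'a \<Rightarrow> 'a. (\<forall>x. f (p x) = f x) \<and> card S \<le> card (f ` S) + j"
  using assms(1)
proof (induction j p rule: swapidseq.induct)
  case id
  show ?case by (rule exI[of _ id]) simp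
next
  case (comp_Suc j p a b)
  then obtain f :: "'a \<Rightarrow> 'a" where f: "\<forall>x. f (p x) = f x" "card S \<le> card (f ` S) + j"
    by blast
  define h where "h = (\<lambda>x. if f x = f a then f b else f x)"
  have "h ((transpose a b \<circ> p) x) = h x" for x
  proof -
    have "f (transpose a b (p x)) \<in> (if f x \<in> {f a, f b} then {f a, f b} else {f x})"
      using f(1) by (auto simp: transpose_def)
    then show ?thesis by (auto simp: h_def split: if_splits)
  qed
  moreover have "card (f ` S) \<le> card (h ` S) + 1"
  proof -
    have "f ` S \<subseteq> insert (f a) (h ` S)" by (auto simp: h_def image_iff)
    then have "card (f ` S) \<le> card (insert (f a) (h ` S))"
      using assms(2) by (intro card_mono) auto
    also have "\<dots> \<le> card (h ` S) + 1" using assms(2) by (simp add: card_insert_if)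
    finally show ?thesis .
  qed
  ultimately show ?case using f(2) by (intro exI[of _ h]) auto
qed

lemma cycle_of_list_nth:
  assumes "distinct cs" "i < length cs"
  shows "cycle_of_list cs (cs ! i) = cs ! (Suc i mod length cs)"
proof -
  have "map (cycle_of_list cs) cs = rotate1 cs"
    using cyclic_rotation[OF assms(1), of 1] by simp
  then have "map (cycle_of_list cs) cs ! i = rotate1 cs ! i" by simp
  then show ?thesis using assms(2) by (simp add: nth_rotate1)
qed

lemma invariant_map_constant_on_cycle:
  assumes "distinct (concat css)" "cs \<in> set css" "\<forall>x. f (product_of_cycles css x) = f x" "x \<in> set cs"
  shows "f x = f (hd cs)"
proof -
  have dc: "distinct cs" using distinct_in_concat[OF assms(1,2)] .
  have ne: "cs \<noteq> []" using assms(4) by auto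
  have "i < length cs \<Longrightarrow> f (cs ! i) = f (cs ! 0)" for i
  proof (induction i)
    case (Suc i)
    have "f (cs ! Suc i) = f (cycle_of_list cs (cs ! i))"
      using Suc.prems cycle_of_list_nth[OF dc, of i] by simp
    also have "\<dots> = f (product_of_cycles css (cs ! i))"
      using product_of_cycles_apply[OF assms(1,2)] Suc.prems by simp
    also have "\<dots> = f (cs ! i)" using assms(3) by simp
    finally show ?case using Suc by simp
  qed simp
  then show ?thesis using assms(4) ne by (metis hd_conv_nth in_set_conv_nth)
qed

text \<open>
  A map that is invariant under the permutation is constant on its cycles, so it takes at most as many
  values as there are cycles.
\<close>

lemma excess_le_swapidseq:
  fixes css :: "'a list list"
  assumes "distinct (concat css)" "[] \<notin> set css" "swapidseq j (product_of_cycles css)"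
  shows "excess (map length css) \<le> j"
proof -
  define S where "S = set (concat css)"
  have "finite S" by (simp add: S_def)
  from swapidseq_invariant_map[OF assms(3) this] obtain f :: "'a \<Rightarrow> 'a"
    where f: "\<forall>x. f (product_of_cycles css x) = f x" "card S \<le> card (f ` S) + j"
    by blast
  have "f ` S \<subseteq> (f \<circ> hd) ` set css"
  proof
    fix y assume "y \<in> f ` S"
    then obtain x cs where x: "y = f x" "cs \<in> set css" "x \<in> set cs" by (auto simp: S_def)
    then have "y = (f \<circ> hd) cs"
      using invariant_map_constant_on_cycle[OF assms(1) x(2) f(1) x(3)] by simp
    then show "y \<in> (f \<circ> hd) ` set css" using x(2) by blast
  qed
  then have "card (f ` S) \<le> card ((f \<circ> hd) ` set css)" by (intro card_mono) auto
  also have "\<dots> \<le> length css" by (meson card_image_le card_length le_trans List.finite_set)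
  finally have "card S \<le> length css + j" using f(2) by simp
  moreover have "card S = sum_list (map length css)"
    unfolding S_def distinct_card[OF assms(1)] length_concat ..
  moreover have "0 \<notin> set (map length css)" using assms(2) by auto
  then have "excess (map length css) + length css = sum_list (map length css)"
    using excess_add_length[of "map length css"] by simp
  ultimately show ?thesis by simp
qed

lemma cyclic_on_cycle:
  assumes "distinct (concat css)" "cs \<in> set css" "cs \<noteq> []"
  shows "cyclic_on (product_of_cycles css) (set cs)"
proof -
  define p where "p = product_of_cycles css"
  have dc: "distinct cs" using distinct_in_concat[OF assms(1,2)] .
  have perm: "permutation p" unfolding p_def
    using product_of_cycles_permutes permutation_permutes by blast
  have p: "p x = cycle_of_list cs x" if "x \<in> set cs" for x
    using product_of_cycles_apply[OF assms(1,2) that] by (simp add: p_def)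
  have "i < length cs \<Longrightarrow> cs ! i \<in> Orbits.orbit p (cs ! 0)" for i
  proof (induction i)
    case 0
    show ?case by (rule permutation_self_in_orbit[OF perm])
  next
    case (Suc i)
    then have "p (cs ! i) \<in> Orbits.orbit p (cs ! 0)" by (auto intro: orbit.step)
    then show ?case using p[of "cs ! i"] Suc.prems cycle_of_list_nth[OF dc, of i] by simp
  qed
  then have "set cs \<subseteq> Orbits.orbit p (cs ! 0)" by (auto simp: in_set_conv_nth)
  moreover have "Orbits.orbit p (cs ! 0) \<subseteq> set cs"
  proof
    fix y assume "y \<in> Orbits.orbit p (cs ! 0)"
    then show "y \<in> set cs"
      by induction (use assms(3) in \<open>auto simp: p cycle_of_list_in\<close>)
  qed
  ultimately have "set cs = Orbits.orbit p (cs ! 0)" by auto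
  moreover have "cs ! 0 \<in> set cs" using assms(3) by simp
  ultimately show ?thesis using cyclic_on_singleI[of "cs ! 0" "set cs" p] by (simp only: p_def)
qed

lemma cycle_type_product_of_cycles:
  assumes "distinct (concat css)" "[] \<notin> set css" "set (concat css) = {1..n}"
  shows "cycle_type n (product_of_cycles css) = mset (map length css)"
proof -
  let ?p = "product_of_cycles css"
  have orb: "Orbits.orbit ?p x = set cs" if "cs \<in> set css" "x \<in> set cs" for cs x
  proof -
    have "cs \<noteq> []" using that(2) by auto
    then show ?thesis
      using orbit_cyclic_eq3[OF cyclic_on_cycle[OF assms(1) that(1)] that(2)] by simp
  qed
  have orbits: "Orbits.orbit ?p ` {1..n} = set ` set css"
  proof
    show "Orbits.orbit ?p ` {1..n} \<subseteq> set ` set css"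
    proof
      fix X assume "X \<in> Orbits.orbit ?p ` {1..n}"
      then obtain x cs where "X = Orbits.orbit ?p x" "cs \<in> set css" "x \<in> set cs"
        unfolding assms(3)[symmetric] by auto
      then show "X \<in> set ` set css" using orb by blast
    qed
    show "set ` set css \<subseteq> Orbits.orbit ?p ` {1..n}"
    proof
      fix X assume "X \<in> set ` set css"
      then obtain cs where cs: "cs \<in> set css" "X = set cs" by auto
      then have "hd cs \<in> set cs" using assms(2) by (metis hd_in_set)
      moreover have "hd cs \<in> {1..n}" using calculation cs assms(3) by auto
      ultimately show "X \<in> Orbits.orbit ?p ` {1..n}" using orb cs by (metis imageI)
    qed
  qed
  have distinct_sets: "distinct (map set css)"
    using assms(1,2)
  proof (induction css)
    case (Cons cs css)
    have "set ds \<noteq> set cs" if "ds \<in> set css" for ds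
    proof
      assume eq: "set ds = set cs"
      have "set cs \<subseteq> set (concat css)"
        using UN_upper[OF that, of set] unfolding set_concat eq .
      then have "set cs \<inter> set (concat css) = set cs" by (rule Int_absorb2)
      moreover have "set cs \<inter> set (concat css) = {}"
        using Cons.prems(1) unfolding concat.simps distinct_append by (rule conjunct2[OF conjunct2])
      ultimately have "set cs = {}" by (rule trans[OF sym])
      then have "cs = []" by simp
      then show False using Cons.prems(2) by (simp only: list.set insert_iff simp_thms)
    qed
    then have "set cs \<notin> set (map set css)" unfolding list.set_map by blast
    moreover have "distinct (map set css)"
      by (rule Cons.IH) (use Cons.prems in simp_all)
    ultimately show ?case unfolding list.map distinct.simps by (rule conjI)
  qed simp
  have "mset_set (set ` set css) = mset (map set css)"
    using mset_set_set[OF distinct_sets] unfolding list.set_map .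
  then have "cycle_type n ?p = mset (map card (map set css))"
    unfolding cycle_type_def orbits mset_map by (rule arg_cong)
  also have "map card (map set css) = map length css"
    using distinct_in_concat[OF assms(1)] by (auto simp: distinct_card)
  finally show ?thesis .
qed

text \<open>
  Fixed points appear as cycles of length 1, so that the cycles cover \<open>S\<close>.
\<close>

lemma cycles_decomposition:
  assumes "g permutes S" "finite S"
  shows "\<exists>css. distinct (concat css) \<and> [] \<notin> set css \<and> set (concat css) = S \<and> g = product_of_cycles css"
proof -
  have "cycle_decomp S g" using cycle_decomposition[OF assms] .
  then show ?thesis
  proof (induction rule: cycle_decomp.induct)
    case empty
    show ?case by (rule exI[of _ "[]"]) auto
  next
    case (comp I p cs)
    then obtain css where css: "distinct (concat css)" "[] \<notin> set css" "set (concat css) = I" "p = product_of_cycles css"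
      by blast
    show ?case
    proof (cases "cs = []")
      case True
      then show ?thesis using css by (intro exI[of _ css]) auto
    next
      case False
      then show ?thesis using css comp by (intro exI[of _ "cs # css"]) auto
    qed
  qed
qed

text \<open>
  Only the cycles listed in \<open>L\<close> are prescribed, all other points being fixed. In contrast to
  \<open>cycle_type\<close>, the lengths come in a fixed order and can be matched with explicit placements.
\<close>

definition is_product_of_type :: "nat \<Rightarrow> nat list \<Rightarrow> (nat \<Rightarrow> nat) \<Rightarrow> bool" where
  "is_product_of_type n L g \<longleftrightarrow> (\<exists>css. distinct (concat css) \<and> set (concat css) \<subseteq> {1..n}
     \<and> map length css = L \<and> g = product_of_cycles css)"

lemma mset_map_eq_obtain:
  assumes "image_mset f (mset xs) = mset ys"
  shows "\<exists>xs'. mset xs' = mset xs \<and> map f xs' = ys"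
  using assms
proof (induction ys arbitrary: xs)
  case (Cons y ys)
  then have "y \<in># image_mset f (mset xs)" by simp
  then obtain x where x: "x \<in> set xs" "f x = y" by auto
  have m: "mset xs = add_mset x (mset (remove1 x xs))" using x(1) by simp
  have "image_mset f (mset xs) = add_mset (f x) (image_mset f (mset (remove1 x xs)))"
    by (subst m) (rule image_mset_add_mset)
  then have "image_mset f (mset (remove1 x xs)) = mset ys"
    unfolding Cons.prems x(2) mset.simps by simp
  then obtain zs where zs: "mset zs = mset (remove1 x xs)" "map f zs = ys" using Cons.IH by blast
  have "mset (x # zs) = mset xs" unfolding mset.simps zs(1) by (rule m[symmetric])
  moreover have "map f (x # zs) = y # ys" using zs(2) x(2) by simp
  ultimately show ?case by (intro exI[of _ "x # zs"] conjI)
qed auto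

lemma product_of_cycles_filter_nontrivial:
  "product_of_cycles (filter (\<lambda>cs. 2 \<le> length cs) css) = product_of_cycles css"
proof (induction css)
  case (Cons cs css)
  show ?case
  proof (cases "2 \<le> length cs")
    case True
    then show ?thesis by (simp only: filter.simps if_True product_of_cycles.simps Cons)
  next
    case False
    then have "cycle_of_list cs = id" by (cases cs rule: cycle_of_list.cases) auto
    with False show ?thesis by (simp only: filter.simps if_False product_of_cycles.simps Cons id_comp)
  qed
qed simp

lemma distinct_concat_filter:
  "distinct (concat css) \<Longrightarrow> distinct (concat (filter P css))"
proof (induction css)
  case (Cons cs css)
  have sub: "set (concat (filter P css)) \<subseteq> set (concat css)"
    unfolding set_concat by (rule UN_mono) auto
  have d: "distinct cs" "distinct (concat css)" "set cs \<inter> set (concat css) = {}"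
    using Cons.prems unfolding concat.simps distinct_append by (rule conjunct1, metis, metis)
  have "set cs \<inter> set (concat (filter P css)) = {}"
    using Int_mono[OF subset_refl sub, of "set cs"] unfolding d(3) by (rule subset_empty[THEN iffD1])
  then have "distinct (concat (cs # filter P css))"
    unfolding concat.simps distinct_append using d(1) Cons.IH[OF d(2)] by (intro conjI)
  then show ?case using Cons.IH[OF d(2)] by (cases "P cs") (simp_all only: filter.simps if_True if_False)
qed simp

lemma is_product_of_cycle_type:
  assumes "g permutes {1..n}" "mset L = filter_mset (\<lambda>i. 2 \<le> i) (cycle_type n g)"
  shows "is_product_of_type n L g"
proof -
  obtain css where css: "distinct (concat css)" "[] \<notin> set css" "set (concat css) = {1..n}" "g = product_of_cycles css"
    using cycles_decomposition[OF assms(1) finite_atLeastAtMost] by (elim exE conjE)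
  define dss where "dss = filter (\<lambda>cs. 2 \<le> length cs) css"
  have "set (concat dss) \<subseteq> set (concat css)" unfolding dss_def set_concat by (rule UN_mono) auto
  then have d: "distinct (concat dss)" "set (concat dss) \<subseteq> {1..n}"
    using distinct_concat_filter[OF css(1)] unfolding css(3) dss_def by simp_all
  have g: "g = product_of_cycles dss"
    unfolding css(4) dss_def by (rule product_of_cycles_filter_nontrivial[symmetric])
  have "mset L = filter_mset (\<lambda>i. 2 \<le> i) (mset (map length css))"
    unfolding assms(2) css(4) cycle_type_product_of_cycles[OF css(1-3)] ..
  also have "\<dots> = image_mset length (mset dss)"
    unfolding dss_def by (simp add: filter_mset_image_mset)
  finally obtain ess where ess: "mset ess = mset dss" "map length ess = L"
    using mset_map_eq_obtain[of length dss L] by metis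
  have "g = product_of_cycles ess"
    unfolding g by (rule product_of_cycles_cong_mset[OF ess(1)[symmetric] d(1)])
  moreover have m: "mset (concat ess) = mset (concat dss)" by (rule mset_concat_cong[OF ess(1)])
  have "distinct (concat ess)" "set (concat ess) \<subseteq> {1..n}"
    using d mset_eq_imp_distinct_iff[OF m] mset_eq_setD[OF m] by simp_all
  ultimately show ?thesis unfolding is_product_of_type_def using ess(2) by (intro exI[of _ ess] conjI)
qed

section \<open>Schur's lemma and central characters\<close>

lemma mat_trace_mult_commute:
  assumes "A \<in> carrier_mat d d" "B \<in> carrier_mat d d"
  shows "mat_trace (A * B) = mat_trace (B * A)"
proof -
  have "mat_trace (A * B) = (\<Sum>i<d. \<Sum>k<d. A $$ (i, k) * B $$ (k, i))"
    using assms by (simp add: mat_trace_def scalar_prod_def atLeast0LessThan)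
  also have "\<dots> = (\<Sum>k<d. \<Sum>i<d. A $$ (i, k) * B $$ (k, i))" by (rule sum.swap)
  also have "\<dots> = (\<Sum>k<d. \<Sum>i<d. B $$ (k, i) * A $$ (i, k))" by (simp only: mult.commute)
  also have "\<dots> = mat_trace (B * A)"
    using assms by (simp add: mat_trace_def scalar_prod_def atLeast0LessThan)
  finally show ?thesis .
qed

text \<open>
  The sum is taken entrywise because matrices of varying dimension form no additive monoid.
\<close>

definition sum_of_mats :: "nat \<Rightarrow> ('i \<Rightarrow> complex mat) \<Rightarrow> 'i set \<Rightarrow> complex mat" where
  "sum_of_mats d A I = mat d d (\<lambda>ij. \<Sum>s\<in>I. A s $$ ij)"

lemma sum_of_mats_carrier: "sum_of_mats d A I \<in> carrier_mat d d"
  by (simp add: sum_of_mats_def)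

lemma mult_sum_of_mats:
  assumes "B \<in> carrier_mat d d" "\<And>s. s \<in> I \<Longrightarrow> A s \<in> carrier_mat d d"
  shows "B * sum_of_mats d A I = sum_of_mats d (\<lambda>s. B * A s) I"
proof (rule eq_matI)
  fix i j assume ij: "i < dim_row (sum_of_mats d (\<lambda>s. B * A s) I)" "j < dim_col (sum_of_mats d (\<lambda>s. B * A s) I)"
  then have ij: "i < d" "j < d" by (simp_all add: sum_of_mats_def)
  have "(B * sum_of_mats d A I) $$ (i, j) = (\<Sum>k<d. B $$ (i, k) * (\<Sum>s\<in>I. A s $$ (k, j)))"
    using assms(1) ij by (simp add: sum_of_mats_def scalar_prod_def atLeast0LessThan)
  also have "\<dots> = (\<Sum>k<d. \<Sum>s\<in>I. B $$ (i, k) * A s $$ (k, j))" by (simp only: sum_distrib_left)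
  also have "\<dots> = (\<Sum>s\<in>I. \<Sum>k<d. B $$ (i, k) * A s $$ (k, j))" by (rule sum.swap)
  also have "\<dots> = (\<Sum>s\<in>I. (B * A s) $$ (i, j))"
  proof (rule sum.cong)
    fix s assume "s \<in> I"
    then have "A s \<in> carrier_mat d d" by (rule assms(2))
    then show "(\<Sum>k<d. B $$ (i, k) * A s $$ (k, j)) = (B * A s) $$ (i, j)"
      using assms(1) ij by (simp add: scalar_prod_def atLeast0LessThan)
  qed (rule refl)
  also have "\<dots> = sum_of_mats d (\<lambda>s. B * A s) I $$ (i, j)"
    using ij by (simp add: sum_of_mats_def)
  finally show "(B * sum_of_mats d A I) $$ (i, j) = sum_of_mats d (\<lambda>s. B * A s) I $$ (i, j)" .
qed (use assms(1) in \<open>simp_all add: sum_of_mats_def\<close>)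

lemma sum_of_mats_mult:
  assumes "B \<in> carrier_mat d d" "\<And>s. s \<in> I \<Longrightarrow> A s \<in> carrier_mat d d"
  shows "sum_of_mats d A I * B = sum_of_mats d (\<lambda>s. A s * B) I"
proof (rule eq_matI)
  fix i j assume ij: "i < dim_row (sum_of_mats d (\<lambda>s. A s * B) I)" "j < dim_col (sum_of_mats d (\<lambda>s. A s * B) I)"
  then have ij: "i < d" "j < d" by (simp_all add: sum_of_mats_def)
  have "(sum_of_mats d A I * B) $$ (i, j) = (\<Sum>k<d. (\<Sum>s\<in>I. A s $$ (i, k)) * B $$ (k, j))"
    using assms(1) ij by (simp add: sum_of_mats_def scalar_prod_def atLeast0LessThan)
  also have "\<dots> = (\<Sum>k<d. \<Sum>s\<in>I. A s $$ (i, k) * B $$ (k, j))" by (simp only: sum_distrib_right)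
  also have "\<dots> = (\<Sum>s\<in>I. \<Sum>k<d. A s $$ (i, k) * B $$ (k, j))" by (rule sum.swap)
  also have "\<dots> = (\<Sum>s\<in>I. (A s * B) $$ (i, j))"
  proof (rule sum.cong)
    fix s assume "s \<in> I"
    then have "A s \<in> carrier_mat d d" by (rule assms(2))
    then show "(\<Sum>k<d. A s $$ (i, k) * B $$ (k, j)) = (A s * B) $$ (i, j)"
      using assms(1) ij by (simp add: scalar_prod_def atLeast0LessThan)
  qed (rule refl)
  also have "\<dots> = sum_of_mats d (\<lambda>s. A s * B) I $$ (i, j)"
    using ij by (simp add: sum_of_mats_def)
  finally show "(sum_of_mats d A I * B) $$ (i, j) = sum_of_mats d (\<lambda>s. A s * B) I $$ (i, j)" .
qed (use assms(1) in \<open>simp_all add: sum_of_mats_def\<close>)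

lemma mat_trace_sum_of_mats:
  assumes "\<And>s. s \<in> I \<Longrightarrow> A s \<in> carrier_mat d d"
  shows "mat_trace (sum_of_mats d A I) = (\<Sum>s\<in>I. mat_trace (A s))"
proof -
  have "mat_trace (sum_of_mats d A I) = (\<Sum>i<d. \<Sum>s\<in>I. A s $$ (i, i))"
    by (simp add: mat_trace_def sum_of_mats_def)
  also have "\<dots> = (\<Sum>s\<in>I. \<Sum>i<d. A s $$ (i, i))" by (rule sum.swap)
  also have "\<dots> = (\<Sum>s\<in>I. mat_trace (A s))"
  proof (rule sum.cong)
    fix s assume "s \<in> I"
    then have "A s \<in> carrier_mat d d" by (rule assms)
    then have "dim_row (A s) = d" by simp
    then show "(\<Sum>i<d. A s $$ (i, i)) = mat_trace (A s)" unfolding mat_trace_def by (simp only:)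
  qed (rule refl)
  finally show ?thesis .
qed

lemma matrix_representation_carrier:
  assumes "matrix_representation G d \<rho>" "g \<in> carrier G"
  shows "\<rho> g \<in> carrier_mat d d"
proof -
  have "\<rho> g \<in> carrier (units_of (ring_mat TYPE(complex) d ()))"
    using assms unfolding matrix_representation_def by (rule hom_in_carrier)
  then show ?thesis unfolding units_of_carrier Units_def ring_mat_simps by simp
qed

lemma matrix_representation_mult:
  assumes "matrix_representation G d \<rho>" "g \<in> carrier G" "h \<in> carrier G"
  shows "\<rho> (g \<otimes>\<^bsub>G\<^esub> h) = \<rho> g * \<rho> h"
proof -
  have "\<rho> (g \<otimes>\<^bsub>G\<^esub> h) = \<rho> g \<otimes>\<^bsub>units_of (ring_mat TYPE(complex) d ())\<^esub> \<rho> h"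
    using assms unfolding matrix_representation_def by (rule hom_mult)
  then show ?thesis unfolding units_of_mult ring_mat_simps .
qed

lemma matrix_representation_one:
  assumes "matrix_representation G d \<rho>" "group G"
  shows "\<rho> \<one>\<^bsub>G\<^esub> = 1\<^sub>m d"
proof -
  interpret R: ring "ring_mat TYPE(complex) d ()" by (rule ring_mat)
  have "\<rho> \<one>\<^bsub>G\<^esub> = \<one>\<^bsub>units_of (ring_mat TYPE(complex) d ())\<^esub>"
    using assms unfolding matrix_representation_def by (intro hom_one R.units_group)
  then show ?thesis unfolding units_of_one ring_mat_simps .
qed

lemma complex_mat_has_eigenvector:
  fixes A :: "complex mat"
  assumes "A \<in> carrier_mat d d" "d > 0"
  shows "\<exists>v c. v \<in> carrier_vec d \<and> v \<noteq> 0\<^sub>v d \<and> A *\<^sub>v v = c \<cdot>\<^sub>v v"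
proof -
  have "degree (char_poly A) > 0" using degree_monic_char_poly[OF assms(1)] assms(2) by simp
  then have "\<not> constant (poly (char_poly A))" by (simp add: constant_degree)
  then obtain c where "poly (char_poly A) c = 0" using fundamental_theorem_of_algebra by metis
  then have "eigenvalue A c" using eigenvalue_root_char_poly[OF assms(1)] by simp
  then obtain v where "eigenvector A v c" unfolding eigenvalue_def by (rule exE)
  moreover have "dim_row A = d" using assms(1) by simp
  ultimately show ?thesis unfolding eigenvector_def by metis
qed

lemma eigenspace_is_subspace:
  fixes A :: "complex mat"
  assumes "A \<in> carrier_mat d d"
  shows "VectorSpace.subspace class_ring {w \<in> carrier_vec d. A *\<^sub>v w = c \<cdot>\<^sub>v w} (module_vec TYPE(complex) d)"
proof (rule VectorSpace.subspace.intro)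
  show "vectorspace class_ring (module_vec TYPE(complex) d)" by (rule vec_vs)
  show "submodule class_ring {w \<in> carrier_vec d. A *\<^sub>v w = c \<cdot>\<^sub>v w} (module_vec TYPE(complex) d)"
  proof (rule submodule.intro)
    show "Module.module class_ring (module_vec TYPE(complex) d)" by (rule vec_module)
  next
    fix v w assume "v \<in> {w \<in> carrier_vec d. A *\<^sub>v w = c \<cdot>\<^sub>v w}" "w \<in> {w \<in> carrier_vec d. A *\<^sub>v w = c \<cdot>\<^sub>v w}"
    then show "v \<oplus>\<^bsub>module_vec TYPE(complex) d\<^esub> w \<in> {w \<in> carrier_vec d. A *\<^sub>v w = c \<cdot>\<^sub>v w}"
      using mult_add_distrib_mat_vec[OF assms, of v w] smult_add_distrib_vec[of v d w c]
      by (simp add: module_vec_simps)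
  next
    have "A *\<^sub>v 0\<^sub>v d = 0\<^sub>v d" using assms by (intro eq_vecI) auto
    moreover have "0\<^sub>v d = c \<cdot>\<^sub>v 0\<^sub>v d" by (intro eq_vecI) auto
    ultimately show "\<zero>\<^bsub>module_vec TYPE(complex) d\<^esub> \<in> {w \<in> carrier_vec d. A *\<^sub>v w = c \<cdot>\<^sub>v w}"
      by (simp add: module_vec_simps)
  next
    fix k v assume "v \<in> {w \<in> carrier_vec d. A *\<^sub>v w = c \<cdot>\<^sub>v w}"
    then show "k \<odot>\<^bsub>module_vec TYPE(complex) d\<^esub> v \<in> {w \<in> carrier_vec d. A *\<^sub>v w = c \<cdot>\<^sub>v w}"
      using mult_mat_vec[OF assms, of v k] by (simp add: module_vec_simps smult_smult_assoc mult.commute)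
  qed (simp add: module_vec_simps)
qed

text \<open>
  An eigenspace of \<open>M\<close> is invariant under the representation and nonzero, hence everything.
\<close>

lemma schur_scalar:
  assumes "irreducible_representation G d \<rho>" "M \<in> carrier_mat d d"
    and "\<And>g. g \<in> carrier G \<Longrightarrow> \<rho> g * M = M * \<rho> g"
  shows "\<exists>c. M = c \<cdot>\<^sub>m 1\<^sub>m d"
proof -
  have rep: "matrix_representation G d \<rho>" and d: "d > 0"
    and irr: "\<And>W. VectorSpace.subspace class_ring W (module_vec TYPE(complex) d) \<Longrightarrow>
          (\<forall>g\<in>carrier G. \<forall>w\<in>W. \<rho> g *\<^sub>v w \<in> W) \<Longrightarrow> W = {0\<^sub>v d} \<or> W = carrier_vec d"
    using assms(1) unfolding irreducible_representation_def by metis+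
  obtain v c where v: "v \<in> carrier_vec d" "v \<noteq> 0\<^sub>v d" "M *\<^sub>v v = c \<cdot>\<^sub>v v"
    using complex_mat_has_eigenvector[OF assms(2) d] by metis
  define W where "W = {w \<in> carrier_vec d. M *\<^sub>v w = c \<cdot>\<^sub>v w}"
  have "\<rho> g *\<^sub>v w \<in> W" if "g \<in> carrier G" "w \<in> W" for g w
  proof -
    have w: "w \<in> carrier_vec d" "M *\<^sub>v w = c \<cdot>\<^sub>v w" using that(2) by (simp_all add: W_def)
    have g: "\<rho> g \<in> carrier_mat d d" using matrix_representation_carrier[OF rep that(1)] .
    have "M *\<^sub>v (\<rho> g *\<^sub>v w) = (M * \<rho> g) *\<^sub>v w" using assms(2) g w(1) by simp
    also have "\<dots> = (\<rho> g * M) *\<^sub>v w" using assms(3)[OF that(1)] by simp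
    also have "\<dots> = \<rho> g *\<^sub>v (M *\<^sub>v w)" using assms(2) g w(1) by simp
    also have "\<dots> = c \<cdot>\<^sub>v (\<rho> g *\<^sub>v w)" unfolding w(2) by (rule mult_mat_vec[OF g w(1)])
    finally show ?thesis using g w(1) by (simp add: W_def)
  qed
  then have "\<forall>g\<in>carrier G. \<forall>w\<in>W. \<rho> g *\<^sub>v w \<in> W" by (intro ballI)
  then have "W = {0\<^sub>v d} \<or> W = carrier_vec d"
    by (rule irr[rotated]) (unfold W_def, rule eigenspace_is_subspace[OF assms(2)])
  moreover have "v \<in> W" using v by (simp add: W_def)
  ultimately have W: "W = carrier_vec d" using v(2) by (metis singletonD)
  have "M = c \<cdot>\<^sub>m 1\<^sub>m d"
  proof (rule eq_matI)
    fix i j assume "i < dim_row (c \<cdot>\<^sub>m 1\<^sub>m d)" "j < dim_col (c \<cdot>\<^sub>m 1\<^sub>m d)"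
    then have ij: "i < d" "j < d" by simp_all
    have "unit_vec d j \<in> W" unfolding W by simp
    then have "(M *\<^sub>v unit_vec d j) $ i = (c \<cdot>\<^sub>v unit_vec d j) $ i" by (simp add: W_def)
    then show "M $$ (i, j) = (c \<cdot>\<^sub>m 1\<^sub>m d) $$ (i, j)" using ij assms(2) by simp
  qed (use assms(2) in simp_all)
  then show ?thesis by (rule exI)
qed

text \<open>
  The last condition says that \<open>F\<close> extends to a multiplicative functional on the centre of the group
  algebra: the mean over the conjugates of \<open>h\<close> is the normalised class sum of \<open>h\<close>.
\<close>

definition central_character :: "nat \<Rightarrow> ((nat \<Rightarrow> nat) \<Rightarrow> complex) \<Rightarrow> bool" where
  "central_character n F \<longleftrightarrow> F id = 1
     \<and> (\<forall>g h. g permutes {1..n} \<longrightarrow> h permutes {1..n} \<longrightarrow> F (h \<circ> g \<circ> inv_into UNIV h) = F g)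
     \<and> (\<forall>g h. g permutes {1..n} \<longrightarrow> h permutes {1..n} \<longrightarrow>
          (\<Sum>s | s permutes {1..n}. F (g \<circ> (s \<circ> h \<circ> inv_into UNIV s))) = fact n * F g * F h)"

lemma trace_one_mat: "mat_trace (1\<^sub>m d) = of_nat d"
  by (simp add: mat_trace_def)

lemma trace_smult_mat: "mat_trace (c \<cdot>\<^sub>m A) = c * mat_trace A" if "A \<in> carrier_mat d d"
  using that by (simp add: mat_trace_def sum_distrib_left)

text \<open>
  The sum \<open>M\<close> of the images of all \<open>s h s\<inverse>\<close> commutes with the representation and so is a scalar; its trace
  determines the scalar, and the trace of \<open>\<rho>(g) M\<close> is the sum in question.
\<close>

lemma irreducible_character_is_central:
  assumes "irreducible_character (sym_group n) \<chi>"
  shows "central_character n (normalized_character n \<chi>)"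
proof -
  define P where "P = {p. p permutes {1..n}}"
  obtain d \<rho> where irr: "irreducible_representation (sym_group n) d \<rho>"
    and "\<forall>g\<in>carrier (sym_group n). \<chi> g = mat_trace (\<rho> g)"
    using assms unfolding irreducible_character_def by (elim exE conjE)
  then have \<chi>: "\<And>g. g \<in> P \<Longrightarrow> \<chi> g = mat_trace (\<rho> g)"
    by (simp add: P_def sym_group_carrier)
  have rep: "matrix_representation (sym_group n) d \<rho>" and d: "d > 0"
    using irr unfolding irreducible_representation_def by metis+
  have comp: "g \<circ> h \<in> P" if "g \<in> P" "h \<in> P" for g h
    using that permutes_compose[of h "{1..n}" g] by (simp add: P_def)
  have invP: "inv_into UNIV h \<in> P" if "h \<in> P" for h
    using that permutes_inv[of h "{1..n}"] by (simp add: P_def)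
  have inv_comp: "inv_into UNIV h \<circ> h = id" "h \<circ> inv_into UNIV h = id" if "h \<in> P" for h
    using that permutes_inv_o[of h "{1..n}"] by (simp_all add: P_def)
  have "card P = fact n" unfolding P_def by (rule card_permutations) auto
  then have cardP: "of_nat (card P) = (fact n :: complex)" by simp
  have idP: "id \<in> P" by (simp add: P_def permutes_id)
  have car: "\<rho> g \<in> carrier_mat d d" if "g \<in> P" for g
    using matrix_representation_carrier[OF rep] that by (simp add: P_def sym_group_carrier)
  have mult: "\<rho> (g \<circ> h) = \<rho> g * \<rho> h" if "g \<in> P" "h \<in> P" for g h
    using matrix_representation_mult[OF rep, of g h] that by (simp add: P_def sym_group_carrier sym_group_mult)
  have one: "\<rho> id = 1\<^sub>m d"
    using matrix_representation_one[OF rep sym_group_is_group] by (simp add: sym_group_one)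
  have \<chi>1: "\<chi> id = of_nat d" using \<chi>[OF idP] one trace_one_mat by simp
  define F where "F = normalized_character n \<chi>"
  have F: "F g = \<chi> g / of_nat d" for g
    by (simp add: F_def normalized_character_def sym_group_one \<chi>1)
  have cls: "\<chi> (h \<circ> g \<circ> inv_into UNIV h) = \<chi> g" if "g \<in> P" "h \<in> P" for g h
  proof -
    have "\<chi> (h \<circ> g \<circ> inv_into UNIV h) = mat_trace (\<rho> (h \<circ> g) * \<rho> (inv_into UNIV h))"
      using \<chi>[OF comp[OF comp[OF that(2,1)] invP[OF that(2)]]]
        mult[OF comp[OF that(2,1)] invP[OF that(2)]] by (simp only:)
    also have "\<dots> = mat_trace (\<rho> (inv_into UNIV h) * \<rho> (h \<circ> g))"
      by (rule mat_trace_mult_commute[OF car[OF comp[OF that(2,1)]] car[OF invP[OF that(2)]]])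
    also have "\<dots> = mat_trace (\<rho> (inv_into UNIV h \<circ> (h \<circ> g)))"
      using mult[OF invP[OF that(2)] comp[OF that(2,1)]] by (simp only:)
    also have "inv_into UNIV h \<circ> (h \<circ> g) = g"
      unfolding comp_assoc[symmetric] inv_comp(1)[OF that(2)] by (rule id_comp)
    also have "mat_trace (\<rho> g) = \<chi> g" by (rule \<chi>[OF that(1), symmetric])
    finally show ?thesis .
  qed
  have main: "(\<Sum>s\<in>P. \<chi> (g \<circ> (s \<circ> h \<circ> inv_into UNIV s))) = fact n * \<chi> g * \<chi> h / of_nat d"
    if g: "g \<in> P" and h: "h \<in> P" for g h
  proof -
    define A where "A = (\<lambda>s. \<rho> (s \<circ> h \<circ> inv_into UNIV s))"
    have cP: "s \<circ> h \<circ> inv_into UNIV s \<in> P" if "s \<in> P" for s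
      by (rule comp[OF comp[OF that h] invP[OF that]])
    have A: "A s \<in> carrier_mat d d" if "s \<in> P" for s
      unfolding A_def by (rule car[OF cP[OF that]])
    define M where "M = sum_of_mats d A P"
    have "\<rho> x * M = M * \<rho> x" if x: "x \<in> P" for x
    proof -
      have "bij_betw (\<lambda>s. x \<circ> s) P P"
      proof (rule bij_betwI[where g = "\<lambda>s. inv_into UNIV x \<circ> s"])
        show "(\<lambda>s. x \<circ> s) \<in> P \<rightarrow> P" by (rule funcsetI) (rule comp[OF x])
        show "(\<lambda>s. inv_into UNIV x \<circ> s) \<in> P \<rightarrow> P" by (rule funcsetI) (rule comp[OF invP[OF x]])
      qed (simp_all only: comp_assoc[symmetric] inv_comp[OF x] id_comp)
      then have "(\<Sum>s\<in>P. A (x \<circ> s) $$ ij) = (\<Sum>s\<in>P. A s $$ ij)" for ij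
        by (rule sum.reindex_bij_betw)
      then have "M = sum_of_mats d (\<lambda>s. A (x \<circ> s)) P" unfolding M_def sum_of_mats_def by (simp only:)
      then have "M * \<rho> x = sum_of_mats d (\<lambda>s. A (x \<circ> s) * \<rho> x) P"
        using sum_of_mats_mult[OF car[OF x], of P "\<lambda>s. A (x \<circ> s)"] A[OF comp[OF x]] by (simp only:)
      also have "\<dots> = sum_of_mats d (\<lambda>s. \<rho> x * A s) P"
      proof -
        have "A (x \<circ> s) * \<rho> x = \<rho> x * A s" if s: "s \<in> P" for s
        proof -
          have "inv_into UNIV (x \<circ> s) = inv_into UNIV s \<circ> inv_into UNIV x"
            using x s by (intro o_inv_distrib) (auto simp: P_def permutes_bij)
          then have "x \<circ> s \<circ> h \<circ> inv_into UNIV (x \<circ> s) \<circ> x = x \<circ> (s \<circ> h \<circ> inv_into UNIV s) \<circ> (inv_into UNIV x \<circ> x)"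
            by (simp only: comp_assoc)
          then have "x \<circ> s \<circ> h \<circ> inv_into UNIV (x \<circ> s) \<circ> x = x \<circ> (s \<circ> h \<circ> inv_into UNIV s)"
            unfolding inv_comp(1)[OF x] by (simp only: comp_id)
          then show ?thesis unfolding A_def
            using mult[OF cP[OF comp[OF x s]] x] mult[OF x cP[OF s]] by (simp only:)
        qed
        then show ?thesis unfolding sum_of_mats_def by (simp cong: sum.cong)
      qed
      also have "\<dots> = \<rho> x * M" unfolding M_def by (rule mult_sum_of_mats[OF car[OF x] A, symmetric])
      finally show ?thesis by (rule sym)
    qed
    then obtain c where c: "M = c \<cdot>\<^sub>m 1\<^sub>m d"
      using schur_scalar[OF irr, of M] sum_of_mats_carrier unfolding M_def P_def
      by (metis sym_group_carrier mem_Collect_eq)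
    have "c * of_nat d = mat_trace M"
      unfolding c using trace_smult_mat[OF one_carrier_mat] trace_one_mat by simp
    also have "\<dots> = (\<Sum>s\<in>P. mat_trace (A s))" unfolding M_def by (rule mat_trace_sum_of_mats[OF A])
    also have "\<dots> = (\<Sum>s\<in>P. \<chi> h)"
      by (rule sum.cong[OF refl]) (simp only: A_def \<chi>[OF cP, symmetric] cls[OF h])
    also have "\<dots> = fact n * \<chi> h"
      by (simp add: cardP)
    finally have c': "c = fact n * \<chi> h / of_nat d" using d by (simp add: field_simps)
    have "(\<Sum>s\<in>P. \<chi> (g \<circ> (s \<circ> h \<circ> inv_into UNIV s))) = (\<Sum>s\<in>P. mat_trace (\<rho> g * A s))"
      by (rule sum.cong[OF refl]) (simp only: A_def \<chi>[OF comp[OF g cP]] mult[OF g cP])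
    also have "\<dots> = mat_trace (sum_of_mats d (\<lambda>s. \<rho> g * A s) P)"
      by (rule mat_trace_sum_of_mats[symmetric]) (use car[OF g] A in \<open>simp\<close>)
    also have "\<dots> = mat_trace (\<rho> g * M)"
      unfolding M_def by (rule arg_cong[OF mult_sum_of_mats[OF car[OF g], symmetric]]) (rule A)
    also have "\<rho> g * M = c \<cdot>\<^sub>m \<rho> g"
      unfolding c mult_smult_distrib[OF car[OF g] one_carrier_mat] right_mult_one_mat[OF car[OF g]] ..
    also have "mat_trace (c \<cdot>\<^sub>m \<rho> g) = c * \<chi> g" using trace_smult_mat[OF car[OF g]] \<chi>[OF g] by simp
    finally have eq: "(\<Sum>s\<in>P. \<chi> (g \<circ> (s \<circ> h \<circ> inv_into UNIV s))) = c * \<chi> g" .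
    show ?thesis unfolding eq c' by simp
  qed
  have "F id = 1" using F \<chi>1 d by simp
  moreover have "F (h \<circ> g \<circ> inv_into UNIV h) = F g" if "g \<in> P" "h \<in> P" for g h
    unfolding F cls[OF that] ..
  moreover have "(\<Sum>s\<in>P. F (g \<circ> (s \<circ> h \<circ> inv_into UNIV s))) = fact n * F g * F h" if "g \<in> P" "h \<in> P" for g h
    unfolding F sum_divide_distrib[symmetric] main[OF that] by simp
  ultimately show ?thesis
    unfolding central_character_def F_def[symmetric] P_def mem_Collect_eq by (intro conjI allI impI)
qed

section \<open>Placements of cycles and their overlap patterns\<close>

text \<open>
  A placement of a product of cycles is given by one list of distinct points, which is cut into
  consecutive blocks of the prescribed lengths.
\<close>

fun chop :: "nat list \<Rightarrow> 'a list \<Rightarrow> 'a list list" where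
  "chop [] xs = []"
| "chop (l # L) xs = take l xs # chop L (drop l xs)"

lemma map_chop: "map (map f) (chop L xs) = chop L (map f xs)"
  by (induction L arbitrary: xs) (simp_all add: take_map drop_map)

lemma concat_chop: "length xs = sum_list L \<Longrightarrow> concat (chop L xs) = xs"
  by (induction L arbitrary: xs) simp_all

lemma map_length_chop: "length xs = sum_list L \<Longrightarrow> map length (chop L xs) = L"
  by (induction L arbitrary: xs) simp_all

lemma chop_map_length_concat: "chop (map length css) (concat css) = css"
  by (induction css) simp_all

lemma chop_append: "length xs = l \<Longrightarrow> chop (l # L) (xs @ ys) = xs # chop L ys"
  by simp

text \<open>
  The permutation is built point by point: one further transposition corrects the image of the new
  point and leaves the previous images alone.
\<close>

lemma exists_permutation_of_lists:
  assumes "distinct xs" "distinct ys" "length xs = length ys" "set xs \<subseteq> S" "set ys \<subseteq> S"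
  shows "\<exists>s. s permutes S \<and> map s xs = ys"
  using assms
proof (induction xs arbitrary: ys)
  case Nil
  then have "map id [] = ys" by simp
  then show ?case using permutes_id by (intro exI[of _ id] conjI)
next
  case (Cons x xs)
  then obtain y ys' where ys: "ys = y # ys'" by (cases ys) auto
  obtain s where s: "s permutes S" "map s xs = ys'"
    using Cons.IH[of ys'] Cons.prems by (auto simp: ys)
  define t where "t = transpose (s x) y \<circ> s"
  have "s x \<in> S" using s(1) Cons.prems(4) by (simp add: permutes_in_image)
  then have "t permutes S" unfolding t_def
    using Cons.prems(5) by (intro permutes_compose[OF s(1)] permutes_swap_id) (simp_all add: ys)
  moreover have "map t xs = map s xs"
  proof (rule map_cong[OF refl])
    fix z assume z: "z \<in> set xs"
    then have "s z \<noteq> s x" using Cons.prems(1) permutes_inj[OF s(1)] by (auto dest: injD)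
    moreover have "s z \<in> set ys'" using z s(2) by (metis imageI list.set_map)
    then have "s z \<noteq> y" using Cons.prems(2) by (auto simp: ys)
    ultimately show "t z = s z" by (simp add: t_def transpose_def)
  qed
  moreover have "t x = y" by (simp add: t_def)
  ultimately have "map t (x # xs) = ys" unfolding list.map ys using s(2) by (simp only:)
  with \<open>t permutes S\<close> show ?case by (intro exI[of _ t] conjI)
qed

lemma central_character_conj:
  assumes "central_character n F" "g permutes {1..n}" "h permutes {1..n}"
  shows "F (h \<circ> g \<circ> inv_into UNIV h) = F g"
  using assms unfolding central_character_def by metis

lemma central_character_mult:
  assumes "central_character n F" "g permutes {1..n}" "h permutes {1..n}"
  shows "(\<Sum>s | s permutes {1..n}. F (g \<circ> (s \<circ> h \<circ> inv_into UNIV s))) = fact n * F g * F h"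
proof -
  have "\<forall>g h. g permutes {1..n} \<longrightarrow> h permutes {1..n} \<longrightarrow>
      (\<Sum>s | s permutes {1..n}. F (g \<circ> (s \<circ> h \<circ> inv_into UNIV s))) = fact n * F g * F h"
    using assms(1) unfolding central_character_def by (elim conjE)
  from this[rule_format, OF assms(2,3)] show ?thesis .
qed

lemma central_character_same_type:
  assumes "central_character n F"
    and "distinct (concat css)" "set (concat css) \<subseteq> {1..n}"
    and "distinct (concat dss)" "set (concat dss) \<subseteq> {1..n}"
    and "map length css = map length dss"
  shows "F (product_of_cycles css) = F (product_of_cycles dss)"
proof -
  have "length (concat css) = length (concat dss)" unfolding length_concat assms(6) ..
  then obtain s where s: "s permutes {1..n}" "map s (concat css) = concat dss"
    using exists_permutation_of_lists[OF assms(2,4) _ assms(3,5)] by metis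
  have "map (map s) css = chop (map length css) (map s (concat css))"
    unfolding map_chop[symmetric] chop_map_length_concat ..
  also have "\<dots> = dss" unfolding s(2) assms(6) chop_map_length_concat ..
  finally have "product_of_cycles dss = s \<circ> product_of_cycles css \<circ> inv_into UNIV s"
    using product_of_cycles_conj[of s css] permutes_bij[OF s(1)] distinct_in_concat[OF assms(2)] by metis
  then show ?thesis
    using central_character_conj[OF assms(1) product_of_cycles_permutes'[OF assms(3)] s(1)] by (simp only:)
qed

definition dlists :: "nat \<Rightarrow> 'a set \<Rightarrow> 'a list set" where
  "dlists l S = {xs. length xs = l \<and> distinct xs \<and> set xs \<subseteq> S}"

lemma finite_dlists: "finite S \<Longrightarrow> finite (dlists l S)"
  unfolding dlists_def by (rule finite_subset[OF _ finite_lists_length_eq[of S l]]) auto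

lemma dlists_0 [simp]: "dlists 0 S = {[]}"
  by (auto simp: dlists_def)

lemma sum_dlists_Suc:
  assumes "finite S"
  shows "(\<Sum>xs\<in>dlists (Suc l) S. f xs) = (\<Sum>x\<in>S. \<Sum>ys\<in>dlists l (S - {x}). f (x # ys))"
proof -
  have "xs \<in> dlists (Suc l) S \<longleftrightarrow> xs \<in> (\<lambda>(x, ys). x # ys) ` (SIGMA x:S. dlists l (S - {x}))" for xs
    by (cases xs) (auto simp: dlists_def image_iff)
  then have "dlists (Suc l) S = (\<lambda>(x, ys). x # ys) ` (SIGMA x:S. dlists l (S - {x}))"
    by (intro subset_antisym subsetI) simp_all
  moreover have "inj_on (\<lambda>(x, ys). x # ys) (SIGMA x:S. dlists l (S - {x}))"
    by (intro inj_onI) auto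
  ultimately have "(\<Sum>xs\<in>dlists (Suc l) S. f xs) = (\<Sum>(x, ys)\<in>(SIGMA x:S. dlists l (S - {x})). f (x # ys))"
    using sum.reindex[of "\<lambda>(x, ys). x # ys" "SIGMA x:S. dlists l (S - {x})" f]
    by (simp add: case_prod_unfold o_def)
  also have "\<dots> = (\<Sum>x\<in>S. \<Sum>ys\<in>dlists l (S - {x}). f (x # ys))"
    using assms finite_dlists[of "S - {x}" for x] by (subst sum.Sigma) auto
  finally show ?thesis .
qed

lemma map_dlists:
  assumes "inj s"
  shows "map s ` dlists l S = dlists l (s ` S)"
proof
  show "map s ` dlists l S \<subseteq> dlists l (s ` S)"
  proof (rule image_subsetI)
    fix xs assume "xs \<in> dlists l S"
    then have "length xs = l" "distinct xs" "set xs \<subseteq> S" by (simp_all add: dlists_def)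
    then show "map s xs \<in> dlists l (s ` S)"
      using inj_on_subset[OF assms subset_UNIV] image_mono[of "set xs" S s]
      by (simp add: dlists_def distinct_map)
  qed
  show "dlists l (s ` S) \<subseteq> map s ` dlists l S"
  proof
    fix ys assume "ys \<in> dlists l (s ` S)"
    then have ys: "length ys = l" "distinct ys" "set ys \<subseteq> s ` S" by (simp_all add: dlists_def)
    define xs where "xs = map (inv_into UNIV s) ys"
    have inv: "s (inv_into UNIV s y) = y" "inv_into UNIV s y \<in> S" if "y \<in> set ys" for y
      using that ys(3) assms by (auto simp: subset_iff)
    have "map s xs = ys" unfolding xs_def map_map by (rule map_idI) (simp add: inv)
    moreover from this have "distinct xs" using ys(2) by (metis distinct_map)
    moreover have "set xs \<subseteq> S" using inv(2) by (auto simp: xs_def)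
    ultimately show "ys \<in> map s ` dlists l S"
      using ys(1) by (intro image_eqI[of _ _ xs]) (auto simp: dlists_def xs_def)
  qed
qed

lemma sum_dlists_map:
  assumes "inj s" "s ` S = T"
  shows "(\<Sum>ys\<in>dlists l T. f ys) = (\<Sum>xs\<in>dlists l S. f (map s xs))"
proof -
  have "inj_on (map s) (dlists l S)" by (rule inj_on_subset[OF inj_mapI[OF assms(1)] subset_UNIV])
  from sum.reindex[OF this, of f] show ?thesis
    unfolding map_dlists[OF assms(1)] assms(2) by (simp add: o_def)
qed

text \<open>
  Conjugation permutes the placements, so the sum over all placements is a multiple of a class sum,
  on which \<open>F\<close> is multiplicative.
\<close>

lemma central_character_average:
  assumes F: "central_character n F" and c: "c permutes {1..n}"
  shows "(\<Sum>xs\<in>dlists (sum_list L) {1..n}. F (c \<circ> product_of_cycles (chop L xs)))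
    = F c * (\<Sum>xs\<in>dlists (sum_list L) {1..n}. F (product_of_cycles (chop L xs)))"
proof -
  define X where "X = dlists (sum_list L) {1..n}"
  define G where "G = {p. p permutes {1..n}}"
  define h :: "nat list \<Rightarrow> nat \<Rightarrow> nat" where "h = (\<lambda>xs. product_of_cycles (chop L xs))"
  have h: "h xs permutes {1..n}" "h (map s xs) = s \<circ> h xs \<circ> inv_into UNIV s"
    if "xs \<in> X" "s \<in> G" for xs s
  proof -
    have xs: "distinct (concat (chop L xs))" "set (concat (chop L xs)) \<subseteq> {1..n}"
      using that(1) concat_chop[of xs L] by (simp_all add: X_def dlists_def del: set_concat)
    show "h xs permutes {1..n}" unfolding h_def by (rule product_of_cycles_permutes'[OF xs(2)])
    have "bij s" using that(2) permutes_bij by (simp add: G_def)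
    then show "h (map s xs) = s \<circ> h xs \<circ> inv_into UNIV s"
      unfolding h_def map_chop[symmetric] by (rule product_of_cycles_conj) (rule distinct_in_concat[OF xs(1)])
  qed
  have cardG: "of_nat (card G) = (fact n :: complex)"
    unfolding G_def using card_permutations[of "{1..n}" n] by simp
  have "fact n * (\<Sum>xs\<in>X. F (c \<circ> h xs)) = (\<Sum>s\<in>G. \<Sum>xs\<in>X. F (c \<circ> h xs))"
    by (simp add: cardG)
  also have "\<dots> = (\<Sum>s\<in>G. \<Sum>xs\<in>X. F (c \<circ> (s \<circ> h xs \<circ> inv_into UNIV s)))"
  proof (rule sum.cong[OF refl])
    fix s assume s: "s \<in> G"
    then have sp: "s permutes {1..n}" by (simp add: G_def)
    have "(\<Sum>xs\<in>X. F (c \<circ> h xs)) = (\<Sum>xs\<in>X. F (c \<circ> h (map s xs)))"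
      unfolding X_def by (rule sum_dlists_map[OF permutes_inj[OF sp] permutes_image[OF sp]])
    also have "\<dots> = (\<Sum>xs\<in>X. F (c \<circ> (s \<circ> h xs \<circ> inv_into UNIV s)))"
      by (rule sum.cong[OF refl]) (simp only: h(2)[OF _ s])
    finally show "(\<Sum>xs\<in>X. F (c \<circ> h xs)) = (\<Sum>xs\<in>X. F (c \<circ> (s \<circ> h xs \<circ> inv_into UNIV s)))" .
  qed
  also have "\<dots> = (\<Sum>xs\<in>X. \<Sum>s\<in>G. F (c \<circ> (s \<circ> h xs \<circ> inv_into UNIV s)))" by (rule sum.swap)
  also have "\<dots> = (\<Sum>xs\<in>X. fact n * F c * F (h xs))"
  proof (rule sum.cong[OF refl])
    fix xs assume "xs \<in> X"
    moreover have "id \<in> G" by (simp add: G_def permutes_id)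
    ultimately have "h xs permutes {1..n}" by (rule h(1))
    then show "(\<Sum>s\<in>G. F (c \<circ> (s \<circ> h xs \<circ> inv_into UNIV s))) = fact n * F c * F (h xs)"
      unfolding G_def by (rule central_character_mult[OF F c])
  qed
  also have "\<dots> = fact n * (F c * (\<Sum>xs\<in>X. F (h xs)))"
    by (simp add: sum_distrib_left mult.assoc)
  finally show ?thesis unfolding X_def h_def by simp
qed

text \<open>
  The falling factorial, with factors taken in the complex numbers so that it vanishes for \<open>r > n\<close>
  and obeys polynomial identities in \<open>n\<close> without any side condition.
\<close>

definition falling :: "nat \<Rightarrow> nat \<Rightarrow> complex" where
  "falling n r = (\<Prod>i<r. of_nat n - of_nat i)"

lemma falling_0 [simp]: "falling n 0 = 1"
  and falling_Suc: "falling n (Suc r) = falling n r * (of_nat n - of_nat r)"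
  by (simp_all add: falling_def)

lemma falling_eq_0_iff: "falling n r = 0 \<longleftrightarrow> n < r"
  by (auto simp: falling_def)

text \<open>
  Suppose that \<open>{1..s}\<close> are the points seen so far, of which those in \<open>A\<close> may still be used. A pattern
  describes a list of \<open>l\<close> further distinct points: each entry is either a point of \<open>A\<close> or the next
  unused label \<open>s + 1, s + 2, \<dots>\<close>, which stands for a point not seen before. Since the new labels
  occur in increasing order, each pattern is also the canonical list with that pattern.
\<close>

fun patterns :: "nat \<Rightarrow> nat set \<Rightarrow> nat \<Rightarrow> nat list set" where
  "patterns 0 A s = {[]}"
| "patterns (Suc l) A s = (\<Union>x\<in>A. (#) x ` patterns l (A - {x}) s) \<union> (#) (Suc s) ` patterns l A (Suc s)"

abbreviation labels :: "nat \<Rightarrow> nat list \<Rightarrow> nat" where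
  "labels s P \<equiv> fold max P s"

lemma finite_patterns: "finite A \<Longrightarrow> finite (patterns l A s)"
  by (induction l A s rule: patterns.induct) auto

lemma sum_patterns_Suc:
  assumes "A \<subseteq> {1..s}"
  shows "(\<Sum>P\<in>patterns (Suc l) A s. f P) = (\<Sum>x\<in>A. \<Sum>P\<in>patterns l (A - {x}) s. f (x # P))
    + (\<Sum>P\<in>patterns l A (Suc s). f (Suc s # P))"
proof -
  have fA: "finite A" using assms finite_subset by blast
  have "(\<Sum>P\<in>patterns (Suc l) A s. f P) = (\<Sum>P\<in>(\<Union>x\<in>A. (#) x ` patterns l (A - {x}) s). f P)
    + (\<Sum>P\<in>(#) (Suc s) ` patterns l A (Suc s). f P)"
    unfolding patterns.simps using fA assms finite_patterns
    by (intro sum.union_disjoint) auto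
  also have "(\<Sum>P\<in>(\<Union>x\<in>A. (#) x ` patterns l (A - {x}) s). f P)
    = (\<Sum>x\<in>A. \<Sum>P\<in>(#) x ` patterns l (A - {x}) s. f P)"
    using fA finite_patterns by (intro sum.UNION_disjoint) auto
  finally show ?thesis by (simp add: sum.reindex)
qed

lemma patterns_properties:
  assumes "P \<in> patterns l A s" "A \<subseteq> {1..s}"
  shows "length P = l \<and> distinct P \<and> s \<le> labels s P \<and> set P \<subseteq> A \<union> {s<..labels s P}
    \<and> {s<..labels s P} \<subseteq> set P"
  using assms
proof (induction l arbitrary: A s P)
  case (Suc l)
  from Suc.prems(1) consider
    x Q where "x \<in> A" "Q \<in> patterns l (A - {x}) s" "P = x # Q"
    | Q where "Q \<in> patterns l A (Suc s)" "P = Suc s # Q"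
    by auto
  then show ?case
  proof cases
    case 1
    have IH: "length Q = l \<and> distinct Q \<and> s \<le> labels s Q \<and> set Q \<subseteq> (A - {x}) \<union> {s<..labels s Q}
      \<and> {s<..labels s Q} \<subseteq> set Q"
      using Suc.prems(2) by (intro Suc.IH[OF 1(2)]) auto
    have x: "x \<le> s" using 1(1) Suc.prems(2) by auto
    then have "labels s P = labels s Q" using 1(3) by (simp add: max_def)
    moreover have "x \<notin> set Q" using IH x by auto
    ultimately show ?thesis using IH 1(1,3) by auto
  next
    case 2
    have IH: "length Q = l \<and> distinct Q \<and> Suc s \<le> labels (Suc s) Q \<and> set Q \<subseteq> A \<union> {Suc s<..labels (Suc s) Q}
      \<and> {Suc s<..labels (Suc s) Q} \<subseteq> set Q"
      using Suc.prems(2) by (intro Suc.IH[OF 2(1)]) auto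
    have l: "labels s P = labels (Suc s) Q" using 2(2) by (simp add: max_def)
    have "Suc s \<notin> set Q"
    proof
      assume "Suc s \<in> set Q"
      then have "Suc s \<in> A \<union> {Suc s<..labels (Suc s) Q}" using IH by (meson subsetD)
      then show False using Suc.prems(2) by auto
    qed
    moreover have "{s<..labels s P} = insert (Suc s) {Suc s<..labels (Suc s) Q}"
      unfolding l using IH by auto
    ultimately show ?thesis using IH 2(2) unfolding l by auto
  qed
qed simp

text \<open>
  A new point can be moved to the label \<open>s + 1\<close> by a transposition that fixes all points seen so far, so all
  \<open>n - s\<close> choices for it contribute equally. With the factor \<open>falling n s\<close> on the left the multiplicities
  telescope into one falling factorial. It vanishes on patterns that need more than \<open>n\<close> labels, and
  therefore \<open>n\<close> may be arbitrary.
\<close>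

lemma sum_dlists_patterns:
  assumes "A \<subseteq> {1..s}"
    and "\<And>p xs. p permutes {1..n} \<Longrightarrow> \<forall>i\<in>{1..s}. p i = i \<Longrightarrow> xs \<in> dlists l (A \<union> {s<..n})
      \<Longrightarrow> f (map p xs) = f xs"
  shows "falling n s * (\<Sum>xs\<in>dlists l (A \<union> {s<..n}). f xs)
    = (\<Sum>P\<in>patterns l A s. falling n (labels s P) * f P)"
  using assms
proof (induction l arbitrary: A s f)
  case (Suc l)
  have fA: "finite A" using Suc.prems(1) finite_subset by blast
  define S where "S = A \<union> {s<..n}"
  have fS: "finite S" using fA by (simp add: S_def)
  show ?case
  proof (cases "s \<le> n")
    case False
    have "falling n (labels s P) = 0" if "P \<in> patterns (Suc l) A s" for P
      using patterns_properties[OF that Suc.prems(1)] False by (simp add: falling_eq_0_iff)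
    then have "(\<Sum>P\<in>patterns (Suc l) A s. falling n (labels s P) * f P) = 0"
      by (intro sum.neutral) simp
    then show ?thesis using False by (simp add: falling_eq_0_iff)
  next
    case True
    have "(\<Sum>xs\<in>dlists (Suc l) S. f xs) = (\<Sum>x\<in>S. \<Sum>ys\<in>dlists l (S - {x}). f (x # ys))"
      by (rule sum_dlists_Suc[OF fS])
    also have "\<dots> = (\<Sum>x\<in>A. \<Sum>ys\<in>dlists l (S - {x}). f (x # ys))
        + (\<Sum>x\<in>{s<..n}. \<Sum>ys\<in>dlists l (S - {x}). f (x # ys))"
      unfolding S_def using fA Suc.prems(1) by (intro sum.union_disjoint) auto
    finally have split: "falling n s * (\<Sum>xs\<in>dlists (Suc l) S. f xs)
      = (\<Sum>x\<in>A. falling n s * (\<Sum>ys\<in>dlists l (S - {x}). f (x # ys)))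
        + falling n s * (\<Sum>x\<in>{s<..n}. \<Sum>ys\<in>dlists l (S - {x}). f (x # ys))"
      by (simp add: distrib_left sum_distrib_left)
    have old: "falling n s * (\<Sum>ys\<in>dlists l (S - {x}). f (x # ys))
      = (\<Sum>P\<in>patterns l (A - {x}) s. falling n (labels s (x # P)) * f (x # P))" if x: "x \<in> A" for x
    proof -
      have xs: "x \<le> s" "1 \<le> x" using x Suc.prems(1) by auto
      then have "S - {x} = (A - {x}) \<union> {s<..n}" by (auto simp: S_def)
      moreover have "falling n s * (\<Sum>ys\<in>dlists l ((A - {x}) \<union> {s<..n}). f (x # ys))
        = (\<Sum>P\<in>patterns l (A - {x}) s. falling n (labels s P) * f (x # P))"
      proof (rule Suc.IH)
        show "A - {x} \<subseteq> {1..s}" using Suc.prems(1) by auto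
        fix p ys assume p: "p permutes {1..n}" "\<forall>i\<in>{1..s}. p i = i" and ys: "ys \<in> dlists l (A - {x} \<union> {s<..n})"
        have "x # ys \<in> dlists (Suc l) (A \<union> {s<..n})" using ys x xs by (auto simp: dlists_def)
        then have "f (map p (x # ys)) = f (x # ys)" by (rule Suc.prems(2)[OF p])
        moreover have "p x = x" using p(2) xs by auto
        ultimately show "f (x # map p ys) = f (x # ys)" by simp
      qed
      moreover have "max x s = s" using xs by simp
      ultimately show ?thesis by simp
    qed
    have new: "falling n s * (\<Sum>x\<in>{s<..n}. \<Sum>ys\<in>dlists l (S - {x}). f (x # ys))
      = (\<Sum>P\<in>patterns l A (Suc s). falling n (labels s (Suc s # P)) * f (Suc s # P))"
    proof (cases "s < n")
      case False
      have "falling n (labels s (Suc s # P)) = 0" if "P \<in> patterns l A (Suc s)" for P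
      proof -
        have "A \<subseteq> {1..Suc s}" using Suc.prems(1) by auto
        from patterns_properties[OF that this] False show ?thesis by (simp add: falling_eq_0_iff max_def)
      qed
      then have "(\<Sum>P\<in>patterns l A (Suc s). falling n (labels s (Suc s # P)) * f (Suc s # P)) = 0"
        by (intro sum.neutral) simp
      then show ?thesis using False by simp
    next
      case sn: True
      define S' where "S' = A \<union> {Suc s<..n}"
      have "(\<Sum>ys\<in>dlists l (S - {x}). f (x # ys)) = (\<Sum>zs\<in>dlists l S'. f (Suc s # zs))"
        if x: "x \<in> {s<..n}" for x
      proof -
        define t where "t = transpose x (Suc s)"
        have t: "inj t" "t permutes {1..n}" "\<forall>i\<in>{1..s}. t i = i"
          using x sn unfolding t_def
          by (auto intro!: permutes_swap_id simp: transpose_def inj_on_def split: if_splits)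
        have "t ` S' = S - {x}"
        proof -
          have "t ` A = A" using t(3) Suc.prems(1) by (force simp: image_iff)
          moreover have "t ` {Suc s<..n} = {s<..n} - {x}"
          proof -
            have "{Suc s<..n} = {s<..n} - {Suc s}" by auto
            also have "t ` \<dots> = t ` {s<..n} - {t (Suc s)}" using t(1) by (simp add: image_set_diff)
            also have "t ` {s<..n} = {s<..n}" unfolding t_def using x sn by (intro permutes_image permutes_swap_id) auto
            finally show ?thesis by (simp add: t_def)
          qed
          moreover have "A - {x} = A" using x Suc.prems(1) by auto
          ultimately show ?thesis unfolding S'_def S_def image_Un Un_Diff by simp
        qed
        then have "(\<Sum>ys\<in>dlists l (S - {x}). f (x # ys)) = (\<Sum>zs\<in>dlists l S'. f (x # map t zs))"
          by (rule sum_dlists_map[OF t(1)])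
        also have "\<dots> = (\<Sum>zs\<in>dlists l S'. f (Suc s # zs))"
        proof (rule sum.cong[OF refl])
          fix zs assume "zs \<in> dlists l S'"
          then have "Suc s # zs \<in> dlists (Suc l) (A \<union> {s<..n})"
            using Suc.prems(1) sn by (auto simp: dlists_def S'_def subset_iff)
          then have "f (map t (Suc s # zs)) = f (Suc s # zs)" by (rule Suc.prems(2)[OF t(2,3)])
          moreover have "t (Suc s) = x" by (simp add: t_def)
          ultimately show "f (x # map t zs) = f (Suc s # zs)" by simp
        qed
        finally show ?thesis .
      qed
      then have "falling n s * (\<Sum>x\<in>{s<..n}. \<Sum>ys\<in>dlists l (S - {x}). f (x # ys))
         = falling n s * of_nat (n - s) * (\<Sum>zs\<in>dlists l S'. f (Suc s # zs))"
        by simp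
      also have "falling n s * of_nat (n - s) = falling n (Suc s)"
        using True by (simp add: falling_Suc of_nat_diff)
      also have "falling n (Suc s) * (\<Sum>zs\<in>dlists l S'. f (Suc s # zs))
         = (\<Sum>P\<in>patterns l A (Suc s). falling n (labels (Suc s) P) * f (Suc s # P))"
        unfolding S'_def
      proof (rule Suc.IH)
        show "A \<subseteq> {1..Suc s}" using Suc.prems(1) by auto
        fix p ys assume p: "p permutes {1..n}" "\<forall>i\<in>{1..Suc s}. p i = i" and ys: "ys \<in> dlists l (A \<union> {Suc s<..n})"
        have "Suc s # ys \<in> dlists (Suc l) (A \<union> {s<..n})"
          using ys Suc.prems(1) sn by (auto simp: dlists_def subset_iff)
        then have "f (map p (Suc s # ys)) = f (Suc s # ys)" using p by (intro Suc.prems(2)) auto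
        moreover have "p (Suc s) = Suc s" using p(2) by auto
        ultimately show "f (Suc s # map p ys) = f (Suc s # ys)" by simp
      qed
      finally show ?thesis by (simp add: max_def)
    qed
    show ?thesis
      unfolding sum_patterns_Suc[OF Suc.prems(1)] S_def[symmetric] split new
      using old by (simp cong: sum.cong)
  qed
qed simp

text \<open>
  This splits off the block of labels that belongs to the first cycle.
\<close>

lemma sum_patterns_add:
  assumes "A \<subseteq> {1..s}"
  shows "(\<Sum>P\<in>patterns (k + l) A s. f P)
    = (\<Sum>P\<in>patterns k A s. \<Sum>Q\<in>patterns l (A - set P) (labels s P). f (P @ Q))"
  using assms
proof (induction k arbitrary: A s f)
  case (Suc k)
  have A: "A - {x} \<subseteq> {1..s}" "A \<subseteq> {1..Suc s}" for x using Suc.prems by auto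
  have old: "labels s (x # P) = labels s P" "A - set (x # P) = A - {x} - set P" if "x \<in> A" for x P
  proof -
    have "max x s = s" using that Suc.prems by auto
    then show "labels s (x # P) = labels s P" by simp
  qed auto
  have "max (Suc s) s = Suc s" by simp
  then have new: "labels s (Suc s # P) = labels (Suc s) P" "A - set (Suc s # P) = A - set P" for P
    using Suc.prems by auto
  have "(\<Sum>P\<in>patterns (k + l) (A - {x}) s. f (x # P)) = (\<Sum>P\<in>patterns k (A - {x}) s.
      \<Sum>Q\<in>patterns l (A - set (x # P)) (labels s (x # P)). f ((x # P) @ Q))" if "x \<in> A" for x
    unfolding Suc.IH[OF A(1)] old[OF that] append_Cons ..
  moreover have "(\<Sum>P\<in>patterns (k + l) A (Suc s). f (Suc s # P)) = (\<Sum>P\<in>patterns k A (Suc s).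
      \<Sum>Q\<in>patterns l (A - set (Suc s # P)) (labels s (Suc s # P)). f ((Suc s # P) @ Q))"
    unfolding Suc.IH[OF A(2)] new append_Cons ..
  ultimately show ?case
    unfolding add_Suc sum_patterns_Suc[OF Suc.prems] by (simp only: cong: sum.cong)
qed simp

text \<open>
  There is one way to avoid all available points, namely to take new labels only.
\<close>

lemma patterns_avoiding:
  assumes "A \<subseteq> {1..s}"
  shows "{P \<in> patterns l A s. set P \<inter> A = {}} = {[Suc s..<Suc (s + l)]}"
  using assms
proof (induction l arbitrary: s)
  case (Suc l)
  have "A \<subseteq> {1..Suc s}" "Suc s \<notin> A" using Suc.prems by auto
  have "{P \<in> patterns (Suc l) A s. set P \<inter> A = {}} = (#) (Suc s) ` {P \<in> patterns l A (Suc s). set P \<inter> A = {}}"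
    using \<open>Suc s \<notin> A\<close> by auto
  also have "\<dots> = {Suc s # [Suc (Suc s)..<Suc (Suc s + l)]}"
    unfolding Suc.IH[OF \<open>A \<subseteq> {1..Suc s}\<close>] by simp
  also have "Suc s # [Suc (Suc s)..<Suc (Suc s + l)] = [Suc s..<Suc (s + Suc l)]"
    by (simp add: upt_rec[of "Suc s"])
  finally show ?case .
qed auto

text \<open>
  One chooses the position in the block and the available point that is put there; the remaining
  entries are new.
\<close>

lemma card_patterns_touching_once:
  assumes "A \<subseteq> {1..s}"
  shows "card {P \<in> patterns l A s. card (set P \<inter> A) = 1} = l * card A"
proof -
  have card_eq: "card {P \<in> patterns l A s. Q P} = (\<Sum>P\<in>patterns l A s. of_bool (Q P))"
    if "A \<subseteq> {1..s}" for l A s and Q :: "nat list \<Rightarrow> bool"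
  proof -
    have "finite (patterns l A s)" using that finite_subset finite_patterns by blast
    then show ?thesis by (simp add: sum.If_cases of_bool_def Collect_conj_eq Int_commute)
  qed
  have "(\<Sum>P\<in>patterns l A s. of_bool (card (set P \<inter> A) = 1)) = l * card A"
    using assms
  proof (induction l arbitrary: s)
    case (Suc l)
    have A: "A \<subseteq> {1..Suc s}" "Suc s \<notin> A" and fA: "finite A"
      using Suc.prems finite_subset by auto
    have "(\<Sum>P\<in>patterns l (A - {x}) s. of_bool (card (set (x # P) \<inter> A) = 1)) = (1::nat)" if x: "x \<in> A" for x
    proof -
      have sub: "A - {x} \<subseteq> {1..s}" using Suc.prems by auto
      have "card (set (x # P) \<inter> A) = 1 \<longleftrightarrow> set P \<inter> (A - {x}) = {}" for P
      proof -
        have "set (x # P) \<inter> A = insert x (set P \<inter> (A - {x}))" using x by auto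
        then show ?thesis using fA by (auto simp: card_insert_if)
      qed
      then have "(\<Sum>P\<in>patterns l (A - {x}) s. of_bool (card (set (x # P) \<inter> A) = 1))
        = card {P \<in> patterns l (A - {x}) s. set P \<inter> (A - {x}) = {}}"
        unfolding card_eq[OF sub] by (simp only:)
      then show ?thesis unfolding patterns_avoiding[OF sub] by simp
    qed
    moreover have "set (Suc s # P) \<inter> A = set P \<inter> A" for P using A(2) by auto
    ultimately show ?case
      unfolding sum_patterns_Suc[OF Suc.prems] using Suc.IH[OF A(1)] by simp
  qed simp
  then show ?thesis unfolding card_eq[OF assms] .
qed

section \<open>Scaled character values and their products\<close>

lemma chop_concat_props:
  assumes "distinct xs" "length xs = sum_list L"
  shows "distinct (concat (chop L xs))" "set (concat (chop L xs)) = set xs"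
  unfolding concat_chop[OF assms(2)] by (rule assms(1), rule refl)

lemma product_of_cycles_chop_permutes:
  assumes "length xs = sum_list L" "set xs \<subseteq> S"
  shows "product_of_cycles (chop L xs) permutes S"
  by (rule product_of_cycles_permutes') (use assms in \<open>simp only: concat_chop\<close>)

lemma product_of_cycles_chop_conj:
  assumes "distinct xs" "length xs = sum_list L" "p permutes S"
  shows "product_of_cycles (chop L (map p xs)) = p \<circ> product_of_cycles (chop L xs) \<circ> inv_into UNIV p"
  unfolding map_chop[symmetric]
  by (rule product_of_cycles_conj[OF permutes_bij[OF assms(3)]])
    (rule distinct_in_concat[OF chop_concat_props(1)[OF assms(1,2)]])

type_synonym char_function = "nat \<Rightarrow> ((nat \<Rightarrow> nat) \<Rightarrow> complex) \<Rightarrow> complex"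

text \<open>
  Functions of \<open>n\<close> and \<open>F\<close> that are given by one polynomial over the rationals in \<open>n\<close> and the
  generators \<open>G\<close>. By the last rule only the values on central characters matter, because the identities
  between scaled values hold only there.
\<close>

inductive polynomial_in :: "char_function set \<Rightarrow> char_function \<Rightarrow> bool" for G where
  const: "polynomial_in G (\<lambda>n F. of_rat r)"
| degree: "polynomial_in G (\<lambda>n F. of_nat n)"
| gen: "f \<in> G \<Longrightarrow> polynomial_in G f"
| add: "polynomial_in G f \<Longrightarrow> polynomial_in G g \<Longrightarrow> polynomial_in G (\<lambda>n F. f n F + g n F)"
| mult: "polynomial_in G f \<Longrightarrow> polynomial_in G g \<Longrightarrow> polynomial_in G (\<lambda>n F. f n F * g n F)"
| cong: "polynomial_in G f \<Longrightarrow> (\<And>n F. central_character n F \<Longrightarrow> f n F = g n F) \<Longrightarrow> polynomial_in G g"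

lemma polynomial_in_scale: "polynomial_in G f \<Longrightarrow> polynomial_in G (\<lambda>n F. of_rat r * f n F)"
  by (rule polynomial_in.mult[OF polynomial_in.const])

lemma polynomial_in_0: "polynomial_in G (\<lambda>n F. 0)"
  using polynomial_in.const[of G 0] by simp

lemma polynomial_in_1: "polynomial_in G (\<lambda>n F. 1)"
  using polynomial_in.const[of G 1] by simp

lemma polynomial_in_diff:
  assumes "polynomial_in G f" "polynomial_in G g"
  shows "polynomial_in G (\<lambda>n F. f n F - g n F)"
  using polynomial_in.add[OF assms(1) polynomial_in_scale[OF assms(2), of "- 1"]] by simp

lemma polynomial_in_sum:
  assumes "\<And>i. i \<in> I \<Longrightarrow> polynomial_in G (f i)"
  shows "polynomial_in G (\<lambda>n F. \<Sum>i\<in>I. f i n F)"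
  using assms
proof (induction I rule: infinite_finite_induct)
  case (insert i I)
  have "polynomial_in G (\<lambda>n F. f i n F + (\<Sum>i\<in>I. f i n F))"
    by (rule polynomial_in.add) (use insert in simp_all)
  then show ?case using insert.hyps by simp
qed (simp_all add: polynomial_in_0)

lemma polynomial_in_falling_tail: "polynomial_in G (\<lambda>n F. \<Prod>i\<in>{a..<b}. of_nat n - of_nat i)"
proof (induction b)
  case (Suc b)
  have "polynomial_in G (\<lambda>n F. of_nat n - of_rat (of_nat b))"
    by (rule polynomial_in_diff[OF polynomial_in.degree polynomial_in.const])
  from polynomial_in.mult[OF Suc this] show ?case
    by (cases "a \<le> b") (simp_all add: polynomial_in_1)
qed (simp add: polynomial_in_1)

lemma polynomial_in_trans:
  assumes "polynomial_in G f" "\<And>g. g \<in> G \<Longrightarrow> polynomial_in H g"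
  shows "polynomial_in H f"
  using assms(1)
proof (induction rule: polynomial_in.induct)
  case (gen f)
  then show ?case by (rule assms(2))
next
  case (add f g)
  show ?case by (rule polynomial_in.add[OF add.IH])
next
  case (mult f g)
  show ?case by (rule polynomial_in.mult[OF mult.IH])
next
  case (cong f g)
  show ?case by (rule polynomial_in.cong[OF cong.IH cong.hyps(2)])
qed (rule polynomial_in.const, rule polynomial_in.degree)

text \<open>
  The factor makes products of these values linear combinations with coefficients independent of \<open>n\<close>. The
  representative on \<open>{1..sum_list L}\<close> lies in the symmetric group only if \<open>sum_list L \<le> n\<close>;
  otherwise the factor is 0.
\<close>

definition scaled_value :: "nat list \<Rightarrow> char_function" where
  "scaled_value L n F = falling n (sum_list L) * F (product_of_cycles (chop L [1..<Suc (sum_list L)]))"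

lemma scaled_value_eq:
  assumes "central_character n F" "distinct (concat css)" "set (concat css) \<subseteq> {1..n}" "map length css = L"
  shows "scaled_value L n F = falling n (sum_list L) * F (product_of_cycles css)"
proof -
  define xs where "xs = [1..<Suc (sum_list L)]"
  have len: "length xs = sum_list L" and d: "distinct xs" by (simp_all add: xs_def del: upt_Suc)
  have "sum_list L = card (set (concat css))"
    unfolding distinct_card[OF assms(2)] length_concat assms(4) ..
  also have "\<dots> \<le> n" using card_mono[OF _ assms(3)] by simp
  finally have "set xs \<subseteq> {1..n}" by (auto simp: xs_def)
  then have "F (product_of_cycles (chop L xs)) = F (product_of_cycles css)"
    using assms chop_concat_props[OF d len] map_length_chop[OF len]
    by (intro central_character_same_type[OF assms(1)]) simp_all
  then show ?thesis unfolding scaled_value_def xs_def by (simp only:)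
qed

lemma falling_split:
  assumes "r \<le> s"
  shows "falling n s = falling n r * (\<Prod>i\<in>{r..<s}. of_nat n - of_nat i)"
proof -
  have "{..<s} = {..<r} \<union> {r..<s}" using assms by auto
  then show ?thesis unfolding falling_def by (simp add: prod.union_disjoint ivl_disj_int)
qed

text \<open>
  Fixed points change the factor only, by a polynomial in \<open>n\<close>.
\<close>

lemma scaled_value_drop_ones:
  assumes F: "central_character n F"
  shows "scaled_value L n F = (\<Prod>i\<in>{sum_list (filter (\<lambda>l. 2 \<le> l) L)..<sum_list L}. of_nat n - of_nat i)
    * scaled_value (filter (\<lambda>l. 2 \<le> l) L) n F"
proof -
  define L' where "L' = filter (\<lambda>l. 2 \<le> l) L"
  have le: "sum_list L' \<le> sum_list L"
    unfolding L'_def by (induction L) auto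
  show ?thesis unfolding L'_def[symmetric]
  proof (cases "sum_list L \<le> n")
    case False
    then have "falling n (sum_list L) = 0" by (simp add: falling_eq_0_iff)
    then show "scaled_value L n F = (\<Prod>i\<in>{sum_list L'..<sum_list L}. of_nat n - of_nat i) * scaled_value L' n F"
      using falling_split[OF le, of n] by (auto simp: scaled_value_def)
  next
    case True
    define css where "css = chop L [1..<Suc (sum_list L)]"
    define dss where "dss = filter (\<lambda>cs. 2 \<le> length cs) css"
    have css: "distinct (concat css)" "set (concat css) \<subseteq> {1..n}" "map length css = L"
      unfolding css_def using chop_concat_props[of "[1..<Suc (sum_list L)]" L] True
      by (simp_all add: map_length_chop del: upt_Suc set_concat) auto
    have "map length dss = L'"
      unfolding dss_def L'_def css(3)[symmetric] filter_map o_def ..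
    moreover have "distinct (concat dss)" unfolding dss_def by (rule distinct_concat_filter[OF css(1)])
    moreover have "set (concat dss) \<subseteq> {1..n}" using css(2) unfolding dss_def by auto
    ultimately have "scaled_value L' n F = falling n (sum_list L') * F (product_of_cycles css)"
      using scaled_value_eq[OF F, of dss L'] product_of_cycles_filter_nontrivial[of css]
      unfolding dss_def by simp
    then show "scaled_value L n F = (\<Prod>i\<in>{sum_list L'..<sum_list L}. of_nat n - of_nat i) * scaled_value L' n F"
      using scaled_value_eq[OF F css] falling_split[OF le, of n] by simp
  qed
qed

lemma excess_filter: "excess (filter (\<lambda>l. 2 \<le> l) L) = excess L"
  by (induction L) auto

text \<open>
  Both sides are the same product of adjacent transpositions. Read from left to right this merges two
  cycles with one common point.
\<close>

lemma cycle_of_list_append: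
  "cycle_of_list (xs @ [z]) \<circ> cycle_of_list (z # ys) = cycle_of_list (xs @ z # ys)"
proof (induction xs)
  case (Cons x xs)
  show ?case
  proof (cases xs)
    case Nil
    show ?thesis unfolding Nil by (simp only: append_Cons append_Nil cycle_of_list.simps comp_id)
  next
    case (Cons w ws)
    show ?thesis using \<open>cycle_of_list (xs @ [z]) \<circ> _ = _\<close>
      unfolding Cons by (simp only: append_Cons cycle_of_list.simps comp_assoc)
  qed
qed simp

lemma cycle_of_list_starting_at:
  assumes "distinct xs" "x \<in> set xs"
  shows "\<exists>ys. distinct (x # ys) \<and> set (x # ys) = set xs \<and> length (x # ys) = length xs
    \<and> cycle_of_list xs = cycle_of_list (x # ys)"
proof -
  obtain us vs where xs: "xs = us @ x # vs" using assms(2) split_list by metis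
  have r: "rotate (length us) xs = x # (vs @ us)" unfolding xs rotate_append by simp
  show ?thesis
  proof (intro exI[of _ "vs @ us"] conjI)
    show "cycle_of_list xs = cycle_of_list (x # (vs @ us))"
      using cycle_of_list_rotate_independent[OF assms(1), of "length us"] unfolding r .
  qed (use assms(1) xs in auto)
qed

lemma cycle_of_list_ending_at:
  assumes "distinct xs" "x \<in> set xs"
  shows "\<exists>ys. distinct (ys @ [x]) \<and> set (ys @ [x]) = set xs \<and> length (ys @ [x]) = length xs
    \<and> cycle_of_list xs = cycle_of_list (ys @ [x])"
proof -
  obtain ys where ys: "distinct (x # ys)" "set (x # ys) = set xs" "length (x # ys) = length xs"
    "cycle_of_list xs = cycle_of_list (x # ys)"
    using cycle_of_list_starting_at[OF assms] by metis
  have "cycle_of_list (x # ys) = cycle_of_list (ys @ [x])"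
    using cycle_of_list_rotate_independent[OF ys(1), of 1] by simp
  with ys show ?thesis by (intro exI[of _ ys]) simp
qed

text \<open>
  One rotates the first cycle so that it ends in \<open>z\<close> and the second so that it begins with \<open>z\<close>.
\<close>

lemma merge_cycles:
  assumes "distinct xs" "distinct ys" "set xs \<inter> set ys = {z}"
  shows "\<exists>zs. distinct zs \<and> set zs = set xs \<union> set ys \<and> length zs = length xs + length ys - 1
    \<and> cycle_of_list xs \<circ> cycle_of_list ys = cycle_of_list zs"
proof -
  have z: "z \<in> set xs" "z \<in> set ys" using assms(3) by auto
  obtain us where us: "distinct (us @ [z])" "set (us @ [z]) = set xs" "length (us @ [z]) = length xs"
    "cycle_of_list xs = cycle_of_list (us @ [z])"
    using cycle_of_list_ending_at[OF assms(1) z(1)] by metis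
  obtain vs where vs: "distinct (z # vs)" "set (z # vs) = set ys" "length (z # vs) = length ys"
    "cycle_of_list ys = cycle_of_list (z # vs)"
    using cycle_of_list_starting_at[OF assms(2) z(2)] by metis
  show ?thesis
  proof (intro exI[of _ "us @ z # vs"] conjI)
    have "set us \<inter> set vs \<subseteq> {z}" using us(2) vs(2) assms(3) by auto
    then show "distinct (us @ z # vs)" using us(1) vs(1) by auto
    show "set (us @ z # vs) = set xs \<union> set ys" unfolding us(2)[symmetric] vs(2)[symmetric] by auto
    show "length (us @ z # vs) = length xs + length ys - 1"
      unfolding us(3)[symmetric] vs(3)[symmetric] by simp
    show "cycle_of_list xs \<circ> cycle_of_list ys = cycle_of_list (us @ z # vs)"
      unfolding us(4) vs(4) by (rule cycle_of_list_append)
  qed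
qed

text \<open>
  The transposition of the two common points cuts either cycle into two, from the right and from the
  left respectively. Inserting its square between the cycles therefore saves one transposition
  in each of them.
\<close>

lemma swapidseq_cycles_sharing_two:
  assumes "distinct xs" "distinct ys" "x \<in> set xs \<inter> set ys" "y \<in> set xs \<inter> set ys" "x \<noteq> y"
  shows "swapidseq ((length xs - 2) + (length ys - 2)) (cycle_of_list xs \<circ> cycle_of_list ys)"
proof -
  define t where "t = transpose y x"
  have tt: "t \<circ> t = id" by (simp add: t_def)
  have "swapidseq (length ys - 2) (t \<circ> cycle_of_list ys)"
  proof -
    obtain us where us: "distinct (x # us)" "set (x # us) = set ys" "length (x # us) = length ys"
      "cycle_of_list ys = cycle_of_list (x # us)"
      using cycle_of_list_starting_at[OF assms(2), of x] assms(3) by auto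
    then have "y \<in> set us" using assms(4,5) by auto
    then obtain as bs where us': "us = as @ y # bs" using split_list by metis
    have d: "distinct (x # as)" "distinct (y # bs)" "distinct (y # x # as)"
      using us(1) us' by auto
    have "cycle_of_list ys = cycle_of_list ((x # as) @ y # bs)" using us(4) us' by simp
    also have "\<dots> = cycle_of_list ((x # as) @ [y]) \<circ> cycle_of_list (y # bs)"
      by (rule cycle_of_list_append[symmetric])
    also have "cycle_of_list ((x # as) @ [y]) = cycle_of_list (y # x # as)"
      using cycle_of_list_rotate_independent[OF d(3), of 1] by simp
    also have "cycle_of_list (y # x # as) = t \<circ> cycle_of_list (x # as)" by (simp add: t_def)
    finally have "t \<circ> cycle_of_list ys = (t \<circ> t) \<circ> (cycle_of_list (x # as) \<circ> cycle_of_list (y # bs))"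
      by (simp only: comp_assoc)
    then have eq: "t \<circ> cycle_of_list ys = cycle_of_list (x # as) \<circ> cycle_of_list (y # bs)"
      unfolding tt id_comp .
    have l: "length ys - 2 = length (x # as) - 1 + (length (y # bs) - 1)"
      unfolding us(3)[symmetric] us' by simp
    show ?thesis unfolding eq l
      by (rule swapidseq_comp_add[OF swapidseq_cycle_of_list[OF d(1)] swapidseq_cycle_of_list[OF d(2)]])
  qed
  moreover have "swapidseq (length xs - 2) (cycle_of_list xs \<circ> t)"
  proof -
    obtain us where us: "distinct (us @ [y])" "set (us @ [y]) = set xs" "length (us @ [y]) = length xs"
      "cycle_of_list xs = cycle_of_list (us @ [y])"
      using cycle_of_list_ending_at[OF assms(1), of y] assms(4) by auto
    then have "x \<in> set us" using assms(3,5) by auto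
    then obtain as bs where us': "us = as @ x # bs" using split_list by metis
    have d: "distinct (as @ [x])" "distinct (bs @ [y])" "distinct (x # bs @ [y])"
      using us(1) us' by auto
    have "cycle_of_list xs = cycle_of_list (as @ x # (bs @ [y]))" using us(4) us' by simp
    also have "\<dots> = cycle_of_list (as @ [x]) \<circ> cycle_of_list (x # (bs @ [y]))"
      by (rule cycle_of_list_append[symmetric])
    also have "cycle_of_list (x # (bs @ [y])) = cycle_of_list (bs @ y # [x])"
      using cycle_of_list_rotate_independent[OF d(3), of 1] by simp
    also have "\<dots> = cycle_of_list (bs @ [y]) \<circ> cycle_of_list (y # [x])"
      by (rule cycle_of_list_append[symmetric])
    also have "cycle_of_list (y # [x]) = t" by (simp add: t_def)
    finally have "cycle_of_list xs \<circ> t = (cycle_of_list (as @ [x]) \<circ> cycle_of_list (bs @ [y])) \<circ> (t \<circ> t)"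
      by (simp only: comp_assoc)
    then have eq: "cycle_of_list xs \<circ> t = cycle_of_list (as @ [x]) \<circ> cycle_of_list (bs @ [y])"
      unfolding tt comp_id .
    have l: "length xs - 2 = length (as @ [x]) - 1 + (length (bs @ [y]) - 1)"
      unfolding us(3)[symmetric] us' by simp
    show ?thesis unfolding eq l
      by (rule swapidseq_comp_add[OF swapidseq_cycle_of_list[OF d(1)] swapidseq_cycle_of_list[OF d(2)]])
  qed
  ultimately have "swapidseq ((length xs - 2) + (length ys - 2)) ((cycle_of_list xs \<circ> t) \<circ> (t \<circ> cycle_of_list ys))"
    by (intro swapidseq_comp_add)
  moreover have "(cycle_of_list xs \<circ> t) \<circ> (t \<circ> cycle_of_list ys) = cycle_of_list xs \<circ> (t \<circ> t) \<circ> cycle_of_list ys"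
    by (simp only: comp_assoc)
  ultimately show ?thesis unfolding tt comp_id by (simp only:)
qed

lemma labels_upt: "labels s [Suc s..<Suc (s + b)] = s + b"
  by (induction b) simp_all

text \<open>
  The sum over all placements of \<open>M\<close> is computed twice: with the fixed cycle in front, by patterns
  relative to \<open>{1..a}\<close>, and alone, where no point has been seen before and only one pattern is left.
\<close>

lemma scaled_value_mult:
  assumes F: "central_character n F"
  shows "scaled_value [a] n F * scaled_value M n F
    = (\<Sum>P\<in>patterns (sum_list M) {1..a} a. falling n (labels a P)
        * F (cycle_of_list [1..<Suc a] \<circ> product_of_cycles (chop M P)))"
proof (cases "a \<le> n")
  case False
  have "falling n (labels a P) = 0" if "P \<in> patterns (sum_list M) {1..a} a" for P
    using patterns_properties[OF that order_refl] False by (simp add: falling_eq_0_iff)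
  moreover have "scaled_value [a] n F = 0"
    using False by (simp add: scaled_value_def falling_eq_0_iff)
  ultimately show ?thesis by simp
next
  case True
  define c where "c = cycle_of_list [1..<Suc a]"
  define h :: "nat list \<Rightarrow> nat \<Rightarrow> nat" where "h = (\<lambda>xs. product_of_cycles (chop M xs))"
  define X where "X = dlists (sum_list M) {1..n}"
  have "set [1..<Suc a] \<subseteq> {1..n}" using True by auto
  then have c: "c permutes {1..n}"
    unfolding c_def by (rule permutes_subset[OF cycle_permutes])
  have h: "h xs permutes {1..n}" if "xs \<in> X" for xs
    unfolding h_def using that by (intro product_of_cycles_chop_permutes) (simp_all add: X_def dlists_def)
  have hp: "h (map p xs) = p \<circ> h xs \<circ> inv_into UNIV p" if "p permutes {1..n}" "xs \<in> X" for p xs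
    unfolding h_def using that(2) by (intro product_of_cycles_chop_conj[OF _ _ that(1)]) (simp_all add: X_def dlists_def)
  have f1: "F (h (map p xs)) = F (h xs)" if "p permutes {1..n}" "xs \<in> X" for p xs
    unfolding hp[OF that] by (rule central_character_conj[OF F h[OF that(2)] that(1)])
  have f2: "F (c \<circ> h (map p xs)) = F (c \<circ> h xs)"
    if p: "p permutes {1..n}" "\<forall>i\<in>{1..a}. p i = i" and xs: "xs \<in> X" for p xs
  proof -
    have "map p [1..<Suc a] = [1..<Suc a]" using p(2) by (intro map_idI) auto
    then have pc: "p \<circ> c \<circ> inv_into UNIV p = c"
      using conjugation_of_cycle[of "[1..<Suc a]" p] permutes_bij[OF p(1)] unfolding c_def by simp
    have "p \<circ> (c \<circ> h xs) \<circ> inv_into UNIV p = p \<circ> c \<circ> (inv_into UNIV p \<circ> p) \<circ> h xs \<circ> inv_into UNIV p"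
      unfolding permutes_inv_o(2)[OF p(1)] comp_id by (simp only: comp_assoc)
    also have "\<dots> = (p \<circ> c \<circ> inv_into UNIV p) \<circ> (p \<circ> h xs \<circ> inv_into UNIV p)"
      by (simp only: comp_assoc)
    also have "\<dots> = c \<circ> h (map p xs)" unfolding pc hp[OF p(1) xs] ..
    finally have "F (c \<circ> h (map p xs)) = F (p \<circ> (c \<circ> h xs) \<circ> inv_into UNIV p)" by (simp only:)
    also have "\<dots> = F (c \<circ> h xs)"
      by (rule central_character_conj[OF F permutes_compose[OF h[OF xs] c] p(1)])
    finally show ?thesis .
  qed
  have X: "{} \<union> {0<..n} = {1..n}" "{1..a} \<union> {a<..n} = {1..n}" using True by auto
  have pat: "patterns (sum_list M) {} 0 = {[1..<Suc (sum_list M)]}"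
    using patterns_avoiding[of "{}" 0 "sum_list M"] by simp
  have "falling n 0 * (\<Sum>xs\<in>dlists (sum_list M) ({} \<union> {0<..n}). F (h xs))
    = (\<Sum>P\<in>patterns (sum_list M) {} 0. falling n (labels 0 P) * F (h P))"
    by (rule sum_dlists_patterns) (simp, unfold X, fold X_def, rule f1)
  then have "(\<Sum>xs\<in>X. F (h xs)) = (\<Sum>P\<in>{[1..<Suc (sum_list M)]}. falling n (labels 0 P) * F (h P))"
    unfolding X X_def[symmetric] pat by simp
  also have "\<dots> = scaled_value M n F"
    using labels_upt[of 0 "sum_list M"] by (simp add: scaled_value_def h_def)
  finally have M: "(\<Sum>xs\<in>X. F (h xs)) = scaled_value M n F" .
  have "scaled_value [a] n F = falling n a * F c"
    by (simp add: scaled_value_def c_def)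
  then have "scaled_value [a] n F * scaled_value M n F = falling n a * (F c * (\<Sum>xs\<in>X. F (h xs)))"
    unfolding M by simp
  also have "F c * (\<Sum>xs\<in>X. F (h xs)) = (\<Sum>xs\<in>X. F (c \<circ> h xs))"
    unfolding X_def h_def by (rule central_character_average[OF F c, symmetric])
  also have "falling n a * \<dots> = (\<Sum>P\<in>patterns (sum_list M) {1..a} a. falling n (labels a P) * F (c \<circ> h P))"
    using sum_dlists_patterns[of "{1..a}" a n "sum_list M" "\<lambda>xs. F (c \<circ> h xs)"] f2
    unfolding X X_def[symmetric] by simp
  finally show ?thesis unfolding c_def h_def .
qed

section \<open>Every scaled value as a polynomial in those of cycles\<close>

text \<open>
  The coefficient of the cycle of the same length, modulo products of shorter elements: up to sign the
  product of all parts times \<open>(k+1)(k+2)\<dots>(k+p-2)\<close> for \<open>p \<ge> 2\<close> parts, where \<open>k - 1\<close> is the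
  length. Dividing the rising factorial from \<open>k\<close> by \<open>k\<close> includes the case \<open>p = 1\<close>, where the
  coefficient is 1.
\<close>

definition cycle_coeff :: "nat list \<Rightarrow> rat" where
  "cycle_coeff L = (- 1) ^ (length L - 1) * of_nat (prod_list L)
     * pochhammer (of_nat (Suc (excess L))) (length L - 1) / of_nat (Suc (excess L))"

lemma cycle_coeff_singleton: "l \<ge> 1 \<Longrightarrow> cycle_coeff [l] = 1"
  by (simp add: cycle_coeff_def)

lemma cycle_coeff_nonzero: "0 \<notin> set L \<Longrightarrow> cycle_coeff L \<noteq> 0"
  by (simp add: cycle_coeff_def prod_list_zero_iff pochhammer_eq_0_iff)

text \<open>
  The total of all \<open>cycle_coeff\<close> reached from the following intermediate state: the cycle has grown to
  length \<open>u\<close> and has \<open>y\<close> points that may still be touched, the cycles in \<open>rest\<close> have been placed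
  without contact, and those in \<open>M\<close> are still to be placed. The closed form results from summing over
  the touched subset of \<open>M\<close> with Vandermonde's identity for rising factorials. It is what is needed to
  see that the total is 0 at the start.
\<close>

definition placement_coeff :: "nat \<Rightarrow> rat \<Rightarrow> nat \<Rightarrow> nat list \<Rightarrow> nat list \<Rightarrow> rat" where
  "placement_coeff d y u rest M =
    (let k = of_nat (Suc d); v = k + of_nat (length rest) - y; q = length M in
      (- 1) ^ (length rest + q) * of_nat (prod_list rest) * of_nat (prod_list M)
       * (pochhammer k (length rest) / k)
       * (of_nat u * pochhammer v q - y * of_nat (excess M) * pochhammer (v + 1) (q - 1)))"

lemma placement_coeff_Nil:
  assumes "excess (u # rest) = d"
  shows "placement_coeff d y u rest [] = cycle_coeff (u # rest)"
  using assms by (simp add: placement_coeff_def cycle_coeff_def Let_def)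

text \<open>
  The first cycle in \<open>M\<close> either avoids the big cycle or touches it once, in \<open>b y\<close> ways, and then
  uses up one point and lengthens it by \<open>b - 1\<close>. After cancelling common factors this is the
  identity \<open>(v)\<^sub>q\<^sub>+\<^sub>1 = v (v+1)\<^sub>q\<close> for rising factorials, applied twice.
\<close>

lemma placement_coeff_Cons:
  assumes "b \<ge> 1" "u \<ge> 1"
  shows "placement_coeff d y u rest (b # M) = placement_coeff d y u (rest @ [b]) M
    + of_nat b * y * placement_coeff d (y - 1) (u + b - 1) rest M"
proof -
  define k :: rat where "k = of_nat (Suc d)"
  define r where "r = length rest"
  define q where "q = length M"
  define X :: rat where "X = of_nat (excess M)"
  define w :: rat where "w = k + of_nat r"
  define v :: rat where "v = w - y"
  define U :: rat where "U = of_nat u"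
  define B :: rat where "B = of_nat b"
  define Z where "Z = pochhammer k r / k"
  define p1 where "p1 = pochhammer (v + 1) q"
  define p where "p = pochhammer (v + 2) (q - 1)"
  define c :: rat where "c = (- 1) ^ (r + q) * of_nat (prod_list rest) * of_nat (prod_list M) * Z"
  have X0: "X = 0" if "q = 0" using that by (simp add: X_def q_def)
  have shift: "v + 1 + 1 = v + 2" "k + of_nat (Suc r) - y = v + 1" "k + of_nat r - (y - 1) = v + 1"
    by (simp_all add: v_def w_def)
  have rec: "p1 = (v + 1) * p" if "q > 0"
    using that pochhammer_rec[of "v + 1" "q - 1"] unfolding shift p_def p1_def by simp
  have B1: "of_nat (b - 1 + excess M) = B - 1 + X" "of_nat (u + b - 1) = U + B - 1"
    using assms by (simp_all add: B_def X_def U_def of_nat_diff)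
  have "placement_coeff d y u rest (b # M)
    = (- 1) ^ (r + Suc q) * of_nat (prod_list rest) * of_nat (b * prod_list M) * Z
      * (U * pochhammer v (Suc q) - y * of_nat (b - 1 + excess M) * p1)"
    by (simp add: placement_coeff_def Let_def k_def[symmetric] r_def[symmetric] q_def[symmetric]
      w_def[symmetric] v_def[symmetric] Z_def p1_def U_def del: of_nat_Suc of_nat_add of_nat_mult)
  also have "\<dots> = - c * B * (U * (v * p1) - y * (B - 1 + X) * p1)"
    unfolding B1 pochhammer_rec p1_def[symmetric] of_nat_mult c_def B_def[symmetric] by simp
  finally have lhs: "placement_coeff d y u rest (b # M) = - c * B * (U * (v * p1) - y * (B - 1 + X) * p1)" .
  have "placement_coeff d y u (rest @ [b]) M
    = (- 1) ^ (Suc r + q) * of_nat (prod_list rest * b) * of_nat (prod_list M) * (pochhammer k (Suc r) / k)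
      * (U * p1 - y * X * p)"
    unfolding placement_coeff_def Let_def k_def[symmetric] length_append list.size add_Suc_right add_0_right
      r_def[symmetric] q_def[symmetric] prod_list.append prod_list.Cons prod_list.Nil mult_1_right
      shift U_def[symmetric] X_def[symmetric] p1_def[symmetric] p_def[symmetric] ..
  also have "pochhammer k (Suc r) / k = Z * w"
    by (simp add: pochhammer_Suc Z_def w_def)
  finally have r1: "placement_coeff d y u (rest @ [b]) M = - c * B * w * (U * p1 - y * X * p)"
    by (simp add: c_def B_def)
  have r2: "placement_coeff d (y - 1) (u + b - 1) rest M
    = c * ((U + B - 1) * p1 - (y - 1) * X * p)"
    unfolding placement_coeff_def Let_def k_def[symmetric] r_def[symmetric] q_def[symmetric] shift B1
      X_def[symmetric] p1_def[symmetric] p_def[symmetric] Z_def[symmetric] c_def ..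
  show ?thesis
  proof (cases "q = 0")
    case True
    then show ?thesis unfolding lhs r1 r2 B_def[symmetric] by (simp add: X0 v_def algebra_simps)
  next
    case False
    then have q: "p1 = (v + 1) * p" using rec by simp
    show ?thesis unfolding lhs r1 r2 q B_def[symmetric] by (simp add: v_def algebra_simps)
  qed
qed

text \<open>
  In the initial state all \<open>a\<close> points are available, and the two terms of the closed form cancel.
\<close>

lemma placement_coeff_full:
  assumes "excess (a # M) = d" "M \<noteq> []" "a \<ge> 1"
  shows "placement_coeff d (of_nat a) a [] M = 0"
proof -
  have "of_nat (Suc d) - of_nat a = (of_nat (excess M) :: rat)"
    using assms(1,3) by (simp add: of_nat_diff algebra_simps flip: of_nat_add)
  moreover have "length M = Suc (length M - 1)" using assms(2) by (cases M) auto
  then have "pochhammer (of_nat (excess M) :: rat) (length M)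
      = of_nat (excess M) * pochhammer (of_nat (excess M) + 1) (length M - 1)"
    by (metis pochhammer_rec)
  ultimately show ?thesis by (simp add: placement_coeff_def Let_def)
qed

text \<open>
  Polynomials in \<open>n\<close> and the scaled values of cycles of length at most \<open>d + 1\<close>, that is, those that need
  at most \<open>d\<close> transpositions.
\<close>

definition cycle_polys :: "nat \<Rightarrow> char_function \<Rightarrow> bool" where
  "cycle_polys d = polynomial_in ((\<lambda>j. scaled_value [Suc j]) ` {1..d})"

text \<open>
  The part of a scaled value that should be expressible by shorter cycles.
\<close>

definition defect :: "nat \<Rightarrow> nat list \<Rightarrow> char_function" where
  "defect d L n F = scaled_value L n F - of_rat (cycle_coeff L) * scaled_value [Suc d] n F"

lemma scaled_value_cover:
  assumes "central_character n F" "distinct (concat css)" "set (concat css) = {1..s}"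
  shows "scaled_value (map length css) n F = falling n s * F (product_of_cycles css)"
proof -
  have s: "sum_list (map length css) = s"
    using distinct_card[OF assms(2)] unfolding assms(3) length_concat by simp
  show ?thesis
  proof (cases "s \<le> n")
    case True
    then have "set (concat css) \<subseteq> {1..n}" unfolding assms(3) by auto
    from scaled_value_eq[OF assms(1,2) this refl] show ?thesis unfolding s .
  next
    case False
    then have "falling n s = 0" by (simp add: falling_eq_0_iff)
    then show ?thesis unfolding scaled_value_def s by simp
  qed
qed

text \<open>
  The cycles in \<open>M\<close> are placed one after the other, starting from the state described at
  \<open>placement_coeff\<close>; \<open>A\<close> is the set of points of the big cycle \<open>C\<close> that may still be touched. A cycle
  of \<open>M\<close> without contact joins \<open>rest\<close>, one with a single contact is merged into \<open>C\<close>, and one with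
  several contacts makes the whole product shorter, so that \<open>short\<close> applies. A state with fewer
  than \<open>N\<close> cycles in the end is known by \<open>few\<close>; this leaves only the placement without any
  contact, which contributes the last defect. The assumptions \<open>short\<close> and \<open>few\<close> are the two
  induction hypotheses of \<open>defect_in_cycle_polys\<close>.
\<close>

lemma placements_modulo_shorter:
  assumes short: "\<And>s p j. p permutes {1..s} \<Longrightarrow> swapidseq j p \<Longrightarrow> j < d
      \<Longrightarrow> polynomial_in G (\<lambda>n F. falling n s * F p)"
    and few: "\<And>L. L \<noteq> [] \<Longrightarrow> \<forall>l\<in>set L. 2 \<le> l \<Longrightarrow> excess L = d \<Longrightarrow> length L < N
      \<Longrightarrow> polynomial_in G (defect d L)"
    and "distinct (C @ concat rest)" "set C \<union> set (concat rest) = {1..s}" "A \<subseteq> set C" "2 \<le> length C"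
    and "\<forall>l\<in>set (map length rest @ M). 2 \<le> l"
    and "excess (length C # map length rest @ M) = d" "1 + length rest + length M \<le> N"
  shows "polynomial_in G (\<lambda>n F. (\<Sum>P\<in>patterns (sum_list M) A s. falling n (labels s P)
        * F (product_of_cycles (C # rest) \<circ> product_of_cycles (chop M P)))
      - of_rat (placement_coeff d (of_nat (card A)) (length C) (map length rest) M) * scaled_value [Suc d] n F
      - defect d (length C # map length rest @ M) n F)"
  using assms(3-)
proof (induction M arbitrary: C rest A s)
  case Nil
  have props: "distinct (concat (C # rest))" "set (concat (C # rest)) = {1..s}"
    using Nil.prems(1,2) by (simp_all del: set_concat)
  have eq: "scaled_value (length C # map length rest) n F = falling n s * F (product_of_cycles (C # rest))"
    if F: "central_character n F" for n F
    using scaled_value_cover[OF F props] unfolding list.map .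
  have coeff: "placement_coeff d (of_nat (card A)) (length C) (map length rest) []
    = cycle_coeff (length C # map length rest)"
    using Nil.prems(6) by (intro placement_coeff_Nil) simp
  have sum: "(\<Sum>P\<in>patterns (sum_list []) A s. falling n (labels s P)
      * F (product_of_cycles (C # rest) \<circ> product_of_cycles (chop [] P))) = falling n s * F (product_of_cycles (C # rest))" for n F
    by (simp del: product_of_cycles.simps(2))
  show ?case
  proof (rule polynomial_in.cong[OF polynomial_in_0])
    fix n and F :: "(nat \<Rightarrow> nat) \<Rightarrow> complex" assume F: "central_character n F"
    show "0 = (\<Sum>P\<in>patterns (sum_list []) A s. falling n (labels s P)
        * F (product_of_cycles (C # rest) \<circ> product_of_cycles (chop [] P)))
      - of_rat (placement_coeff d (of_nat (card A)) (length C) (map length rest) []) * scaled_value [Suc d] n F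
      - defect d (length C # map length rest @ []) n F"
      unfolding sum coeff append_Nil2 defect_def eq[OF F] by simp
  qed
next
  case (Cons b M)
  define u where "u = length C"
  define R where "R = map length rest"
  define Y :: rat where "Y = of_nat (card A)"
  have b: "2 \<le> b" and u: "2 \<le> u" using Cons.prems(4,5) by (simp_all add: u_def)
  have As: "A \<subseteq> {1..s}" using Cons.prems(2,3) by auto
  have finA: "finite A" using As finite_subset by auto
  define H where "H = (\<lambda>P n F. \<Sum>Q\<in>patterns (sum_list M) (A - set P) (labels s P). falling n (labels s (P @ Q))
        * F (product_of_cycles (C # rest) \<circ> (cycle_of_list P \<circ> product_of_cycles (chop M Q))))"
  define T where "T = (\<lambda>t. {P \<in> patterns b A s. card (set P \<inter> A) = t})"
  define T2 where "T2 = {P \<in> patterns b A s. 2 \<le> card (set P \<inter> A)}"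
  have fin: "finite (patterns b A s)" by (rule finite_patterns[OF finA])
  have split: "(\<Sum>P\<in>patterns (sum_list (b # M)) A s. falling n (labels s P)
        * F (product_of_cycles (C # rest) \<circ> product_of_cycles (chop (b # M) P)))
    = (\<Sum>P\<in>T 0. H P n F) + (\<Sum>P\<in>T 1. H P n F) + (\<Sum>P\<in>T2. H P n F)" for n F
  proof -
    have "(\<Sum>P\<in>patterns (sum_list (b # M)) A s. falling n (labels s P)
        * F (product_of_cycles (C # rest) \<circ> product_of_cycles (chop (b # M) P)))
      = (\<Sum>P\<in>patterns b A s. H P n F)"
      unfolding sum_list.Cons sum_patterns_add[OF As] H_def
    proof (intro sum.cong refl)
      fix P Q assume "P \<in> patterns b A s"
      then have "length P = b" using patterns_properties[OF _ As] by simp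
      then show "falling n (labels s (P @ Q)) * F (product_of_cycles (C # rest) \<circ> product_of_cycles (chop (b # M) (P @ Q)))
        = falling n (labels s (P @ Q)) * F (product_of_cycles (C # rest) \<circ> (cycle_of_list P \<circ> product_of_cycles (chop M Q)))"
        by (simp only: chop_append product_of_cycles.simps)
    qed
    also have "patterns b A s = T 0 \<union> T 1 \<union> T2"
      unfolding T_def T2_def by (auto simp: numeral_2_eq_2 not_less_eq_eq le_Suc_eq)
    also have "(\<Sum>P\<in>\<dots>. H P n F) = (\<Sum>P\<in>T 0 \<union> T 1. H P n F) + (\<Sum>P\<in>T2. H P n F)"
      using fin by (intro sum.union_disjoint) (auto simp: T_def T2_def)
    also have "(\<Sum>P\<in>T 0 \<union> T 1. H P n F) = (\<Sum>P\<in>T 0. H P n F) + (\<Sum>P\<in>T 1. H P n F)"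
      using fin by (intro sum.union_disjoint) (auto simp: T_def)
    finally show ?thesis .
  qed
  have disj: "set C \<inter> set (concat rest) = {}" "distinct C" "distinct (concat rest)"
    using Cons.prems(1) unfolding distinct_append by simp_all
  have block: "length P = b" "distinct P" "s \<le> labels s P" "set P \<subseteq> A \<union> {s<..labels s P}"
      "{s<..labels s P} \<subseteq> set P" "set P \<inter> set (concat rest) = {}" "set C \<inter> set P = set P \<inter> A"
      "set P \<union> {1..s} = {1..labels s P}"
    if "P \<in> patterns b A s" for P
  proof -
    note pp = patterns_properties[OF that As]
    then show l: "length P = b" "distinct P" "s \<le> labels s P" "set P \<subseteq> A \<union> {s<..labels s P}"
      "{s<..labels s P} \<subseteq> set P" by simp_all
    have Cs: "set C \<subseteq> {1..s}" "set (concat rest) \<subseteq> {1..s}" using Cons.prems(2) by (simp_all only: Un_upper1 Un_upper2 flip: Cons.prems(2))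
    show "set P \<inter> set (concat rest) = {}"
    proof (rule equals0I)
      fix x assume x: "x \<in> set P \<inter> set (concat rest)"
      then have "x \<in> A \<union> {s<..labels s P}" using l(4) by (meson IntD1 subsetD)
      moreover have "x \<notin> A" using x disj(1) Cons.prems(3) by (metis IntD2 IntI empty_iff subsetD)
      moreover have "x \<le> s" using x Cs(2) by (meson IntD2 subsetD atLeastAtMost_iff)
      ultimately show False by simp
    qed
    show "set C \<inter> set P = set P \<inter> A"
    proof (intro subset_antisym subsetI)
      fix x assume x: "x \<in> set C \<inter> set P"
      then have "x \<in> A \<union> {s<..labels s P}" using l(4) by (meson IntD2 subsetD)
      moreover have "x \<le> s" using x Cs(1) by (meson IntD1 subsetD atLeastAtMost_iff)
      ultimately show "x \<in> set P \<inter> A" using x by simp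
    next
      fix x assume "x \<in> set P \<inter> A"
      then show "x \<in> set C \<inter> set P" using Cons.prems(3) by (meson IntD1 IntD2 IntI subsetD)
    qed
    have iv: "{1..labels s P} = {1..s} \<union> {s<..labels s P}" using l(3) by auto
    show "set P \<union> {1..s} = {1..labels s P}"
      unfolding iv
    proof (intro subset_antisym Un_least)
      show "set P \<subseteq> {1..s} \<union> {s<..labels s P}" by (rule order_trans[OF l(4) Un_mono[OF As subset_refl]])
      show "{s<..labels s P} \<subseteq> set P \<union> {1..s}" by (rule le_supI1[OF l(5)])
    qed simp_all
  qed
  have dist_block: "distinct (concat (rest @ [P]))" if "P \<in> patterns b A s" for P
    using block(2,6)[OF that] disj(3) by (simp add: Int_commute del: set_concat)
  have commute: "product_of_cycles (C # rest) \<circ> cycle_of_list P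
      = cycle_of_list C \<circ> cycle_of_list P \<circ> product_of_cycles rest" if "P \<in> patterns b A s" for P
  proof -
    have "product_of_cycles (rest @ [P]) = product_of_cycles (P # rest)"
      by (rule product_of_cycles_cong_mset[OF _ dist_block[OF that]]) simp
    then have "product_of_cycles rest \<circ> cycle_of_list P = cycle_of_list P \<circ> product_of_cycles rest"
      unfolding product_of_cycles_append product_of_cycles.simps comp_id .
    then show ?thesis unfolding product_of_cycles.simps comp_assoc by (simp only:)
  qed
  have exc: "u - 1 + (excess R + (b - 1 + excess M)) = d"
    using Cons.prems(6) by (simp add: u_def R_def)

  \<comment> \<open>By \<open>patterns_avoiding\<close> only one block avoids \<open>A\<close>, and this is the one branch that keeps the number
    of cycles; the defect of the original type is handed down along it.\<close>
  have zero: "polynomial_in G (\<lambda>n F. (\<Sum>P\<in>T 0. H P n F)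
      - of_rat (placement_coeff d Y u (R @ [b]) M) * scaled_value [Suc d] n F - defect d (u # R @ b # M) n F)"
  proof -
    define P where "P = [Suc s..<Suc (s + b)]"
    have "T 0 = {P}"
      using patterns_avoiding[OF As, of b] finA unfolding T_def P_def by (simp add: card_eq_0_iff)
    have "P \<in> {P \<in> patterns b A s. set P \<inter> A = {}}"
      unfolding patterns_avoiding[OF As] P_def by (rule singletonI)
    then have P: "P \<in> patterns b A s" "set P \<inter> A = {}" by simp_all
    have AP: "A - set P = A" using P(2) by auto
    have len: "map length (rest @ [P]) = R @ [b]" using block(1)[OF P(1)] by (simp add: R_def)
    have "polynomial_in G (\<lambda>n F. (\<Sum>Q\<in>patterns (sum_list M) A (labels s P). falling n (labels (labels s P) Q)
        * F (product_of_cycles (C # rest @ [P]) \<circ> product_of_cycles (chop M Q)))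
      - of_rat (placement_coeff d (of_nat (card A)) (length C) (map length (rest @ [P])) M) * scaled_value [Suc d] n F
      - defect d (length C # map length (rest @ [P]) @ M) n F)"
    proof (rule Cons.IH)
      have "set P \<inter> set C = {}" using block(7)[OF P(1)] P(2) by (simp add: Int_commute)
      then show "distinct (C @ concat (rest @ [P]))"
        using dist_block[OF P(1)] disj(1,2) by (simp add: Int_Un_distrib Int_commute del: set_concat)
      show "set C \<union> set (concat (rest @ [P])) = {1..labels s P}"
        unfolding block(8)[OF P(1), symmetric] Cons.prems(2)[symmetric] concat_append set_append by auto
      show "A \<subseteq> set C" "2 \<le> length C" by (fact Cons.prems(3), fact Cons.prems(4))
      show "\<forall>l\<in>set (map length (rest @ [P]) @ M). 2 \<le> l"
        using Cons.prems(5) unfolding len R_def by auto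
      show "excess (length C # map length (rest @ [P]) @ M) = d"
        using exc unfolding len by (simp add: u_def)
      show "1 + length (rest @ [P]) + length M \<le> N" using Cons.prems(7) by simp
    qed
    then show ?thesis
      unfolding len \<open>T 0 = {P}\<close> Y_def[symmetric] u_def[symmetric] H_def
      by (simp add: AP product_of_cycles_append comp_assoc del: fold.simps)
  qed

  \<comment> \<open>Merging loses a cycle, so the defect that the induction hypothesis produces is covered by \<open>few\<close>. All
    these blocks lead to the same coefficient, which is multiplied by their number.\<close>
  have one: "polynomial_in G (\<lambda>n F. (\<Sum>P\<in>T 1. H P n F)
      - of_rat (of_nat b * Y * placement_coeff d (Y - 1) (u + b - 1) R M) * scaled_value [Suc d] n F)"
  proof -
    have "polynomial_in G (\<lambda>n F. H P n F
      - of_rat (placement_coeff d (Y - 1) (u + b - 1) R M) * scaled_value [Suc d] n F)" if "P \<in> T 1" for P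
    proof -
      have P: "P \<in> patterns b A s" "card (set P \<inter> A) = 1" using that by (simp_all add: T_def)
      obtain z where z: "set P \<inter> A = {z}" using P(2) card_1_singletonE by metis
      have "set C \<inter> set P = {z}" unfolding block(7)[OF P(1)] by (rule z)
      then obtain C' where C': "distinct C'" "set C' = set C \<union> set P" "length C' = length C + length P - 1"
        "cycle_of_list C \<circ> cycle_of_list P = cycle_of_list C'"
        using merge_cycles[OF disj(2) block(2)[OF P(1)]] by metis
      have AP: "A - set P = A - {z}" using z by auto
      have "z \<in> A" using z by auto
      then have cA: "of_nat (card (A - set P)) = Y - 1"
        unfolding AP Y_def using finA card_gt_0_iff[of A] by (auto simp: of_nat_diff)
      have lC': "length C' = u + b - 1" using C'(3) block(1)[OF P(1)] by (simp add: u_def)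
      have exC': "excess ((u + b - 1) # R @ M) = d" using exc u b by simp
      have ge2: "\<forall>l\<in>set (R @ M). 2 \<le> l" using Cons.prems(5) by (simp add: R_def)
      have "polynomial_in G (\<lambda>n F. (\<Sum>Q\<in>patterns (sum_list M) (A - set P) (labels s P). falling n (labels (labels s P) Q)
          * F (product_of_cycles (C' # rest) \<circ> product_of_cycles (chop M Q)))
        - of_rat (placement_coeff d (of_nat (card (A - set P))) (length C') (map length rest) M) * scaled_value [Suc d] n F
        - defect d (length C' # map length rest @ M) n F)"
      proof (rule Cons.IH)
        have "set C' \<inter> set (concat rest) = {}"
          using disj(1) block(6)[OF P(1)] unfolding C'(2) by (simp add: Int_Un_distrib2 del: set_concat)
        then show "distinct (C' @ concat rest)" using C'(1) disj(3) by (simp del: set_concat)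
        show "set C' \<union> set (concat rest) = {1..labels s P}"
          unfolding block(8)[OF P(1), symmetric] Cons.prems(2)[symmetric] C'(2) by auto
        show "A - set P \<subseteq> set C'" using Cons.prems(3) C'(2) by auto
        show "2 \<le> length C'" using lC' u b by simp
        show "\<forall>l\<in>set (map length rest @ M). 2 \<le> l" using ge2 by (simp add: R_def)
        show "excess (length C' # map length rest @ M) = d" using exC' unfolding lC' R_def .
        show "1 + length rest + length M \<le> N" using Cons.prems(7) by simp
      qed
      moreover have "polynomial_in G (defect d ((u + b - 1) # R @ M))"
      proof (rule few)
        show "\<forall>l\<in>set ((u + b - 1) # R @ M). 2 \<le> l" using ge2 u b by auto
        show "length ((u + b - 1) # R @ M) < N" using Cons.prems(7) by (simp add: R_def)
      qed (use exC' in simp_all)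
      ultimately have "polynomial_in G (\<lambda>n F. ((\<Sum>Q\<in>patterns (sum_list M) (A - set P) (labels s P). falling n (labels (labels s P) Q)
          * F (product_of_cycles (C' # rest) \<circ> product_of_cycles (chop M Q)))
        - of_rat (placement_coeff d (Y - 1) (u + b - 1) R M) * scaled_value [Suc d] n F
        - defect d ((u + b - 1) # R @ M) n F) + defect d ((u + b - 1) # R @ M) n F)"
        unfolding cA lC' R_def by (rule polynomial_in.add)
      then have "polynomial_in G (\<lambda>n F. (\<Sum>Q\<in>patterns (sum_list M) (A - set P) (labels s P). falling n (labels (labels s P) Q)
          * F (product_of_cycles (C' # rest) \<circ> product_of_cycles (chop M Q)))
        - of_rat (placement_coeff d (Y - 1) (u + b - 1) R M) * scaled_value [Suc d] n F)"
        by (simp only: diff_add_cancel)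
      moreover have merged: "product_of_cycles (C # rest) \<circ> (cycle_of_list P \<circ> h) = product_of_cycles (C' # rest) \<circ> h"
        for h :: "nat \<Rightarrow> nat"
      proof -
        have "product_of_cycles (C # rest) \<circ> (cycle_of_list P \<circ> h)
          = (product_of_cycles (C # rest) \<circ> cycle_of_list P) \<circ> h" by (simp only: comp_assoc)
        also have "\<dots> = (cycle_of_list C \<circ> cycle_of_list P \<circ> product_of_cycles rest) \<circ> h"
          by (simp only: commute[OF P(1)])
        also have "\<dots> = product_of_cycles (C' # rest) \<circ> h"
          by (simp only: C'(4) product_of_cycles.simps)
        finally show ?thesis .
      qed
      ultimately show ?thesis unfolding H_def merged fold_append o_apply by (simp only:)
    qed
    from polynomial_in_sum[OF this]
    have "polynomial_in G (\<lambda>n F. \<Sum>P\<in>T 1. H P n F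
      - of_rat (placement_coeff d (Y - 1) (u + b - 1) R M) * scaled_value [Suc d] n F)" .
    moreover have cT: "card (T 1) = b * card A"
      unfolding T_def by (rule card_patterns_touching_once[OF As])
    ultimately show ?thesis
      unfolding sum_subtractf sum_constant cT Y_def of_rat_mult of_rat_of_nat_eq of_nat_mult
      by (simp only: mult.assoc)
  qed

  \<comment> \<open>Whatever the remaining cycles do, the product is already shorter.\<close>
  have several: "polynomial_in G (\<lambda>n F. \<Sum>P\<in>T2. H P n F)"
  proof (rule polynomial_in_sum)
    fix P assume "P \<in> T2"
    then have P: "P \<in> patterns b A s" "2 \<le> card (set P \<inter> A)" by (simp_all add: T2_def)
    have "\<exists>x y. x \<in> set C \<inter> set P \<and> y \<in> set C \<inter> set P \<and> x \<noteq> y"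
    proof -
      have "2 \<le> card (set C \<inter> set P)" unfolding block(7)[OF P(1)] by (rule P(2))
      then have "\<not> card (set C \<inter> set P) \<le> Suc 0" by simp
      then show ?thesis using card_le_Suc0_iff_eq[of "set C \<inter> set P"] by auto
    qed
    then obtain x y where xy: "x \<in> set C \<inter> set P" "y \<in> set C \<inter> set P" "x \<noteq> y" by metis
    show "polynomial_in G (H P)" unfolding H_def
    proof (rule polynomial_in_sum)
      fix Q assume Q: "Q \<in> patterns (sum_list M) (A - set P) (labels s P)"
      have sub: "A - set P \<subseteq> {1..labels s P}" using As block(3)[OF P(1)] by auto
      note qq = patterns_properties[OF Q sub]
      define p where "p = product_of_cycles (C # rest) \<circ> (cycle_of_list P \<circ> product_of_cycles (chop M Q))"
      define s' where "s' = labels s (P @ Q)"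
      have s': "s' = labels (labels s P) Q" by (simp add: s'_def)
      have le: "labels s P \<le> s'" using qq unfolding s' by simp
      have "A - set P \<subseteq> {1..s'}" using sub le by (auto dest!: subsetD)
      moreover have "{labels s P<..s'} \<subseteq> {1..s'}" by auto
      moreover have "set Q \<subseteq> (A - set P) \<union> {labels s P<..s'}" using qq unfolding s' by simp
      ultimately have setQ: "set Q \<subseteq> {1..s'}" by (meson Un_least order_trans)
      have "{1..labels s P} \<subseteq> {1..s'}" using le by auto
      moreover have "set P \<union> {1..s} \<subseteq> {1..labels s P}" unfolding block(8)[OF P(1)] ..
      ultimately have setP: "set P \<subseteq> {1..s'}" "{1..s} \<subseteq> {1..s'}" by (meson Un_upper1 Un_upper2 order_trans)+
      have "product_of_cycles (C # rest) permutes {1..s'}"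
        using setP(2) Cons.prems(2) by (intro product_of_cycles_permutes') simp
      moreover have "cycle_of_list P permutes {1..s'}"
        by (rule permutes_subset[OF cycle_permutes setP(1)])
      moreover have "product_of_cycles (chop M Q) permutes {1..s'}"
        using qq setQ by (intro product_of_cycles_chop_permutes) simp_all
      ultimately have perm: "p permutes {1..s'}" unfolding p_def by (intro permutes_compose)
      have "p = cycle_of_list C \<circ> cycle_of_list P \<circ> (product_of_cycles rest \<circ> product_of_cycles (chop M Q))"
        unfolding p_def comp_assoc[symmetric] commute[OF P(1)] ..
      moreover have "swapidseq ((length C - 2) + (length P - 2)) (cycle_of_list C \<circ> cycle_of_list P)"
        by (rule swapidseq_cycles_sharing_two[OF disj(2) block(2)[OF P(1)] xy])
      moreover have "swapidseq (excess R) (product_of_cycles rest)"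
        unfolding R_def by (rule swapidseq_product_of_cycles) (rule distinct_in_concat[OF disj(3)])
      moreover have "swapidseq (excess M) (product_of_cycles (chop M Q))"
        using swapidseq_product_of_cycles[of "chop M Q"] distinct_in_concat[OF chop_concat_props(1)[of Q M]] qq
          map_length_chop[of Q M] by simp
      ultimately have "swapidseq ((length C - 2) + (length P - 2) + (excess R + excess M)) p"
        by (simp only: swapidseq_comp_add)
      moreover have "(length C - 2) + (length P - 2) + (excess R + excess M) < d"
        using exc u b block(1)[OF P(1)] unfolding u_def by simp
      ultimately show "polynomial_in G (\<lambda>n F. falling n (labels s (P @ Q))
          * F (product_of_cycles (C # rest) \<circ> (cycle_of_list P \<circ> product_of_cycles (chop M Q))))"
        using short[OF perm] unfolding p_def s'_def by (simp only:)
    qed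
  qed
  have coeff: "placement_coeff d Y u R (b # M)
    = placement_coeff d Y u (R @ [b]) M + of_nat b * Y * placement_coeff d (Y - 1) (u + b - 1) R M"
    using u b by (intro placement_coeff_Cons) auto
  have "polynomial_in G (\<lambda>n F. ((\<Sum>P\<in>T 0. H P n F)
      - of_rat (placement_coeff d Y u (R @ [b]) M) * scaled_value [Suc d] n F - defect d (u # R @ b # M) n F)
    + ((\<Sum>P\<in>T 1. H P n F)
      - of_rat (of_nat b * Y * placement_coeff d (Y - 1) (u + b - 1) R M) * scaled_value [Suc d] n F)
    + (\<Sum>P\<in>T2. H P n F))"
    by (intro polynomial_in.add zero one several)
  then show ?case
    unfolding split u_def[symmetric] R_def[symmetric] Y_def[symmetric] coeff of_rat_add
    by (rule polynomial_in.cong) (simp add: algebra_simps)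
qed

lemma cycle_polys_mono:
  assumes "cycle_polys e f" "e \<le> d"
  shows "cycle_polys d f"
  using assms(1) unfolding cycle_polys_def
proof (rule polynomial_in_trans)
  fix g assume "g \<in> (\<lambda>j. scaled_value [Suc j]) ` {1..e}"
  then have "g \<in> (\<lambda>j. scaled_value [Suc j]) ` {1..d}" using assms(2) by auto
  then show "polynomial_in ((\<lambda>j. scaled_value [Suc j]) ` {1..d}) g" by (rule polynomial_in.gen)
qed

lemma scaled_value_from_defect:
  assumes "polynomial_in G (defect d L)" "polynomial_in G (scaled_value [Suc d])"
  shows "polynomial_in G (scaled_value L)"
  by (rule polynomial_in.cong[OF polynomial_in.add[OF assms(1) polynomial_in_scale[OF assms(2), of "cycle_coeff L"]]])
    (simp add: defect_def)

lemma scaled_value_Nil: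
  "central_character n F \<Longrightarrow> scaled_value [] n F = 1"
  by (simp add: scaled_value_def central_character_def)

lemma excess_pos: "L \<noteq> [] \<Longrightarrow> \<forall>l\<in>set L. 2 \<le> l \<Longrightarrow> 1 \<le> excess L"
  by (cases L) auto

text \<open>
  Let \<open>L = a # M\<close>. In the product of the scaled values of \<open>[a]\<close> and \<open>M\<close>, both of which are shorter,
  the total coefficient of the long cycle vanishes by \<open>placement_coeff_full\<close>. What remains is the
  defect of \<open>L\<close>.
\<close>

theorem defect_in_cycle_polys:
  assumes "L \<noteq> []" "\<forall>l\<in>set L. 2 \<le> l" "excess L = d"
  shows "cycle_polys (d - 1) (defect d L)"
  using assms
proof (induction d arbitrary: L rule: less_induct)
  case (less d)
  define G where "G = (\<lambda>j. scaled_value [Suc j]) ` {1..d - 1}"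
  have G: "cycle_polys (d - 1) = polynomial_in G" by (simp add: cycle_polys_def G_def)
  have low: "polynomial_in G (scaled_value L)" if L: "\<forall>l\<in>set L. 2 \<le> l" "excess L < d" for L
  proof (cases "L = []")
    case True
    show ?thesis unfolding True
      by (rule polynomial_in.cong[OF polynomial_in_1]) (simp add: scaled_value_Nil)
  next
    case False
    define e where "e = excess L"
    have e: "1 \<le> e" "e \<le> d - 1" using excess_pos[OF False L(1)] L(2) by (simp_all add: e_def)
    have "e < d" using L(2) by (simp add: e_def)
    then have "cycle_polys (e - 1) (defect e L)" by (rule less.IH[OF _ False L(1) e_def[symmetric]])
    then have "polynomial_in G (defect e L)" unfolding G[symmetric] by (rule cycle_polys_mono) (use e in simp)
    moreover have "polynomial_in G (scaled_value [Suc e])"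
      by (rule polynomial_in.gen) (use e in \<open>simp add: G_def\<close>)
    ultimately show ?thesis by (rule scaled_value_from_defect)
  qed
  have short: "polynomial_in G (\<lambda>n F. falling n s * F p)"
    if p: "p permutes {1..s}" "swapidseq j p" "j < d" for s p j
  proof -
    obtain css where css: "distinct (concat css)" "[] \<notin> set css" "set (concat css) = {1..s}" "p = product_of_cycles css"
      using cycles_decomposition[OF p(1) finite_atLeastAtMost] by (elim exE conjE)
    define K where "K = map length css"
    have "excess K \<le> j" using excess_le_swapidseq[OF css(1,2)] p(2) unfolding css(4) K_def by simp
    then have "polynomial_in G (scaled_value (filter (\<lambda>l. 2 \<le> l) K))"
      using p(3) by (intro low) (simp_all add: excess_filter)
    from polynomial_in.mult[OF polynomial_in_falling_tail this] show ?thesis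
    proof (rule polynomial_in.cong)
      fix n and F :: "(nat \<Rightarrow> nat) \<Rightarrow> complex" assume F: "central_character n F"
      show "(\<Prod>i\<in>{sum_list (filter (\<lambda>l. 2 \<le> l) K)..<sum_list K}. of_nat n - of_nat i)
          * scaled_value (filter (\<lambda>l. 2 \<le> l) K) n F = falling n s * F p"
        unfolding scaled_value_drop_ones[OF F, symmetric] K_def css(4)
        by (rule scaled_value_cover[OF F css(1,3)])
    qed
  qed
  have "polynomial_in G (defect d L)" using less.prems
  proof (induction "length L" arbitrary: L rule: less_induct)
    case (less L)
    obtain a M where L: "L = a # M" using less.prems(1) by (cases L) auto
    have a: "2 \<le> a" and M: "\<forall>l\<in>set M. 2 \<le> l" using less.prems(2) by (simp_all add: L)
    have exc: "a - 1 + excess M = d" using less.prems(3) by (simp add: L)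
    show ?case
    proof (cases "M = []")
      case True
      then have "Suc d = a" using exc a by simp
      then have "defect d L n F = 0" for n F
        using a cycle_coeff_singleton[of a] by (simp add: defect_def L True)
      then show ?thesis by (intro polynomial_in.cong[OF polynomial_in_0]) simp
    next
      case False
      have few: "polynomial_in G (defect d K)"
        if "K \<noteq> []" "\<forall>l\<in>set K. 2 \<le> l" "excess K = d" "length K < length L" for K
        using less.hyps that by metis
      define C where "C = [1..<Suc a]"
      have C: "distinct C" "set C = {1..a}" "length C = a" by (auto simp: C_def simp del: upt_Suc)
      have "polynomial_in G (\<lambda>n F. (\<Sum>P\<in>patterns (sum_list M) {1..a} a. falling n (labels a P)
          * F (product_of_cycles (C # []) \<circ> product_of_cycles (chop M P)))
        - of_rat (placement_coeff d (of_nat (card {1..a})) (length C) (map length ([] :: nat list list)) M) * scaled_value [Suc d] n F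
        - defect d (length C # map length ([] :: nat list list) @ M) n F)"
      proof (rule placements_modulo_shorter[where N = "length L"])
        show "polynomial_in G (\<lambda>n F. falling n s * F p)" if "p permutes {1..s}" "swapidseq j p" "j < d" for s p j
          by (rule short[OF that])
        show "polynomial_in G (defect d K)"
          if "K \<noteq> []" "\<forall>l\<in>set K. 2 \<le> l" "excess K = d" "length K < length L" for K
          by (rule few[OF that])
      qed (use C a M exc in \<open>simp_all add: L\<close>)
      moreover have "placement_coeff d (of_nat (card {1..a})) (length C) (map length ([] :: nat list list)) M = 0"
        using placement_coeff_full[of a M d] exc False a C(3) by simp
      ultimately have "polynomial_in G (\<lambda>n F. (\<Sum>P\<in>patterns (sum_list M) {1..a} a. falling n (labels a P)
          * F (cycle_of_list C \<circ> product_of_cycles (chop M P))) - defect d L n F)"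
        using C(3) by (simp add: L)
      then have "polynomial_in G (\<lambda>n F. scaled_value [a] n F * scaled_value M n F - defect d L n F)"
        by (rule polynomial_in.cong) (simp only: scaled_value_mult C_def)
      moreover have "polynomial_in G (\<lambda>n F. scaled_value [a] n F * scaled_value M n F)"
      proof (intro polynomial_in.mult low)
        show "excess [a] < d" using exc excess_pos[OF False M] a by simp
        show "excess M < d" using exc a by simp
      qed (use a M in simp_all)
      ultimately have "polynomial_in G (\<lambda>n F. scaled_value [a] n F * scaled_value M n F
        - (scaled_value [a] n F * scaled_value M n F - defect d L n F))"
        by (rule polynomial_in_diff[rotated])
      then show ?thesis by (rule polynomial_in.cong) simp
    qed
  qed
  then show ?case unfolding G .
qed

lemma scaled_value_in_cycle_polys:
  assumes "\<forall>l\<in>set L. 2 \<le> l"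
  shows "cycle_polys (excess L) (scaled_value L)"
proof (cases "L = []")
  case True
  show ?thesis unfolding True cycle_polys_def
    by (rule polynomial_in.cong[OF polynomial_in_1]) (simp add: scaled_value_Nil)
next
  case False
  have e: "1 \<le> excess L" by (rule excess_pos[OF False assms])
  have "cycle_polys (excess L) (defect (excess L) L)"
    by (rule cycle_polys_mono[OF defect_in_cycle_polys[OF False assms refl]]) simp
  moreover have "cycle_polys (excess L) (scaled_value [Suc (excess L)])"
    unfolding cycle_polys_def by (rule polynomial_in.gen) (use e in simp)
  ultimately show ?thesis unfolding cycle_polys_def by (rule scaled_value_from_defect)
qed

text \<open>
  The equation for the defect of \<open>D j\<close> is solved for the cycle of length \<open>j + 1\<close>; this divides by a nonzero
  constant only.
\<close>

theorem cycle_polys_change_generators: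
  assumes "cycle_polys d f"
    and "\<And>j. j \<in> {1..d} \<Longrightarrow> excess (D j) = j \<and> (\<forall>l\<in>set (D j). 2 \<le> l)"
  shows "polynomial_in ((\<lambda>j. scaled_value (D j)) ` {1..d}) f"
  using assms
proof (induction d arbitrary: f rule: less_induct)
  case (less d)
  define H where "H = (\<lambda>j. scaled_value (D j)) ` {1..d}"
  have cyc: "polynomial_in H (scaled_value [Suc j])" if j: "j \<in> {1..d}" for j
  proof -
    have D: "excess (D j) = j" "\<forall>l\<in>set (D j). 2 \<le> l" using less.prems(2)[OF j] by simp_all
    have ne: "D j \<noteq> []" using D(1) j by auto
    have "cycle_polys (j - 1) (defect j (D j))" by (rule defect_in_cycle_polys[OF ne D(2,1)])
    then have "polynomial_in ((\<lambda>j. scaled_value (D j)) ` {1..j - 1}) (defect j (D j))"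
    proof (rule less.IH[rotated])
      fix i assume "i \<in> {1..j - 1}"
      then have "i \<in> {1..d}" using j by auto
      then show "excess (D i) = i \<and> (\<forall>l\<in>set (D i). 2 \<le> l)" by (rule less.prems(2))
    qed (use j in auto)
    then have "polynomial_in H (defect j (D j))"
    proof (rule polynomial_in_trans)
      fix g assume "g \<in> (\<lambda>j. scaled_value (D j)) ` {1..j - 1}"
      then have "g \<in> H" using j by (auto simp: H_def)
      then show "polynomial_in H g" by (rule polynomial_in.gen)
    qed
    moreover have "polynomial_in H (scaled_value (D j))"
      by (rule polynomial_in.gen) (use j in \<open>simp add: H_def\<close>)
    ultimately have "polynomial_in H (\<lambda>n F. of_rat (1 / cycle_coeff (D j)) * (scaled_value (D j) n F - defect j (D j) n F))"
      by (intro polynomial_in_scale polynomial_in_diff)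
    moreover have "0 \<notin> set (D j)" using D(2) by auto
    then have "cycle_coeff (D j) \<noteq> 0" by (rule cycle_coeff_nonzero)
    ultimately show ?thesis
      by (elim polynomial_in.cong) (simp add: defect_def of_rat_divide)
  qed
  show ?case unfolding H_def[symmetric]
    by (rule polynomial_in_trans[OF less.prems(1)[unfolded cycle_polys_def]]) (use cyc in auto)
qed

section \<open>Polynomials over the rational function field\<close>

lemma ratfun_defined_atI: "poly q a \<noteq> 0 \<Longrightarrow> ratfun_defined_at (Fraction_Field.Fract p q) a"
  unfolding ratfun_defined_at_def by (intro exI[of _ p] exI[of _ q] conjI refl)

lemma ratfun_defined_atE:
  assumes "ratfun_defined_at r a"
  obtains p q where "r = Fraction_Field.Fract p q" "poly q a \<noteq> 0" "q \<noteq> 0"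
  using assms unfolding ratfun_defined_at_def by (metis poly_0)

lemma ratfun_zero: "ratfun_defined_at 0 a" "ratfun_eval 0 a = 0"
proof -
  have z: "(0 :: rat poly fract) = Fraction_Field.Fract 0 1" by (rule Zero_fract_def)
  show "ratfun_defined_at 0 a" unfolding z by (rule ratfun_defined_atI) simp
  show "ratfun_eval 0 a = 0" unfolding z by (subst ratfun_eval_Fract) simp_all
qed

lemma ratfun_add:
  assumes "ratfun_defined_at r a" "ratfun_defined_at s a"
  shows "ratfun_defined_at (r + s) a" "ratfun_eval (r + s) a = ratfun_eval r a + ratfun_eval s a"
proof -
  obtain p q where r: "r = Fraction_Field.Fract p q" "poly q a \<noteq> 0" "q \<noteq> 0" using assms(1) by (rule ratfun_defined_atE)
  obtain p' q' where s: "s = Fraction_Field.Fract p' q'" "poly q' a \<noteq> 0" "q' \<noteq> 0" using assms(2) by (rule ratfun_defined_atE)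
  have rs: "r + s = Fraction_Field.Fract (p * q' + p' * q) (q * q')" using r s by simp
  have q: "poly (q * q') a \<noteq> 0" using r s by simp
  show "ratfun_defined_at (r + s) a" unfolding rs by (rule ratfun_defined_atI[OF q])
  have e: "ratfun_eval r a = poly p a / poly q a" "ratfun_eval s a = poly p' a / poly q' a"
    by (simp_all only: r(1) s(1) ratfun_eval_Fract[OF r(2)] ratfun_eval_Fract[OF s(2)])
  have "ratfun_eval (r + s) a = poly (p * q' + p' * q) a / poly (q * q') a"
    by (simp only: rs ratfun_eval_Fract[OF q])
  then show "ratfun_eval (r + s) a = ratfun_eval r a + ratfun_eval s a"
    unfolding e using r(2) s(2) by (simp add: add_frac_eq)
qed

lemma ratfun_mult:
  assumes "ratfun_defined_at r a" "ratfun_defined_at s a"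
  shows "ratfun_defined_at (r * s) a" "ratfun_eval (r * s) a = ratfun_eval r a * ratfun_eval s a"
proof -
  obtain p q where r: "r = Fraction_Field.Fract p q" "poly q a \<noteq> 0" "q \<noteq> 0" using assms(1) by (rule ratfun_defined_atE)
  obtain p' q' where s: "s = Fraction_Field.Fract p' q'" "poly q' a \<noteq> 0" "q' \<noteq> 0" using assms(2) by (rule ratfun_defined_atE)
  have rs: "r * s = Fraction_Field.Fract (p * p') (q * q')" using r s by simp
  have q: "poly (q * q') a \<noteq> 0" using r s by simp
  show "ratfun_defined_at (r * s) a" unfolding rs by (rule ratfun_defined_atI[OF q])
  have e: "ratfun_eval r a = poly p a / poly q a" "ratfun_eval s a = poly p' a / poly q' a"
    by (simp_all only: r(1) s(1) ratfun_eval_Fract[OF r(2)] ratfun_eval_Fract[OF s(2)])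
  have "ratfun_eval (r * s) a = poly (p * p') a / poly (q * q') a"
    by (simp only: rs ratfun_eval_Fract[OF q])
  then show "ratfun_eval (r * s) a = ratfun_eval r a * ratfun_eval s a"
    unfolding e by simp
qed

definition monomial_value :: "(nat \<Rightarrow>\<^sub>0 nat) \<Rightarrow> (nat \<Rightarrow> complex) \<Rightarrow> complex" where
  "monomial_value e t = (\<Prod>k\<in>Poly_Mapping.keys e. t k ^ Poly_Mapping.lookup e k)"

lemma monomial_value_superset:
  assumes "finite K" "Poly_Mapping.keys e \<subseteq> K"
  shows "monomial_value e t = (\<Prod>k\<in>K. t k ^ Poly_Mapping.lookup e k)"
  unfolding monomial_value_def
  by (rule prod.mono_neutral_left[OF assms]) (simp add: in_keys_iff)

lemma monomial_value_add: "monomial_value (e + e') t = monomial_value e t * monomial_value e' t"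
proof -
  define K where "K = Poly_Mapping.keys e \<union> Poly_Mapping.keys e'"
  have K: "finite K" "Poly_Mapping.keys e \<subseteq> K" "Poly_Mapping.keys e' \<subseteq> K" by (simp_all add: K_def)
  have "Poly_Mapping.keys (e + e') \<subseteq> K" unfolding K_def by (rule keys_add)
  from monomial_value_superset[OF K(1) this] show ?thesis
    unfolding monomial_value_superset[OF K(1,2)] monomial_value_superset[OF K(1,3)]
    by (simp add: lookup_add power_add prod.distrib)
qed

lemma plug_in_superset:
  assumes "finite K" "Poly_Mapping.keys T \<subseteq> K"
  shows "plug_in T a t = (\<Sum>e\<in>K. of_rat (ratfun_eval (Poly_Mapping.lookup T e) a) * monomial_value e t)"
  unfolding plug_in_def monomial_value_def
  by (rule sum.mono_neutral_left[OF assms]) (simp add: in_keys_iff ratfun_zero)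

lemma coeffs_defined_atD: "coeffs_defined_at T a \<Longrightarrow> ratfun_defined_at (Poly_Mapping.lookup T e) a"
  by (cases "e \<in> Poly_Mapping.keys T") (simp_all add: coeffs_defined_at_def in_keys_iff ratfun_zero)

lemma plug_in_add:
  assumes "coeffs_defined_at T a" "coeffs_defined_at S a"
  shows "coeffs_defined_at (T + S) a" "plug_in (T + S) a t = plug_in T a t + plug_in S a t"
proof -
  define K where "K = Poly_Mapping.keys T \<union> Poly_Mapping.keys S"
  have K: "finite K" "Poly_Mapping.keys T \<subseteq> K" "Poly_Mapping.keys S \<subseteq> K" by (simp_all add: K_def)
  have TS: "Poly_Mapping.keys (T + S) \<subseteq> K" unfolding K_def by (rule keys_add)
  note def = coeffs_defined_atD[OF assms(1)] coeffs_defined_atD[OF assms(2)]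
  show "coeffs_defined_at (T + S) a"
    unfolding coeffs_defined_at_def lookup_add using ratfun_add(1)[OF def] by (intro ballI)
  show "plug_in (T + S) a t = plug_in T a t + plug_in S a t"
    unfolding plug_in_superset[OF K(1) TS] plug_in_superset[OF K(1,2)] plug_in_superset[OF K(1,3)] lookup_add
      ratfun_add(2)[OF def]
    by (simp add: of_rat_add distrib_right sum.distrib)
qed

text \<open>
  The functions of \<open>n\<close> and the variables that arise from the polynomials of the theorem; denominators
  may have zeros below \<open>m\<close>.
\<close>

definition representable :: "nat \<Rightarrow> (nat \<Rightarrow> (nat \<Rightarrow> complex) \<Rightarrow> complex) \<Rightarrow> bool" where
  "representable m f \<longleftrightarrow> (\<exists>T. in_variables T {1..m} \<and>
     (\<forall>n\<ge>m. coeffs_defined_at T (of_nat n) \<and> (\<forall>t. plug_in T (of_nat n) t = f n t)))"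

lemma representable_monomial:
  assumes "Poly_Mapping.keys e \<subseteq> {1..m}" "\<And>n. n \<ge> m \<Longrightarrow> ratfun_defined_at r (of_nat n)"
    and "\<And>n t. n \<ge> m \<Longrightarrow> f n t = of_rat (ratfun_eval r (of_nat n)) * monomial_value e t"
  shows "representable m f"
  unfolding representable_def
proof (intro exI conjI allI impI)
  define T where "T = Poly_Mapping.single e r"
  have keys: "Poly_Mapping.keys T \<subseteq> {e}" by (simp add: T_def)
  show "in_variables T {1..m}" using keys assms(1) by (auto simp: in_variables_def)
  fix n assume n: "n \<ge> m"
  show "coeffs_defined_at T (of_nat n)"
    using assms(2)[OF n] by (simp add: coeffs_defined_at_def T_def)
  show "plug_in T (of_nat n) t = f n t" for t
    unfolding plug_in_superset[OF _ keys, simplified] assms(3)[OF n] by (simp add: T_def)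
qed

lemma representable_add:
  assumes "representable m f" "representable m g"
  shows "representable m (\<lambda>n t. f n t + g n t)"
proof -
  obtain T where T: "in_variables T {1..m}" "\<forall>n\<ge>m. coeffs_defined_at T (of_nat n) \<and> (\<forall>t. plug_in T (of_nat n) t = f n t)"
    using assms(1) unfolding representable_def by (elim exE conjE)
  obtain S where S: "in_variables S {1..m}" "\<forall>n\<ge>m. coeffs_defined_at S (of_nat n) \<and> (\<forall>t. plug_in S (of_nat n) t = g n t)"
    using assms(2) unfolding representable_def by (elim exE conjE)
  show ?thesis unfolding representable_def
  proof (intro exI[of _ "T + S"] conjI allI impI)
    have "Poly_Mapping.keys (T + S) \<subseteq> Poly_Mapping.keys T \<union> Poly_Mapping.keys S" by (rule keys_add)
    then show "in_variables (T + S) {1..m}"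
      using T(1) S(1) unfolding in_variables_def by (meson UnE subsetD)
    fix n assume n: "n \<ge> m"
    have def: "coeffs_defined_at T (of_nat n)" "coeffs_defined_at S (of_nat n)" using T(2) S(2) n by simp_all
    show "coeffs_defined_at (T + S) (of_nat n)" by (rule plug_in_add(1)[OF def])
    show "plug_in (T + S) (of_nat n) t = f n t + g n t" for t
      unfolding plug_in_add(2)[OF def] using T(2) S(2) n by simp
  qed
qed

lemma representable_0: "representable m (\<lambda>n t. 0)"
  by (rule representable_monomial[of 0 _ 0]) (simp_all add: ratfun_zero)

lemma representable_sum:
  assumes "\<And>i. i \<in> I \<Longrightarrow> representable m (f i)"
  shows "representable m (\<lambda>n t. \<Sum>i\<in>I. f i n t)"
  using assms
proof (induction I rule: infinite_finite_induct)
  case (insert i I)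
  have "representable m (\<lambda>n t. f i n t + (\<Sum>i\<in>I. f i n t))"
    by (rule representable_add) (use insert in simp_all)
  then show ?case using insert.hyps by simp
qed (simp_all add: representable_0)

lemma representable_cong:
  assumes "representable m f" "\<And>n t. n \<ge> m \<Longrightarrow> f n t = g n t"
  shows "representable m g"
  using assms unfolding representable_def by simp

lemma representable_mult:
  assumes "representable m f" "representable m g"
  shows "representable m (\<lambda>n t. f n t * g n t)"
proof -
  obtain T where T: "in_variables T {1..m}" "\<forall>n\<ge>m. coeffs_defined_at T (of_nat n) \<and> (\<forall>t. plug_in T (of_nat n) t = f n t)"
    using assms(1) unfolding representable_def by (elim exE conjE)
  obtain S where S: "in_variables S {1..m}" "\<forall>n\<ge>m. coeffs_defined_at S (of_nat n) \<and> (\<forall>t. plug_in S (of_nat n) t = g n t)"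
    using assms(2) unfolding representable_def by (elim exE conjE)
  define h where "h = (\<lambda>e e' n t. of_rat (ratfun_eval (Poly_Mapping.lookup T e * Poly_Mapping.lookup S e') (of_nat n))
    * monomial_value (e + e') t)"
  have "representable m (h e e')" if "e \<in> Poly_Mapping.keys T" "e' \<in> Poly_Mapping.keys S" for e e'
  proof (rule representable_monomial)
    have "Poly_Mapping.keys e \<subseteq> {1..m}" "Poly_Mapping.keys e' \<subseteq> {1..m}"
      using T(1) S(1) that by (simp_all add: in_variables_def)
    then show "Poly_Mapping.keys (e + e') \<subseteq> {1..m}" using keys_add[of e e'] by (meson Un_least order_trans)
    show "ratfun_defined_at (Poly_Mapping.lookup T e * Poly_Mapping.lookup S e') (of_nat n)" if "n \<ge> m" for n
      using T(2) S(2) that by (intro ratfun_mult(1) coeffs_defined_atD) simp_all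
  qed (simp add: h_def)
  then have "representable m (\<lambda>n t. \<Sum>e\<in>Poly_Mapping.keys T. \<Sum>e'\<in>Poly_Mapping.keys S. h e e' n t)"
    by (intro representable_sum)
  then show ?thesis
  proof (rule representable_cong)
    fix n t assume n: "n \<ge> m"
    have def: "coeffs_defined_at T (of_nat n)" "coeffs_defined_at S (of_nat n)" using T(2) S(2) n by simp_all
    have "h e e' n t = (of_rat (ratfun_eval (Poly_Mapping.lookup T e) (of_nat n)) * monomial_value e t)
      * (of_rat (ratfun_eval (Poly_Mapping.lookup S e') (of_nat n)) * monomial_value e' t)" for e e'
      unfolding h_def ratfun_mult(2)[OF coeffs_defined_atD[OF def(1)] coeffs_defined_atD[OF def(2)]]
        monomial_value_add of_rat_mult by (simp only: mult_ac)
    then have "(\<Sum>e\<in>Poly_Mapping.keys T. \<Sum>e'\<in>Poly_Mapping.keys S. h e e' n t)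
      = plug_in T (of_nat n) t * plug_in S (of_nat n) t"
      unfolding plug_in_superset[OF finite_keys subset_refl] by (simp add: sum_product)
    then show "(\<Sum>e\<in>Poly_Mapping.keys T. \<Sum>e'\<in>Poly_Mapping.keys S. h e e' n t) = f n t * g n t"
      using T(2) S(2) n by simp
  qed
qed

lemma monomial_value_0: "monomial_value 0 t = 1"
  by (simp add: monomial_value_def)

lemma representable_rational_function:
  assumes "\<And>n. n \<ge> m \<Longrightarrow> poly q (of_nat n) \<noteq> 0"
  shows "representable m (\<lambda>n t. of_rat (poly p (of_nat n) / poly q (of_nat n)))"
proof (rule representable_monomial[of 0 _ "Fraction_Field.Fract p q"])
  show "ratfun_defined_at (Fraction_Field.Fract p q) (of_nat n)" if "n \<ge> m" for n
    by (rule ratfun_defined_atI[OF assms[OF that]])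
  show "of_rat (poly p (of_nat n) / poly q (of_nat n))
    = of_rat (ratfun_eval (Fraction_Field.Fract p q) (of_nat n)) * monomial_value 0 t" if "n \<ge> m" for n t
    unfolding ratfun_eval_Fract[OF assms[OF that]] monomial_value_0 by simp
qed simp

lemma representable_const: "representable m (\<lambda>n t. of_rat c)"
  using representable_rational_function[of m 1 "[:c:]"] by simp

lemma representable_degree: "representable m (\<lambda>n t. of_nat n)"
  using representable_rational_function[of m 1 "[:0, 1:]"] by simp

lemma representable_variable:
  assumes "k \<in> {1..m}"
  shows "representable m (\<lambda>n t. t k)"
proof (rule representable_monomial[of "Poly_Mapping.single k 1" _ "Fraction_Field.Fract 1 1"])
  show "ratfun_defined_at (Fraction_Field.Fract 1 1) (of_nat n)" for n by (rule ratfun_defined_atI) simp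
  have "ratfun_eval (Fraction_Field.Fract 1 1) (of_nat n) = 1" for n by (subst ratfun_eval_Fract) simp_all
  then show "t k = of_rat (ratfun_eval (Fraction_Field.Fract 1 1) (of_nat n)) * monomial_value (Poly_Mapping.single k 1) t" for n t
    by (simp add: monomial_value_def)
qed (use assms in simp)

lemma falling_eq_poly: "falling n r = of_rat (poly (\<Prod>i<r. [:- of_nat i, 1:]) (of_nat n))"
  by (induction r) (simp_all add: falling_Suc of_rat_mult of_rat_diff of_rat_minus poly_prod algebra_simps)

lemma representable_falling: "representable m (\<lambda>n t. falling n r)"
  using representable_rational_function[of m 1 "\<Prod>i<r. [:- of_nat i, 1:]"] by (simp add: falling_eq_poly)

lemma representable_inverse_falling:
  assumes "r \<le> m"
  shows "representable m (\<lambda>n t. inverse (falling n r))"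
proof -
  have "poly (\<Prod>i<r. [:- of_nat i, 1:]) (of_nat n) \<noteq> (0 :: rat)" if "n \<ge> m" for n
  proof
    assume "poly (\<Prod>i<r. [:- of_nat i, 1:]) (of_nat n) = (0 :: rat)"
    then have "falling n r = 0" by (simp add: falling_eq_poly)
    then show False using that assms by (simp add: falling_eq_0_iff)
  qed
  from representable_rational_function[OF this, where p = 1] show ?thesis
    by (simp add: falling_eq_poly of_rat_divide inverse_eq_divide)
qed

text \<open>
  The variable \<open>t (Suc j)\<close> is to carry the value of \<open>F\<close> on elements of type \<open>D j\<close>. The equation is
  multiplied by the falling factorial because it then also makes sense if the type needs more than
  \<open>n\<close> points.
\<close>

definition specialises :: "(nat \<Rightarrow> nat list) \<Rightarrow> nat \<Rightarrow> nat \<Rightarrow> ((nat \<Rightarrow> nat) \<Rightarrow> complex) \<Rightarrow> (nat \<Rightarrow> complex) \<Rightarrow> bool" where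
  "specialises D d n F t \<longleftrightarrow> central_character n F
     \<and> (\<forall>j\<in>{1..d}. scaled_value (D j) n F = falling n (sum_list (D j)) * t (Suc j))"

lemma representable_polynomial_in:
  assumes "polynomial_in ((\<lambda>j. scaled_value (D j)) ` {1..d}) f" "Suc d \<le> m"
  shows "\<exists>g. representable m g \<and> (\<forall>n F t. specialises D d n F t \<longrightarrow> f n F = g n t)"
    (is "\<exists>g. representable m g \<and> ?agree f g")
  using assms(1)
proof (induction rule: polynomial_in.induct)
  case (const r)
  show ?case by (intro exI[of _ "\<lambda>n t. of_rat r"] conjI representable_const) simp
next
  case degree
  show ?case by (intro exI[of _ "\<lambda>n t. of_nat n"] conjI representable_degree) simp
next
  case (gen f)
  then obtain j where j: "j \<in> {1..d}" "f = scaled_value (D j)" by (elim imageE)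
  show ?case
  proof (intro exI[of _ "\<lambda>n t. falling n (sum_list (D j)) * t (Suc j)"] conjI)
    show "representable m (\<lambda>n t. falling n (sum_list (D j)) * t (Suc j))"
      using j(1) assms(2) by (intro representable_mult representable_falling representable_variable) auto
  qed (use j in \<open>simp add: specialises_def\<close>)
next
  case (add f1 f2)
  obtain g1 where g1: "representable m g1" "?agree f1 g1" using add.IH(1) by (elim exE conjE)
  obtain g2 where g2: "representable m g2" "?agree f2 g2" using add.IH(2) by (elim exE conjE)
  show ?case
    by (intro exI[of _ "\<lambda>n t. g1 n t + g2 n t"] conjI representable_add[OF g1(1) g2(1)]) (use g1(2) g2(2) in simp)
next
  case (mult f1 f2)
  obtain g1 where g1: "representable m g1" "?agree f1 g1" using mult.IH(1) by (elim exE conjE)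
  obtain g2 where g2: "representable m g2" "?agree f2 g2" using mult.IH(2) by (elim exE conjE)
  show ?case
    by (intro exI[of _ "\<lambda>n t. g1 n t * g2 n t"] conjI representable_mult[OF g1(1) g2(1)]) (use g1(2) g2(2) in simp)
next
  case (cong f1 f2)
  obtain g1 where g1: "representable m g1" "?agree f1 g1" using cong.IH by (elim exE conjE)
  show ?case
    by (intro exI[of _ g1] conjI g1(1)) (use g1(2) cong.hyps(2) in \<open>simp add: specialises_def\<close>)
qed

lemma scaled_value_is_product_of_type:
  assumes "central_character n F" "is_product_of_type n L g"
  shows "scaled_value L n F = falling n (sum_list L) * F g"
  using assms(2) scaled_value_eq[OF assms(1)] unfolding is_product_of_type_def by (elim exE conjE) simp

text \<open>
  Both parts of the final theorem are instances: the list \<open>D j\<close> is the reduced form of the chosen type of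
  length \<open>j\<close>. The index starts at 1 because the type of length 0 is the identity, where \<open>F\<close> is 1.
\<close>

theorem character_values_from_generating_types:
  assumes "m > 0"
    and D: "\<And>j. j \<in> {1..m - 1} \<Longrightarrow> excess (D j) = j \<and> (\<forall>l\<in>set (D j). 2 \<le> l)"
    and L: "\<forall>l\<in>set L. 2 \<le> l" "sum_list L \<le> m"
  shows "\<exists>T. in_variables T {1..m} \<and> (\<forall>n\<ge>m. coeffs_defined_at T (of_nat n) \<and>
    (\<forall>F g t. central_character n F \<longrightarrow> is_product_of_type n L g \<longrightarrow>
      (\<forall>j\<in>{1..m - 1}. is_product_of_type n (D j) (t (Suc j))) \<longrightarrow>
      F g = plug_in T (of_nat n) (\<lambda>k. F (t k))))"
proof -
  have "excess L \<le> m - 1"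
  proof (cases "L = []")
    case False
    have "0 \<notin> set L" using L(1) by auto
    then have "excess L + length L = sum_list L" by (rule excess_add_length)
    moreover have "1 \<le> length L" using False by (cases L) simp_all
    ultimately show ?thesis using L(2) by simp
  qed simp
  then have "cycle_polys (m - 1) (scaled_value L)"
    by (rule cycle_polys_mono[OF scaled_value_in_cycle_polys[OF L(1)]])
  then have "polynomial_in ((\<lambda>j. scaled_value (D j)) ` {1..m - 1}) (scaled_value L)"
    by (rule cycle_polys_change_generators[OF _ D])
  moreover have "Suc (m - 1) \<le> m" using assms(1) by simp
  ultimately have "\<exists>h. representable m h \<and> (\<forall>n F t. specialises D (m - 1) n F t \<longrightarrow> scaled_value L n F = h n t)"
    by (rule representable_polynomial_in)
  then obtain h where h: "representable m h"
    "\<forall>n F t. specialises D (m - 1) n F t \<longrightarrow> scaled_value L n F = h n t"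
    by (elim exE conjE)
  have "representable m (\<lambda>n t. inverse (falling n (sum_list L)) * h n t)"
    by (rule representable_mult[OF representable_inverse_falling[OF L(2)] h(1)])
  then obtain T where T: "in_variables T {1..m}" "\<forall>n\<ge>m. coeffs_defined_at T (of_nat n) \<and>
      (\<forall>t. plug_in T (of_nat n) t = inverse (falling n (sum_list L)) * h n t)"
    unfolding representable_def by (elim exE conjE)
  show ?thesis
  proof (intro exI[of _ T] conjI allI impI)
    show "in_variables T {1..m}" by (rule T(1))
    fix n assume n: "n \<ge> m"
    then show "coeffs_defined_at T (of_nat n)" using T(2) by simp
    fix F :: "(nat \<Rightarrow> nat) \<Rightarrow> complex" and g :: "nat \<Rightarrow> nat" and t :: "nat \<Rightarrow> nat \<Rightarrow> nat"
    assume F: "central_character n F" and g: "is_product_of_type n L g"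
      and t: "\<forall>j\<in>{1..m - 1}. is_product_of_type n (D j) (t (Suc j))"
    have "specialises D (m - 1) n F (\<lambda>k. F (t k))" unfolding specialises_def
    proof (intro conjI ballI F)
      fix j assume "j \<in> {1..m - 1}"
      then have "is_product_of_type n (D j) (t (Suc j))" using t by simp
      then show "scaled_value (D j) n F = falling n (sum_list (D j)) * F (t (Suc j))"
        by (rule scaled_value_is_product_of_type[OF F])
    qed
    then have "scaled_value L n F = h n (\<lambda>k. F (t k))" using h(2) by simp
    then have "falling n (sum_list L) * F g = h n (\<lambda>k. F (t k))"
      unfolding scaled_value_is_product_of_type[OF F g] .
    moreover have "falling n (sum_list L) \<noteq> 0" using n L(2) by (simp add: falling_eq_0_iff)
    ultimately have "F g = inverse (falling n (sum_list L)) * h n (\<lambda>k. F (t k))"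
      by (simp add: field_simps)
    then show "F g = plug_in T (of_nat n) (\<lambda>k. F (t k))" using T(2) n by simp
  qed
qed

text \<open>
  Sorting merely fixes one order of the parts.
\<close>

definition nontrivial_parts :: "nat multiset \<Rightarrow> nat list" where
  "nontrivial_parts \<mu> = sorted_list_of_multiset (filter_mset (\<lambda>i. 2 \<le> i) \<mu>)"

lemma mset_nontrivial_parts: "mset (nontrivial_parts \<mu>) = filter_mset (\<lambda>i. 2 \<le> i) \<mu>"
  by (simp add: nontrivial_parts_def)

lemma nontrivial_parts_ge_2: "\<forall>l\<in>set (nontrivial_parts \<mu>). 2 \<le> l"
  unfolding set_mset_mset[symmetric] mset_nontrivial_parts by simp

lemma sum_nontrivial_parts: "sum_list (nontrivial_parts \<mu>) \<le> sum_mset \<mu>"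
proof -
  have "sum_list (nontrivial_parts \<mu>) = sum_mset (filter_mset (\<lambda>i. 2 \<le> i) \<mu>)"
    unfolding sum_mset_sum_list[symmetric] mset_nontrivial_parts ..
  also have "\<dots> \<le> sum_mset \<mu>" by (induction \<mu>) auto
  finally show ?thesis .
qed

lemma is_product_of_reduced_type:
  assumes "g \<in> carrier (sym_group n)" "has_reduced_cycle_type n \<mu> g"
  shows "is_product_of_type n (nontrivial_parts \<mu>) g"
  using assms unfolding sym_group_carrier has_reduced_cycle_type_def
  by (intro is_product_of_cycle_type) (simp_all add: mset_nontrivial_parts)

lemma has_cycle_type_reduced:
  assumes "has_cycle_type n \<mu> g"
  shows "has_reduced_cycle_type n \<mu> g"
proof -
  have "filter_mset (\<lambda>i. 2 \<le> i) (replicate_mset k (1 :: nat)) = {#}" for k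
    by (induction k) simp_all
  then show ?thesis using assms by (simp add: has_cycle_type_def has_reduced_cycle_type_def)
qed

lemma is_product_of_cycle:
  assumes "is_cycle_of_length n k c"
  shows "is_product_of_type n [k] c"
proof -
  obtain cs where cs: "distinct cs" "length cs = k" "set cs \<subseteq> {1..n}" "c = cycle_of_list cs"
    using assms unfolding is_cycle_of_length_def by (elim exE conjE)
  show ?thesis unfolding is_product_of_type_def
    by (rule exI[of _ "[cs]"]) (use cs in simp)
qed

text \<open>
  The condition is imposed on all elements of the type; it is applied to one explicit element, in the
  smallest symmetric group in which the type occurs.
\<close>

lemma type_of_length_excess:
  assumes "type_of_length j \<mu>"
  shows "excess (nontrivial_parts \<mu>) = j"
proof -
  define L where "L = nontrivial_parts \<mu>"
  define n where "n = sum_list L"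
  define css where "css = chop L [1..<Suc n]"
  define g where "g = product_of_cycles css"
  have len: "length [1..<Suc n] = sum_list L" by (simp add: n_def del: upt_Suc)
  have css: "distinct (concat css)" "set (concat css) = {1..n}" "map length css = L"
    unfolding css_def chop_concat_props(2)[OF distinct_upt len] map_length_chop[OF len]
    using chop_concat_props(1)[OF distinct_upt len] by auto
  have "0 \<notin> set L" using nontrivial_parts_ge_2[of \<mu>] by (auto simp: L_def)
  then have ne: "[] \<notin> set css" unfolding css(3)[symmetric] by auto
  have "g permutes {1..n}" unfolding g_def by (rule product_of_cycles_permutes') (simp only: css(2))
  moreover have "cycle_type n g = mset L"
    unfolding g_def cycle_type_product_of_cycles[OF css(1) ne css(2)] css(3) ..
  then have "has_reduced_cycle_type n \<mu> g"
    by (simp add: has_reduced_cycle_type_def L_def mset_nontrivial_parts filter_filter_mset)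
  moreover have "min_transpositions j g" if "g \<in> carrier (sym_group n)" "has_reduced_cycle_type n \<mu> g"
    using assms that unfolding type_of_length_def by simp
  ultimately have g: "min_transpositions j g" unfolding sym_group_carrier by simp
  then have "excess L \<le> j"
    using excess_le_swapidseq[OF css(1) ne] unfolding min_transpositions_def g_def css(3) by simp
  moreover have "swapidseq (excess L) g"
    using swapidseq_product_of_cycles[of css] distinct_in_concat[OF css(1)] unfolding g_def css(3) by simp
  then have "\<not> excess L < j" using g unfolding min_transpositions_def by metis
  ultimately show ?thesis unfolding L_def by simp
qed

theorem theoremA:
  fixes m :: nat and lam :: "nat multiset"
  assumes "m > 0" and "partition_of lam m"
  shows "(\<exists>T :: ratfun_mpoly. in_variables T {1..m} \<and>
      (\<forall>n\<ge>m. coeffs_defined_at T (of_nat n) \<and>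
        (\<forall>\<chi> g c. irreducible_character (sym_group n) \<chi> \<longrightarrow>
           g \<in> carrier (sym_group n) \<longrightarrow> has_cycle_type n lam g \<longrightarrow>
           (\<forall>k\<in>{1..m}. is_cycle_of_length n k (c k)) \<longrightarrow>
           normalized_character n \<chi> g
             = plug_in T (of_nat n) (\<lambda>k. normalized_character n \<chi> (c k)))))
    \<and>
    (\<forall>D :: nat \<Rightarrow> nat multiset. (\<forall>k\<in>{1..m}. type_of_length (k - 1) (D k)) \<longrightarrow>
      (\<exists>T :: ratfun_mpoly. in_variables T {1..m} \<and>
        (\<forall>n\<ge>m. (\<forall>k\<in>{1..m}. occurs_in_sym n (D k)) \<longrightarrow>
          coeffs_defined_at T (of_nat n) \<and>
          (\<forall>\<chi> g d. irreducible_character (sym_group n) \<chi> \<longrightarrow>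
             g \<in> carrier (sym_group n) \<longrightarrow> has_cycle_type n lam g \<longrightarrow>
             (\<forall>k\<in>{1..m}. d k \<in> carrier (sym_group n) \<and> has_reduced_cycle_type n (D k) (d k)) \<longrightarrow>
             normalized_character n \<chi> g
               = plug_in T (of_nat n) (\<lambda>k. normalized_character n \<chi> (d k))))))"
proof -
  define L where "L = nontrivial_parts lam"
  have L: "\<forall>l\<in>set L. 2 \<le> l" "sum_list L \<le> m"
    using nontrivial_parts_ge_2 sum_nontrivial_parts[of lam] assms(2)
    by (simp_all add: L_def partition_of_def)
  have g: "is_product_of_type n L g" if "g \<in> carrier (sym_group n)" "has_cycle_type n lam g" for n g
    unfolding L_def by (rule is_product_of_reduced_type[OF that(1) has_cycle_type_reduced[OF that(2)]])
  show ?thesis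
  proof (intro conjI allI impI)
    have "\<exists>T. in_variables T {1..m} \<and> (\<forall>n\<ge>m. coeffs_defined_at T (of_nat n) \<and>
      (\<forall>F g t. central_character n F \<longrightarrow> is_product_of_type n L g \<longrightarrow>
        (\<forall>j\<in>{1..m - 1}. is_product_of_type n [Suc j] (t (Suc j))) \<longrightarrow>
        F g = plug_in T (of_nat n) (\<lambda>k. F (t k))))"
      by (rule character_values_from_generating_types[OF assms(1) _ L]) auto
    then obtain T where T: "in_variables T {1..m}" "\<forall>n\<ge>m. coeffs_defined_at T (of_nat n) \<and>
      (\<forall>F g t. central_character n F \<longrightarrow> is_product_of_type n L g \<longrightarrow>
        (\<forall>j\<in>{1..m - 1}. is_product_of_type n [Suc j] (t (Suc j))) \<longrightarrow>
        F g = plug_in T (of_nat n) (\<lambda>k. F (t k)))"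
      by (elim exE conjE)
    show "\<exists>T :: ratfun_mpoly. in_variables T {1..m} \<and>
      (\<forall>n\<ge>m. coeffs_defined_at T (of_nat n) \<and>
        (\<forall>\<chi> g c. irreducible_character (sym_group n) \<chi> \<longrightarrow>
           g \<in> carrier (sym_group n) \<longrightarrow> has_cycle_type n lam g \<longrightarrow>
           (\<forall>k\<in>{1..m}. is_cycle_of_length n k (c k)) \<longrightarrow>
           normalized_character n \<chi> g
             = plug_in T (of_nat n) (\<lambda>k. normalized_character n \<chi> (c k))))"
    proof (intro exI[of _ T] conjI allI impI)
      show "in_variables T {1..m}" by (rule T(1))
      fix n assume n: "n \<ge> m"
      then show "coeffs_defined_at T (of_nat n)" using T(2) by simp
      fix \<chi> g c
      assume \<chi>: "irreducible_character (sym_group n) \<chi>" and gc: "g \<in> carrier (sym_group n)" "has_cycle_type n lam g"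
        and c: "\<forall>k\<in>{1..m}. is_cycle_of_length n k (c k)"
      have "\<forall>j\<in>{1..m - 1}. is_product_of_type n [Suc j] (c (Suc j))"
        using c by (intro ballI is_product_of_cycle) auto
      then show "normalized_character n \<chi> g = plug_in T (of_nat n) (\<lambda>k. normalized_character n \<chi> (c k))"
        using T(2)[rule_format, OF n] irreducible_character_is_central[OF \<chi>] g[OF gc] by simp
    qed
  next
    fix D :: "nat \<Rightarrow> nat multiset" assume D: "\<forall>k\<in>{1..m}. type_of_length (k - 1) (D k)"
    have "\<exists>T. in_variables T {1..m} \<and> (\<forall>n\<ge>m. coeffs_defined_at T (of_nat n) \<and>
      (\<forall>F g t. central_character n F \<longrightarrow> is_product_of_type n L g \<longrightarrow>
        (\<forall>j\<in>{1..m - 1}. is_product_of_type n (nontrivial_parts (D (Suc j))) (t (Suc j))) \<longrightarrow>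
        F g = plug_in T (of_nat n) (\<lambda>k. F (t k))))"
    proof (rule character_values_from_generating_types[OF assms(1) _ L], intro conjI nontrivial_parts_ge_2 type_of_length_excess)
      fix j assume "j \<in> {1..m - 1}"
      then have "Suc j \<in> {1..m}" by auto
      then show "type_of_length j (D (Suc j))" using D by fastforce
    qed
    then obtain T where T: "in_variables T {1..m}" "\<forall>n\<ge>m. coeffs_defined_at T (of_nat n) \<and>
      (\<forall>F g t. central_character n F \<longrightarrow> is_product_of_type n L g \<longrightarrow>
        (\<forall>j\<in>{1..m - 1}. is_product_of_type n (nontrivial_parts (D (Suc j))) (t (Suc j))) \<longrightarrow>
        F g = plug_in T (of_nat n) (\<lambda>k. F (t k)))"
      by (elim exE conjE)
    show "\<exists>T :: ratfun_mpoly. in_variables T {1..m} \<and>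
        (\<forall>n\<ge>m. (\<forall>k\<in>{1..m}. occurs_in_sym n (D k)) \<longrightarrow>
          coeffs_defined_at T (of_nat n) \<and>
          (\<forall>\<chi> g d. irreducible_character (sym_group n) \<chi> \<longrightarrow>
             g \<in> carrier (sym_group n) \<longrightarrow> has_cycle_type n lam g \<longrightarrow>
             (\<forall>k\<in>{1..m}. d k \<in> carrier (sym_group n) \<and> has_reduced_cycle_type n (D k) (d k)) \<longrightarrow>
             normalized_character n \<chi> g
               = plug_in T (of_nat n) (\<lambda>k. normalized_character n \<chi> (d k))))"
    proof (intro exI[of _ T] conjI allI impI)
      show "in_variables T {1..m}" by (rule T(1))
      fix n assume n: "n \<ge> m"
      then show "coeffs_defined_at T (of_nat n)" using T(2) by simp
      fix \<chi> g d
      assume \<chi>: "irreducible_character (sym_group n) \<chi>" and gc: "g \<in> carrier (sym_group n)" "has_cycle_type n lam g"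
        and d: "\<forall>k\<in>{1..m}. d k \<in> carrier (sym_group n) \<and> has_reduced_cycle_type n (D k) (d k)"
      have "\<forall>j\<in>{1..m - 1}. is_product_of_type n (nontrivial_parts (D (Suc j))) (d (Suc j))"
      proof
        fix j assume "j \<in> {1..m - 1}"
        then have "Suc j \<in> {1..m}" by auto
        then show "is_product_of_type n (nontrivial_parts (D (Suc j))) (d (Suc j))"
          using d by (intro is_product_of_reduced_type) simp_all
      qed
      then show "normalized_character n \<chi> g = plug_in T (of_nat n) (\<lambda>k. normalized_character n \<chi> (d k))"
        using T(2)[rule_format, OF n] irreducible_character_is_central[OF \<chi>] g[OF gc] by simp
    qed
  qed
qed

end
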